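(* Let $G=\prod_{\mathfrak U}G_n$ be an ultraproduct of finite groups. Then the following are equivalent: (a) Every internal product-free subset of $G$ has measure zero. (b) The universal internal compactification $\mathrm{int}\,bG$ of $G$ is the trivial group. (c) If $A$ and $B$ are internal non-null subsets of $G$, then $\mu(AB)=1$. (d) If $A,B$ and $C$ are internal non-null subsets of $G$, then $G=ABC$. (e) There is no internal proper finite quotient of $G$ nor an internal proper abelian one; that is, there is no internal normal subgroup $N\neq G$ of $G$ such that $G/N$ is finite or abelian. (f) The group $G$ is ultra quasirandom.
   Context: Ultraproducts are taken over $\mathbb N$ with respect to a non-principal ultrafilter $\mathfrak U$. A subset $X$ of $G=\prod_{\mathfrak U}G_n$ is internal if $X=\prod_{\mathfrak U}X_n$ for some subsets $X_n\subseteq G_n$. The measure of an internal set $A=\prod_{\mathfrak U}A_n$ is $\mu(A)=\mathrm{st}(|A|/|G|)$, i.e. the limit of $|A_n|/|G_n|$ along $\mathfrak U$. An internal set is null if it has measure zero, and non-null otherwise. A subset $A$ of a group is product-free if there are no $x,y,z\in A$ with $xy=z$. For subsets, $AB=\{ab:a\in A,b\in B\}$, and similarly for $ABC$. An internal compactification of $G$ is a compact Hausdorff topological group $\mathcal H$ together with a group homomorphism $\rho:G\to\mathcal H$ with dense image such that for any two disjoint closed subsets $C_1,C_2$ of $\mathcal H$ there is an internal subset $C$ of $G$ with $\rho^{-1}(C_1)\subseteq C$ and $\rho^{-1}(C_2)\subseteq G\setminus C$. (This is a definable group compactification with respect to a structure on $G$ whose definable subsets of $G$ are exactly the internal ones.)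 The universal internal compactification $b:G\to\mathrm{int}\,bG$ is the internal compactification such that for every internal compactification $\rho:G\to\mathcal H$ there is a unique continuous surjective homomorphism $\tau:\mathrm{int}\,bG\to\mathcal H$ with $\rho=\tau\circ b$; it exists and is unique up to isomorphism. For $d\ge1$, a group is $d$-quasirandom if all its non-trivial (finite-dimensional complex) unitary representations have dimension at least $d$. The ultraproduct $G=\prod_{\mathfrak U}G_n$ is ultra quasirandom if for every $d\ge 1$ the groups $G_n$ are $d$-quasirandom for $\mathfrak U$-almost all $n$ (i.e. for a set of $n$ in $\mathfrak U$). *)

theory Defs
  imports
    "HOL-Analysis.T1_Spaces"
    "HOL-Algebra.Product_Groups"
    "Jordan_Normal_Form.Schur_Decomposition"
begin

section \<open>Ultraproducts, internal sets and their measure\<close>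

definition nonprincipal_ultrafilter :: "nat filter \<Rightarrow> bool" where
  "nonprincipal_ultrafilter U \<longleftrightarrow>
     U \<noteq> bot \<and>
     (\<forall>P. eventually P U \<or> eventually (\<lambda>n. \<not> P n) U) \<and>
     (\<forall>n. U \<noteq> principal {n})"

text \<open>The ultraproduct is realised as the quotient of the full product group by the normal subgroup
  of sequences that are \<open>U\<close>-almost everywhere trivial; its elements are therefore the equivalence
  classes of sequences modulo \<open>U\<close>-almost everywhere equality.\<close>

definition ultra_kernel :: "nat filter \<Rightarrow> (nat \<Rightarrow> 'a monoid) \<Rightarrow> (nat \<Rightarrow> 'a) set" where
  "ultra_kernel U G =
     {f \<in> carrier (product_group UNIV G). eventually (\<lambda>n. f n = \<one>\<^bsub>G n\<^esub>) U}"

definition ultraproduct :: "nat filter \<Rightarrow> (nat \<Rightarrow> 'a monoid) \<Rightarrow> (nat \<Rightarrow> 'a) set monoid" where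
  "ultraproduct U G = product_group UNIV G Mod ultra_kernel U G"

definition internal_product ::
    "nat filter \<Rightarrow> (nat \<Rightarrow> 'a monoid) \<Rightarrow> (nat \<Rightarrow> 'a set) \<Rightarrow> (nat \<Rightarrow> 'a) set set" where
  "internal_product U G X =
     {ultra_kernel U G #>\<^bsub>product_group UNIV G\<^esub> f | f.
        f \<in> carrier (product_group UNIV G) \<and> eventually (\<lambda>n. f n \<in> X n) U}"

definition internal :: "nat filter \<Rightarrow> (nat \<Rightarrow> 'a monoid) \<Rightarrow> (nat \<Rightarrow> 'a) set set \<Rightarrow> bool" where
  "internal U G A \<longleftrightarrow> (\<exists>X. (\<forall>n. X n \<subseteq> carrier (G n)) \<and> A = internal_product U G X)"

text \<open>The value is meaningful for internal sets only; existence and independence of the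
  representing sequence are shown in \<open>tendsto_internal_measure\<close> below.\<close>

definition internal_measure ::
    "nat filter \<Rightarrow> (nat \<Rightarrow> 'a monoid) \<Rightarrow> (nat \<Rightarrow> 'a) set set \<Rightarrow> real" where
  "internal_measure U G A =
     (THE r. \<exists>X. (\<forall>n. X n \<subseteq> carrier (G n)) \<and> A = internal_product U G X \<and>
        ((\<lambda>n. real (card (X n)) / real (card (carrier (G n)))) \<longlongrightarrow> r) U)"

definition non_null :: "nat filter \<Rightarrow> (nat \<Rightarrow> 'a monoid) \<Rightarrow> (nat \<Rightarrow> 'a) set set \<Rightarrow> bool" where
  "non_null U G A \<longleftrightarrow> internal_measure U G A \<noteq> 0"

definition product_free :: "('g, 'm) monoid_scheme \<Rightarrow> 'g set \<Rightarrow> bool" where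
  "product_free G A \<longleftrightarrow> \<not> (\<exists>x\<in>A. \<exists>y\<in>A. \<exists>z\<in>A. x \<otimes>\<^bsub>G\<^esub> y = z)"


section \<open>Internal compactifications\<close>

definition compact_hausdorff_group :: "'h monoid \<Rightarrow> 'h topology \<Rightarrow> bool" where
  "compact_hausdorff_group H T \<longleftrightarrow>
     group H \<and> topspace T = carrier H \<and>
     continuous_map (prod_topology T T) T (\<lambda>(x, y). x \<otimes>\<^bsub>H\<^esub> y) \<and>
     continuous_map T T (\<lambda>x. inv\<^bsub>H\<^esub> x) \<and>
     compact_space T \<and> Hausdorff_space T"

definition internal_compactification ::
    "nat filter \<Rightarrow> (nat \<Rightarrow> 'a monoid) \<Rightarrow> 'h monoid \<Rightarrow> 'h topology \<Rightarrow>
     ((nat \<Rightarrow> 'a) set \<Rightarrow> 'h) \<Rightarrow> bool" where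
  "internal_compactification U G H T \<rho> \<longleftrightarrow>
     compact_hausdorff_group H T \<and>
     \<rho> \<in> hom (ultraproduct U G) H \<and>
     T closure_of (\<rho> ` carrier (ultraproduct U G)) = carrier H \<and>
     (\<forall>C\<^sub>1 C\<^sub>2. closedin T C\<^sub>1 \<and> closedin T C\<^sub>2 \<and> C\<^sub>1 \<inter> C\<^sub>2 = {} \<longrightarrow>
        (\<exists>C. internal U G C \<and>
             {g \<in> carrier (ultraproduct U G). \<rho> g \<in> C\<^sub>1} \<subseteq> C \<and>
             {g \<in> carrier (ultraproduct U G). \<rho> g \<in> C\<^sub>2} \<subseteq> carrier (ultraproduct U G) - C))"

text \<open>One cannot quantify over all types inside a formula, so the universal property below is
  stated for compactifications whose points are sets of sets of elements of the ultraproduct.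
  This loses nothing: a Hausdorff space with a dense image of the ultraproduct embeds into this
  type, so every internal compactification over any type has an isomorphic copy there
  (\<open>internal_compactification_copy\<close>), and the universal property holds over all types
  (\<open>universal_internal_compactification_any_type\<close>).\<close>

type_synonym 'a compactification_point = "(nat \<Rightarrow> 'a) set set set"

definition compactification_map ::
    "nat filter \<Rightarrow> (nat \<Rightarrow> 'a monoid) \<Rightarrow>
     'h monoid \<Rightarrow> 'h topology \<Rightarrow> ((nat \<Rightarrow> 'a) set \<Rightarrow> 'h) \<Rightarrow>
     'k monoid \<Rightarrow> 'k topology \<Rightarrow> ((nat \<Rightarrow> 'a) set \<Rightarrow> 'k) \<Rightarrow> ('h \<Rightarrow> 'k) \<Rightarrow> bool" where
  "compactification_map U G H T b K S \<rho> \<tau> \<longleftrightarrow>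
     \<tau> \<in> hom H K \<and> continuous_map T S \<tau> \<and> \<tau> ` carrier H = carrier K \<and>
     (\<forall>g\<in>carrier (ultraproduct U G). \<rho> g = \<tau> (b g))"

text \<open>\<open>extensional\<close> makes uniqueness of \<open>\<tau>\<close> refer to its values on \<open>H\<close> only.\<close>

definition universal_internal_compactification ::
    "nat filter \<Rightarrow> (nat \<Rightarrow> 'a monoid) \<Rightarrow>
     'a compactification_point monoid \<Rightarrow> 'a compactification_point topology \<Rightarrow>
     ((nat \<Rightarrow> 'a) set \<Rightarrow> 'a compactification_point) \<Rightarrow> bool" where
  "universal_internal_compactification U G H T b \<longleftrightarrow>
     internal_compactification U G H T b \<and>
     (\<forall>(K :: 'a compactification_point monoid) S \<rho>.
        internal_compactification U G K S \<rho> \<longrightarrow>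
        (\<exists>!\<tau>. \<tau> \<in> extensional (carrier H) \<and> compactification_map U G H T b K S \<rho> \<tau>))"


section \<open>Quasirandomness\<close>

definition unitary_group :: "nat \<Rightarrow> complex mat monoid" where
  "unitary_group m =
     \<lparr>carrier = {A \<in> carrier_mat m m. A * mat_adjoint A = 1\<^sub>m m \<and> mat_adjoint A * A = 1\<^sub>m m},
      monoid.mult = (*), one = 1\<^sub>m m\<rparr>"

text \<open>A unitary representation of dimension \<open>m\<close> is a homomorphism to \<open>unitary_group m\<close>; it is
  non-trivial if some group element does not act as the identity.\<close>

definition quasirandom :: "nat \<Rightarrow> ('g, 'm) monoid_scheme \<Rightarrow> bool" where
  "quasirandom d G \<longleftrightarrow>
     (\<forall>m. \<forall>\<pi>\<in>hom G (unitary_group m). (\<exists>g\<in>carrier G. \<pi> g \<noteq> 1\<^sub>m m) \<longrightarrow> d \<le> m)"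

definition ultra_quasirandom :: "nat filter \<Rightarrow> (nat \<Rightarrow> 'a monoid) \<Rightarrow> bool" where
  "ultra_quasirandom U G \<longleftrightarrow> (\<forall>d\<ge>1. eventually (\<lambda>n. quasirandom d (G n)) U)"

section \<open>Adequacy of the definitions\<close>

lemma ultra_kernel_normal:
  assumes U: "nonprincipal_ultrafilter U" and G: "\<And>n. group (G n)"
  shows "ultra_kernel U G \<lhd> product_group UNIV G"
proof -
  interpret P: group "product_group UNIV G" by (simp add: G)
  have mono: "monoid (G n)" for n using G group.is_monoid by blast
  have sub: "subgroup (ultra_kernel U G) (product_group UNIV G)"
  proof (rule P.subgroupI)
    show "ultra_kernel U G \<subseteq> carrier (product_group UNIV G)"
      by (auto simp: ultra_kernel_def)
    have "\<one>\<^bsub>product_group UNIV G\<^esub> \<in> ultra_kernel U G"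
      using P.one_closed by (simp add: ultra_kernel_def)
    then show "ultra_kernel U G \<noteq> {}" by blast
    show "inv\<^bsub>product_group UNIV G\<^esub> a \<in> ultra_kernel U G" if a: "a \<in> ultra_kernel U G" for a
    proof -
      have ac: "a \<in> carrier (product_group UNIV G)" and ev: "eventually (\<lambda>n. a n = \<one>\<^bsub>G n\<^esub>) U"
        using a by (auto simp: ultra_kernel_def)
      have i: "inv\<^bsub>product_group UNIV G\<^esub> a = (\<lambda>n\<in>UNIV. inv\<^bsub>G n\<^esub> a n)"
        using ac G by (intro inv_product_group) auto
      have "eventually (\<lambda>n. (inv\<^bsub>product_group UNIV G\<^esub> a) n = \<one>\<^bsub>G n\<^esub>) U"
        using ev by (rule eventually_mono) (simp add: i monoid.inv_one[OF mono])
      then show ?thesis using P.inv_closed[OF ac] by (simp add: ultra_kernel_def)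
    qed
    show "a \<otimes>\<^bsub>product_group UNIV G\<^esub> b \<in> ultra_kernel U G"
      if a: "a \<in> ultra_kernel U G" and b: "b \<in> ultra_kernel U G" for a b
    proof -
      have "eventually (\<lambda>n. a n = \<one>\<^bsub>G n\<^esub>) U" "eventually (\<lambda>n. b n = \<one>\<^bsub>G n\<^esub>) U"
        using a b by (simp_all add: ultra_kernel_def)
      then have "eventually (\<lambda>n. (a \<otimes>\<^bsub>product_group UNIV G\<^esub> b) n = \<one>\<^bsub>G n\<^esub>) U"
        by eventually_elim (simp add: monoid.l_one[OF mono] monoid.one_closed[OF mono])
      then show ?thesis using P.m_closed[of a b] a b unfolding ultra_kernel_def by blast
    qed
  qed
  show ?thesis
    unfolding P.normal_inv_iff
  proof (intro conjI sub ballI)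
    fix x h assume x: "x \<in> carrier (product_group UNIV G)" and h: "h \<in> ultra_kernel U G"
    have i: "inv\<^bsub>product_group UNIV G\<^esub> x = (\<lambda>n\<in>UNIV. inv\<^bsub>G n\<^esub> x n)"
      using x G by (intro inv_product_group) auto
    have xn: "x n \<in> carrier (G n)" for n using x by auto
    have hc: "h \<in> carrier (product_group UNIV G)" and ev: "eventually (\<lambda>n. h n = \<one>\<^bsub>G n\<^esub>) U"
      using h by (auto simp: ultra_kernel_def)
    have "eventually (\<lambda>n. (x \<otimes>\<^bsub>product_group UNIV G\<^esub> h
              \<otimes>\<^bsub>product_group UNIV G\<^esub> inv\<^bsub>product_group UNIV G\<^esub> x) n = \<one>\<^bsub>G n\<^esub>) U"
      using ev by (rule eventually_mono)
        (simp add: i monoid.r_one[OF mono] xn group.r_inv[OF G])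
    moreover have "x \<otimes>\<^bsub>product_group UNIV G\<^esub> h
              \<otimes>\<^bsub>product_group UNIV G\<^esub> inv\<^bsub>product_group UNIV G\<^esub> x \<in> carrier (product_group UNIV G)"
      using P.m_closed[OF P.m_closed[OF x hc] P.inv_closed[OF x]] .
    ultimately show "x \<otimes>\<^bsub>product_group UNIV G\<^esub> h
              \<otimes>\<^bsub>product_group UNIV G\<^esub> inv\<^bsub>product_group UNIV G\<^esub> x \<in> ultra_kernel U G"
      unfolding ultra_kernel_def by blast
  qed
qed

lemma group_ultraproduct:
  assumes "nonprincipal_ultrafilter U" and "\<And>n. group (G n)"
  shows "group (ultraproduct U G)"
  unfolding ultraproduct_def by (rule normal.factorgroup_is_group[OF ultra_kernel_normal[OF assms]])

lemma ultra_coset_eqD: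
  assumes U: "nonprincipal_ultrafilter U" and G: "\<And>n. group (G n)"
    and f: "f \<in> carrier (product_group UNIV G)" and g: "g \<in> carrier (product_group UNIV G)"
    and eq: "ultra_kernel U G #>\<^bsub>product_group UNIV G\<^esub> f
           = ultra_kernel U G #>\<^bsub>product_group UNIV G\<^esub> g"
  shows "eventually (\<lambda>n. f n = g n) U"
proof -
  interpret P: group "product_group UNIV G" by (simp add: G)
  have sub: "subgroup (ultra_kernel U G) (product_group UNIV G)"
    using ultra_kernel_normal[OF U G] by (rule normal_imp_subgroup)
  have "f \<in> ultra_kernel U G #>\<^bsub>product_group UNIV G\<^esub> g"
    using P.rcos_self[OF f sub] eq by simp
  then obtain k where k: "k \<in> ultra_kernel U G" "f = k \<otimes>\<^bsub>product_group UNIV G\<^esub> g"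
    unfolding r_coset_def by blast
  have gn: "g n \<in> carrier (G n)" for n using g by auto
  have "eventually (\<lambda>n. k n = \<one>\<^bsub>G n\<^esub>) U" using k(1) by (simp add: ultra_kernel_def)
  then show ?thesis
    by (rule eventually_mono)
      (simp add: k(2) monoid.l_one[OF group.is_monoid[OF G]] gn)
qed

lemma internal_product_subsetD:
  assumes U: "nonprincipal_ultrafilter U" and G: "\<And>n. group (G n)"
    and X: "\<And>n. X n \<subseteq> carrier (G n)"
    and sub: "internal_product U G X \<subseteq> internal_product U G Y"
  shows "eventually (\<lambda>n. X n \<subseteq> Y n) U"
proof (rule ccontr)
  assume "\<not> ?thesis"
  then have ev: "eventually (\<lambda>n. \<not> X n \<subseteq> Y n) U"
    using U unfolding nonprincipal_ultrafilter_def by blast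
  define f where "f n = (if X n \<subseteq> Y n then \<one>\<^bsub>G n\<^esub> else SOME x. x \<in> X n - Y n)" for n
  have fn: "f n \<in> X n - Y n" if "\<not> X n \<subseteq> Y n" for n
    unfolding f_def using that by simp (metis (mono_tags, lifting) someI_ex subsetI)
  have "f n \<in> carrier (G n)" for n
    using fn[of n] X[of n] monoid.one_closed[OF group.is_monoid[OF G[of n]]]
    by (cases "X n \<subseteq> Y n") (auto simp: f_def)
  then have fc: "f \<in> carrier (product_group UNIV G)" by auto
  have "eventually (\<lambda>n. f n \<in> X n) U" using ev by (rule eventually_mono) (use fn in blast)
  then have "ultra_kernel U G #>\<^bsub>product_group UNIV G\<^esub> f \<in> internal_product U G Y"
    using fc sub unfolding internal_product_def by blast
  then obtain g where g: "g \<in> carrier (product_group UNIV G)" "eventually (\<lambda>n. g n \<in> Y n) U"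
      "ultra_kernel U G #>\<^bsub>product_group UNIV G\<^esub> f = ultra_kernel U G #>\<^bsub>product_group UNIV G\<^esub> g"
    unfolding internal_product_def by blast
  have "eventually (\<lambda>n. f n = g n) U" using ultra_coset_eqD[OF U G fc g(1) g(3)] .
  with g(2) ev have "eventually (\<lambda>n. False) U"
    by eventually_elim (metis DiffD2 fn)
  then show False using U by (simp add: nonprincipal_ultrafilter_def)
qed

lemma tendsto_internal_measure:
  assumes U: "nonprincipal_ultrafilter U" and G: "\<And>n. group (G n)"
    and fin: "\<And>n. finite (carrier (G n))" and X: "\<And>n. X n \<subseteq> carrier (G n)"
  shows "((\<lambda>n. real (card (X n)) / real (card (carrier (G n))))
           \<longlongrightarrow> internal_measure U G (internal_product U G X)) U"
proof -
  let ?r = "\<lambda>X n. real (card (X n)) / real (card (carrier (G n)))"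
  have nb: "U \<noteq> bot" using U by (simp add: nonprincipal_ultrafilter_def)
  have "?r X n \<in> {0..1}" for n
    using card_mono[OF fin X, of n] by (auto simp: divide_le_eq_1)
  then have "eventually (\<lambda>x. x \<in> {0..1}) (filtermap (?r X) U)"
    by (simp add: eventually_filtermap)
  moreover have "filtermap (?r X) U \<noteq> bot" using nb by (simp add: filtermap_bot_iff)
  ultimately obtain r where r: "inf (nhds r) (filtermap (?r X) U) \<noteq> bot"
    using compact_filter[of "{0..1::real}"] by (meson compact_Icc)
  have lim: "(?r X \<longlongrightarrow> r) U"
    unfolding filterlim_def
  proof (rule filter_leI)
    fix P assume P: "eventually P (nhds r)"
    show "eventually P (filtermap (?r X) U)"
    proof (rule ccontr)
      assume "\<not> eventually P (filtermap (?r X) U)"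
      then have "eventually (\<lambda>x. \<not> P x) (filtermap (?r X) U)"
        using U unfolding nonprincipal_ultrafilter_def eventually_filtermap by blast
      with P have "eventually (\<lambda>x. False) (inf (nhds r) (filtermap (?r X) U))"
        unfolding eventually_inf by blast
      then show False using r by (simp add: trivial_limit_def)
    qed
  qed
  have uniq: "s = r"
    if Y: "\<forall>n. Y n \<subseteq> carrier (G n)" "internal_product U G X = internal_product U G Y"
      "(?r Y \<longlongrightarrow> s) U" for s Y
  proof -
    have "eventually (\<lambda>n. X n = Y n) U"
    proof -
      have "eventually (\<lambda>n. X n \<subseteq> Y n) U"
        using Y(2) by (intro internal_product_subsetD[OF U G X]) simp
      moreover have "eventually (\<lambda>n. Y n \<subseteq> X n) U"
        using Y(1,2) by (intro internal_product_subsetD[OF U G]) auto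
      ultimately show ?thesis by eventually_elim blast
    qed
    then have "eventually (\<lambda>n. ?r X n = ?r Y n) U" by (rule eventually_mono) simp
    then have "(?r Y \<longlongrightarrow> r) U" using lim by (rule Lim_transform_eventually[rotated])
    then show ?thesis using tendsto_unique[OF nb] Y(3) by blast
  qed
  have "internal_measure U G (internal_product U G X) = r"
    unfolding internal_measure_def by (rule the_equality) (use X lim uniq in blast)+
  with lim show ?thesis by simp
qed

lemma internal_compactification_copy:
  fixes H :: "'h monoid" and \<rho> :: "(nat \<Rightarrow> 'a) set \<Rightarrow> 'h"
  assumes comp: "internal_compactification U G H T \<rho>"
  obtains K :: "'a compactification_point monoid" and S \<phi> \<psi>
  where "internal_compactification U G K S (\<phi> \<circ> \<rho>)"
    and "\<phi> \<in> iso H K" and "\<psi> \<in> iso K H" and "homeomorphic_maps T S \<phi> \<psi>"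
proof -
  let ?G = "ultraproduct U G"
  have H: "group H" and top: "topspace T = carrier H"
    and cm: "continuous_map (prod_topology T T) T (\<lambda>(x, y). x \<otimes>\<^bsub>H\<^esub> y)"
    and ci: "continuous_map T T (\<lambda>x. inv\<^bsub>H\<^esub> x)"
    and cpt: "compact_space T" and haus: "Hausdorff_space T"
    and hom: "\<rho> \<in> hom ?G H"
    and dense: "T closure_of (\<rho> ` carrier ?G) = carrier H"
    and sep: "\<And>C\<^sub>1 C\<^sub>2. \<lbrakk>closedin T C\<^sub>1; closedin T C\<^sub>2; C\<^sub>1 \<inter> C\<^sub>2 = {}\<rbrakk> \<Longrightarrow>
        \<exists>C. internal U G C \<and> {g \<in> carrier ?G. \<rho> g \<in> C\<^sub>1} \<subseteq> C \<and>
             {g \<in> carrier ?G. \<rho> g \<in> C\<^sub>2} \<subseteq> carrier ?G - C"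
    using comp unfolding internal_compactification_def compact_hausdorff_group_def by auto
  interpret H: group H by (rule H)
  define \<phi> :: "'h \<Rightarrow> 'a compactification_point" where
    "\<phi> h = {{g \<in> carrier ?G. \<rho> g \<in> V} | V. openin T V \<and> h \<in> V}" for h
  have inj: "inj_on \<phi> (carrier H)"
  proof (rule inj_onI, rule ccontr)
    fix h k assume h: "h \<in> carrier H" and k: "k \<in> carrier H" and eq: "\<phi> h = \<phi> k" and ne: "h \<noteq> k"
    obtain V W where VW: "openin T V" "openin T W" "h \<in> V" "k \<in> W" "disjnt V W"
      using haus h k ne unfolding Hausdorff_space_def top by metis
    have mem\<phi>: "A \<in> \<phi> x \<longleftrightarrow> (\<exists>V. A = {g \<in> carrier ?G. \<rho> g \<in> V} \<and> openin T V \<and> x \<in> V)" for A x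
      unfolding \<phi>_def mem_Collect_eq ..
    have "{g \<in> carrier ?G. \<rho> g \<in> W} \<in> \<phi> h" unfolding eq mem\<phi> using VW by (intro exI[of _ W]) simp
    then obtain V' where V': "{g \<in> carrier ?G. \<rho> g \<in> W} = {g \<in> carrier ?G. \<rho> g \<in> V'}"
      "openin T V'" "h \<in> V'"
      unfolding mem\<phi> by (elim exE conjE)
    have "h \<in> T closure_of (\<rho> ` carrier ?G)" using dense h by simp
    moreover have "openin T (V \<inter> V')" "h \<in> V \<inter> V'" using VW V' by auto
    ultimately have "\<exists>y. y \<in> \<rho> ` carrier ?G \<and> y \<in> V \<inter> V'"
      unfolding in_closure_of by metis
    then obtain g where "g \<in> carrier ?G" "\<rho> g \<in> V \<inter> V'" by blast
    then have "\<rho> g \<in> W" "\<rho> g \<in> V" using V'(1) by blast+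
    then show False using VW(5) by (auto simp: disjnt_iff)
  qed
  define \<psi> where "\<psi> = inv_into (carrier H) \<phi>"
  have \<psi>\<phi>: "\<psi> (\<phi> x) = x" if "x \<in> carrier H" for x
    using that inj by (simp add: \<psi>_def)
  define K where "K = \<lparr>carrier = \<phi> ` carrier H,
    monoid.mult = (\<lambda>x y. \<phi> (\<psi> x \<otimes>\<^bsub>H\<^esub> \<psi> y)), one = \<phi> \<one>\<^bsub>H\<^esub>\<rparr>"
  have cK: "carrier K = \<phi> ` carrier H" and mK: "x \<otimes>\<^bsub>K\<^esub> y = \<phi> (\<psi> x \<otimes>\<^bsub>H\<^esub> \<psi> y)" for x y
    by (simp_all add: K_def)
  have \<psi>c: "\<psi> x \<in> carrier H" and \<phi>\<psi>: "\<phi> (\<psi> x) = x" if "x \<in> carrier K" for x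
    using that \<psi>\<phi> by (auto simp: cK)
  define S where "S = pullback_topology (\<phi> ` carrier H) \<psi> T"
  have topS: "topspace S = \<phi> ` carrier H"
    using \<psi>\<phi> by (auto simp: S_def topspace_pullback_topology top)
  have isoH: "\<phi> \<in> iso H K"
    using inj \<psi>\<phi> by (auto simp: iso_def hom_def bij_betw_def cK mK)
  have K: "group K"
  proof (rule groupI)
    show "\<one>\<^bsub>K\<^esub> \<in> carrier K" by (simp add: K_def)
    show "x \<otimes>\<^bsub>K\<^esub> y \<in> carrier K" if "x \<in> carrier K" "y \<in> carrier K" for x y
      using that \<psi>c by (simp add: cK mK)
    show "x \<otimes>\<^bsub>K\<^esub> y \<otimes>\<^bsub>K\<^esub> z = x \<otimes>\<^bsub>K\<^esub> (y \<otimes>\<^bsub>K\<^esub> z)"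
      if "x \<in> carrier K" "y \<in> carrier K" "z \<in> carrier K" for x y z
      using that \<psi>c by (simp add: mK \<psi>\<phi> H.m_assoc)
    show "\<one>\<^bsub>K\<^esub> \<otimes>\<^bsub>K\<^esub> x = x" if "x \<in> carrier K" for x
      using that \<psi>c \<phi>\<psi> by (simp add: mK) (simp add: K_def \<psi>\<phi>)
    show "\<exists>y\<in>carrier K. y \<otimes>\<^bsub>K\<^esub> x = \<one>\<^bsub>K\<^esub>" if "x \<in> carrier K" for x
      using that \<psi>c by (intro bexI[of _ "\<phi> (inv\<^bsub>H\<^esub> \<psi> x)"]) (simp_all add: mK \<psi>\<phi> cK, simp add: K_def)
  qed
  have isoK: "\<psi> \<in> iso K H"
  proof -
    have "bij_betw \<psi> (carrier K) (carrier H)"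
      unfolding \<psi>_def cK using inj by (intro bij_betw_inv_into) (simp add: bij_betw_def)
    then show ?thesis using \<psi>c by (auto simp: iso_def hom_def mK \<psi>\<phi>)
  qed
  have c\<psi>: "continuous_map S T \<psi>"
    unfolding S_def using continuous_map_pullback[OF continuous_map_id] by simp
  have c\<phi>: "continuous_map T S \<phi>"
    unfolding S_def
  proof (rule continuous_map_pullback')
    show "continuous_map T T (\<psi> \<circ> \<phi>)"
      using continuous_map_eq[OF continuous_map_id, of T "\<psi> \<circ> \<phi>"] \<psi>\<phi> by (simp add: top)
    show "topspace T \<subseteq> \<phi> -` \<phi> ` carrier H" by (auto simp: top)
  qed
  have homeo: "homeomorphic_maps T S \<phi> \<psi>"
    using c\<phi> c\<psi> \<psi>\<phi> by (auto simp: homeomorphic_maps_def top topS)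
  then have hs: "T homeomorphic_space S" unfolding homeomorphic_space_def by blast
  have invK: "inv\<^bsub>K\<^esub> x = \<phi> (inv\<^bsub>H\<^esub> \<psi> x)" if "x \<in> carrier K" for x
    using that \<psi>c by (intro group.inv_equality[OF K]) (simp_all add: mK \<psi>\<phi> cK, simp add: K_def)
  have "continuous_map S S (\<lambda>x. inv\<^bsub>K\<^esub> x)"
  proof (rule continuous_map_eq)
    show "continuous_map S S (\<phi> \<circ> ((\<lambda>x. inv\<^bsub>H\<^esub> x) \<circ> \<psi>))"
      by (intro continuous_map_compose[OF _ c\<phi>] continuous_map_compose[OF c\<psi> ci])
  qed (simp add: invK cK topS)
  moreover have "continuous_map (prod_topology S S) S (\<lambda>(x, y). x \<otimes>\<^bsub>K\<^esub> y)"
  proof -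
    have "continuous_map (prod_topology S S) (prod_topology T T) (\<lambda>p. (\<psi> (fst p), \<psi> (snd p)))"
      by (intro continuous_map_pairedI continuous_map_compose[OF continuous_map_fst c\<psi>, unfolded o_def]
           continuous_map_compose[OF continuous_map_snd c\<psi>, unfolded o_def])
    from continuous_map_compose[OF continuous_map_compose[OF this cm] c\<phi>]
    show ?thesis by (simp add: o_def mK case_prod_unfold)
  qed
  ultimately have cg: "compact_hausdorff_group K S"
    unfolding compact_hausdorff_group_def
    using K cpt haus homeomorphic_compact_space[OF hs] homeomorphic_Hausdorff_space[OF hs]
    by (simp add: topS cK)
  have \<rho>c: "\<rho> g \<in> carrier H" if "g \<in> carrier ?G" for g
    using hom that by (auto simp: hom_def)
  have "internal_compactification U G K S (\<phi> \<circ> \<rho>)"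
    unfolding internal_compactification_def
  proof (intro conjI allI impI cg)
    show "\<phi> \<circ> \<rho> \<in> hom ?G K"
      by (rule Group.hom_compose[OF hom]) (use isoH in \<open>simp add: iso_def\<close>)
    have "S closure_of (\<phi> ` (\<rho> ` carrier ?G)) = \<phi> ` (T closure_of (\<rho> ` carrier ?G))"
      using homeomorphic_maps_map[of T S \<phi> \<psi>] homeo \<rho>c
      by (intro homeomorphic_map_closure_of) (auto simp: top)
    then show "S closure_of ((\<phi> \<circ> \<rho>) ` carrier ?G) = carrier K"
      by (simp add: dense cK image_comp)
  next
    fix C\<^sub>1 C\<^sub>2 assume C: "closedin S C\<^sub>1 \<and> closedin S C\<^sub>2 \<and> C\<^sub>1 \<inter> C\<^sub>2 = {}"
    let ?D = "\<lambda>C. {x \<in> topspace T. \<phi> x \<in> C}"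
    have "closedin T (?D C\<^sub>1)" "closedin T (?D C\<^sub>2)"
      using C c\<phi> by (auto intro: closedin_continuous_map_preimage)
    moreover have "?D C\<^sub>1 \<inter> ?D C\<^sub>2 = {}" using C by auto
    ultimately obtain C where "internal U G C" "{g \<in> carrier ?G. \<rho> g \<in> ?D C\<^sub>1} \<subseteq> C"
      "{g \<in> carrier ?G. \<rho> g \<in> ?D C\<^sub>2} \<subseteq> carrier ?G - C"
      using sep[of "?D C\<^sub>1" "?D C\<^sub>2"] by (elim meta_impE exE conjE)
    moreover have eq: "{g \<in> carrier ?G. (\<phi> \<circ> \<rho>) g \<in> C'} = {g \<in> carrier ?G. \<rho> g \<in> ?D C'}" for C'
      using \<rho>c by (auto simp: top)
    ultimately show "\<exists>C. internal U G C \<and> {g \<in> carrier ?G. (\<phi> \<circ> \<rho>) g \<in> C\<^sub>1} \<subseteq> C \<and>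
        {g \<in> carrier ?G. (\<phi> \<circ> \<rho>) g \<in> C\<^sub>2} \<subseteq> carrier ?G - C"
      unfolding eq by (intro exI conjI)
  qed
  from that[OF this isoH isoK homeo] show ?thesis .
qed

lemma universal_internal_compactification_any_type:
  fixes K :: "'k monoid" and \<rho> :: "(nat \<Rightarrow> 'a) set \<Rightarrow> 'k"
  assumes univ: "universal_internal_compactification U G H T b"
    and comp: "internal_compactification U G K S \<rho>"
  shows "\<exists>!\<tau>. \<tau> \<in> extensional (carrier H) \<and> compactification_map U G H T b K S \<rho> \<tau>"
proof -
  obtain K' :: "'a compactification_point monoid" and S' \<phi> \<psi>
    where comp': "internal_compactification U G K' S' (\<phi> \<circ> \<rho>)"
      and \<phi>: "\<phi> \<in> iso K K'" and \<psi>: "\<psi> \<in> iso K' K" and homeo: "homeomorphic_maps S S' \<phi> \<psi>"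
    using internal_compactification_copy[OF comp] by blast
  have bc: "b g \<in> carrier H" and \<rho>c: "\<rho> g \<in> carrier K" if "g \<in> carrier (ultraproduct U G)" for g
    using univ comp that
    by (auto simp: universal_internal_compactification_def internal_compactification_def hom_def)
  have topH: "topspace T = carrier H" and topK: "topspace S = carrier K"
    and topK': "topspace S' = carrier K'"
    using univ comp comp'
    by (auto simp: universal_internal_compactification_def internal_compactification_def
        compact_hausdorff_group_def)
  have c\<phi>: "continuous_map S S' \<phi>" and c\<psi>: "continuous_map S' S \<psi>"
    and \<psi>\<phi>: "\<And>x. x \<in> carrier K \<Longrightarrow> \<psi> (\<phi> x) = x" and \<phi>\<psi>: "\<And>x. x \<in> carrier K' \<Longrightarrow> \<phi> (\<psi> x) = x"
    using homeo by (auto simp: homeomorphic_maps_def topK topK')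
  have h\<phi>: "\<phi> \<in> hom K K'" "\<phi> ` carrier K = carrier K'"
    and h\<psi>: "\<psi> \<in> hom K' K" "\<psi> ` carrier K' = carrier K"
    using \<phi> \<psi> by (auto simp: iso_def bij_betw_def)
  have grpH: "group H"
    using univ by (simp add: universal_internal_compactification_def
        internal_compactification_def compact_hausdorff_group_def)
  have trans: "compactification_map U G H T b L R \<sigma>' (restrict (\<theta> \<circ> \<tau>) (carrier H))"
    if t: "compactification_map U G H T b M Q \<sigma> \<tau>" and "\<theta> \<in> hom M L" "continuous_map Q R \<theta>"
      "\<theta> ` carrier M = carrier L" "\<And>g. g \<in> carrier (ultraproduct U G) \<Longrightarrow> \<sigma>' g = \<theta> (\<sigma> g)"
    for L :: "'y monoid" and R \<sigma>' and M :: "'x monoid" and Q \<sigma> \<tau> \<theta>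
    unfolding compactification_map_def
  proof (intro conjI ballI)
    have "\<theta> \<circ> \<tau> \<in> hom H L" using t that(2) unfolding compactification_map_def
      using Group.hom_compose by blast
    then show "restrict (\<theta> \<circ> \<tau>) (carrier H) \<in> hom H L"
      using grpH by (auto simp: hom_def group.is_monoid monoid.m_closed)
    have "continuous_map T R (\<theta> \<circ> \<tau>)" using t that(3) unfolding compactification_map_def
      using continuous_map_compose by blast
    then show "continuous_map T R (restrict (\<theta> \<circ> \<tau>) (carrier H))"
      by (rule continuous_map_eq) (simp add: topH)
    show "restrict (\<theta> \<circ> \<tau>) (carrier H) ` carrier H = carrier L"
      using t that(4) unfolding compactification_map_def by (metis image_comp image_restrict_eq)
    show "\<sigma>' g = restrict (\<theta> \<circ> \<tau>) (carrier H) (b g)" if "g \<in> carrier (ultraproduct U G)" for g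
      using t \<open>\<And>g. g \<in> carrier (ultraproduct U G) \<Longrightarrow> \<sigma>' g = \<theta> (\<sigma> g)\<close> that bc
      by (simp add: compactification_map_def)
  qed
  have ex1: "\<exists>!\<tau>. \<tau> \<in> extensional (carrier H) \<and> compactification_map U G H T b K' S' (\<phi> \<circ> \<rho>) \<tau>"
    using univ comp' unfolding universal_internal_compactification_def by blast
  then obtain \<tau> where \<tau>: "compactification_map U G H T b K' S' (\<phi> \<circ> \<rho>) \<tau>" by blast
  show ?thesis
  proof (rule ex_ex1I)
    show "\<exists>\<tau>. \<tau> \<in> extensional (carrier H) \<and> compactification_map U G H T b K S \<rho> \<tau>"
      using trans[OF \<tau> h\<psi>(1) c\<psi> h\<psi>(2), of \<rho>] \<psi>\<phi> \<rho>c by (metis comp_apply restrict_extensional)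
  next
    fix \<tau>\<^sub>1 \<tau>\<^sub>2
    assume 1: "\<tau>\<^sub>1 \<in> extensional (carrier H) \<and> compactification_map U G H T b K S \<rho> \<tau>\<^sub>1"
      and 2: "\<tau>\<^sub>2 \<in> extensional (carrier H) \<and> compactification_map U G H T b K S \<rho> \<tau>\<^sub>2"
    have "restrict (\<phi> \<circ> \<tau>\<^sub>1) (carrier H) = restrict (\<phi> \<circ> \<tau>\<^sub>2) (carrier H)"
      using ex1 trans[OF _ h\<phi>(1) c\<phi> h\<phi>(2), of \<rho> _ "\<phi> \<circ> \<rho>"] 1 2
      by (metis comp_apply restrict_extensional)
    then have "\<phi> (\<tau>\<^sub>1 x) = \<phi> (\<tau>\<^sub>2 x)" if "x \<in> carrier H" for x
      using that by (metis comp_apply restrict_apply')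
    moreover have "\<tau>\<^sub>1 x \<in> carrier K" "\<tau>\<^sub>2 x \<in> carrier K" if "x \<in> carrier H" for x
      using 1 2 that by (auto simp: compactification_map_def)
    ultimately have "\<tau>\<^sub>1 x = \<tau>\<^sub>2 x" if "x \<in> carrier H" for x
      using that \<psi>\<phi> by metis
    then show "\<tau>\<^sub>1 = \<tau>\<^sub>2" using 1 2 by (meson extensionalityI)
  qed
qed

end

(*
  The six conditions are proved equivalent along the cycle (c) (d) (a) (b) (e) (f) (c).
  For (c) to (d), AB meets gC^-1; for (d) to (a), 1 lies in A A A^-1.
  For (a) to (b), a non-trivial compactification has a point k with k^2 different from k, and an
  internal set squeezed between two small neighbourhoods of k is product-free and non-null,
  because finitely many of its translates cover G.
  For (b) to (e), a finite internal quotient is itself a compactification, and an abelian one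
  yields non-trivial characters of the G_n, whose ultralimit maps G to the circle.
  For (e) to (f), a commutator contraction argument as in Jordan's theorem shows that a non-trivial
  finite group of unitary m x m matrices has a proper normal subgroup with abelian quotient or of
  index bounded in terms of m.
  For (f) to (c), Gowers' argument: convolution with A on the functions of mean zero has a top
  eigenspace that carries a non-trivial unitary representation, so quasirandomness and the
  Hilbert-Schmidt norm bound its norm.
*)
theory Submission
  imports Defs
    "HOL-Analysis.Function_Topology"
    "HOL-Analysis.Convex"
    "HOL-Analysis.L2_Norm"
    "HOL-Analysis.Abstract_Topological_Spaces"
    "HOL-Algebra.Multiplicative_Group"
    "HOL-Algebra.Zassenhaus"
begin

section \<open>Ultraproducts of finite groups\<close>

text \<open>Only bounds that are uniform in \<open>n\<close> survive the passage between the factors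
  and the ultraproduct. So the index bound \<open>k\<close> of
  \<open>unitary_image_proper_normal\<close> depends on \<open>m\<close> alone, and the characters
  need a gap: points where they merely differ from 1 may have values whose ultralimit is 1, whereas
  a distance of at least 1 persists. Two classical theorems are bypassed. Jordan's theorem is more
  than is needed, since one proper normal subgroup with either kind of quotient suffices. The
  spectral theorem is replaced by a maximiser of the stretch of \<open>conv A\<close>, found by
  compactness; the functions stretched maximally form an invariant subspace because the defect from
  the maximum is a positive semidefinite form. A universal compactification is defined by maps to
  groups over one type of points, while the quotient \<open>GG Mod N\<close> and the circle live in
  other types. Condition (b) reaches them through
  \<open>universal_internal_compactification_any_type\<close>.\<close>

lemma eventually_not_ultrafilter:
  assumes "nonprincipal_ultrafilter U"
  shows "eventually (\<lambda>n. \<not> P n) U \<longleftrightarrow> \<not> eventually P U"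
proof
  assume 1: "eventually (\<lambda>n. \<not> P n) U"
  show "\<not> eventually P U"
  proof
    assume "eventually P U"
    with 1 have "eventually (\<lambda>n. False) U" by eventually_elim simp
    then show False using assms by (simp add: nonprincipal_ultrafilter_def)
  qed
qed (use assms in \<open>auto simp: nonprincipal_ultrafilter_def\<close>)

lemma eventually_disj_ultrafilter:
  assumes "nonprincipal_ultrafilter U"
  shows "eventually (\<lambda>n. P n \<or> Q n) U \<longleftrightarrow> eventually P U \<or> eventually Q U"
proof -
  have "\<not> eventually (\<lambda>n. P n \<or> Q n) U \<longleftrightarrow> eventually (\<lambda>n. \<not> P n \<and> \<not> Q n) U"
    unfolding eventually_not_ultrafilter[OF assms, symmetric] by simp
  then show ?thesis
    unfolding eventually_conj_iff eventually_not_ultrafilter[OF assms] by blast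
qed

text \<open>Serves to fix one dimension below \<open>d\<close>, and later one coset index below
  \<open>k\<close>, for almost all factors at once.\<close>

lemma eventually_bex_ultrafilter:
  assumes "nonprincipal_ultrafilter U" and "finite I"
  shows "eventually (\<lambda>n. \<exists>i\<in>I. P i n) U \<longleftrightarrow> (\<exists>i\<in>I. eventually (P i) U)"
  using assms(2)
proof induction
  case empty
  then show ?case using assms(1) by (simp add: nonprincipal_ultrafilter_def)
qed (simp add: eventually_disj_ultrafilter[OF assms(1)])

locale finite_group_ultraproduct =
  fixes U :: "nat filter" and G :: "nat \<Rightarrow> 'a monoid"
  assumes U: "nonprincipal_ultrafilter U"
    and grp: "\<And>n. group (G n)"
    and fin: "\<And>n. finite (carrier (G n))"
begin

lemmas ev_not = eventually_not_ultrafilter[OF U]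
  and ev_disj = eventually_disj_ultrafilter[OF U]
  and ev_bex = eventually_bex_ultrafilter[OF U]

lemma U_neq_bot: "U \<noteq> bot"
  using U by (simp add: nonprincipal_ultrafilter_def)

section \<open>Elements of the ultraproduct as classes of sequences\<close>

abbreviation "GG \<equiv> ultraproduct U G"
abbreviation "seqs \<equiv> {f. \<forall>n. f n \<in> carrier (G n)}"

definition cls :: "(nat \<Rightarrow> 'a) \<Rightarrow> (nat \<Rightarrow> 'a) set" where
  "cls f = ultra_kernel U G #>\<^bsub>product_group UNIV G\<^esub> f"

lemma carrier_product: "carrier (product_group UNIV G) = seqs"
  by (auto simp: PiE_def)

sublocale GG: group GG
  by (rule group_ultraproduct[OF U grp])

lemma carrier_GG: "carrier GG = cls ` seqs"
  unfolding ultraproduct_def FactGroup_def RCOSETS_def cls_def carrier_product by auto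

lemma cls_closed: "f \<in> seqs \<Longrightarrow> cls f \<in> carrier GG"
  by (auto simp: carrier_GG)

lemma carrier_GG_E:
  assumes "x \<in> carrier GG"
  obtains f where "f \<in> seqs" "x = cls f"
  using assms by (auto simp: carrier_GG)

lemma cls_mult:
  assumes "f \<in> seqs" "g \<in> seqs"
  shows "cls f \<otimes>\<^bsub>GG\<^esub> cls g = cls (\<lambda>n. f n \<otimes>\<^bsub>G n\<^esub> g n)"
proof -
  have "f \<otimes>\<^bsub>product_group UNIV G\<^esub> g = (\<lambda>n. f n \<otimes>\<^bsub>G n\<^esub> g n)"
    by (simp add: restrict_def)
  moreover have "cls f \<otimes>\<^bsub>GG\<^esub> cls g = cls (f \<otimes>\<^bsub>product_group UNIV G\<^esub> g)"
    unfolding ultraproduct_def cls_def FactGroup_def monoid.simps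
    using assms by (intro normal.rcos_sum[OF ultra_kernel_normal[OF U grp]]) (simp_all add: carrier_product del: carrier_product_group)
  ultimately show ?thesis by simp
qed

lemma cls_eq_iff:
  assumes f: "f \<in> seqs" and g: "g \<in> seqs"
  shows "cls f = cls g \<longleftrightarrow> eventually (\<lambda>n. f n = g n) U"
proof
  assume "cls f = cls g"
  then show "eventually (\<lambda>n. f n = g n) U"
    using assms unfolding cls_def
    by (intro ultra_coset_eqD[OF U grp]) (simp_all add: carrier_product del: carrier_product_group)
next
  interpret P: group "product_group UNIV G" by (simp add: grp)
  assume ev: "eventually (\<lambda>n. f n = g n) U"
  let ?k = "\<lambda>n. f n \<otimes>\<^bsub>G n\<^esub> inv\<^bsub>G n\<^esub> (g n)"
  have sub: "subgroup (ultra_kernel U G) (product_group UNIV G)"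
    using ultra_kernel_normal[OF U grp] by (rule normal_imp_subgroup)
  have fg: "f n \<in> carrier (G n)" "g n \<in> carrier (G n)" for n using f g by auto
  have "eventually (\<lambda>n. ?k n = \<one>\<^bsub>G n\<^esub>) U"
    using ev by eventually_elim (simp add: group.r_inv[OF grp] fg)
  moreover have "?k \<in> carrier (product_group UNIV G)"
    using fg by (simp add: carrier_product group.is_monoid[OF grp] monoid.m_closed group.inv_closed[OF grp] del: carrier_product_group)
  ultimately have "?k \<in> ultra_kernel U G"
    unfolding ultra_kernel_def by blast
  moreover have "f = ?k \<otimes>\<^bsub>product_group UNIV G\<^esub> g"
    using fg by (auto simp: group.inv_solve_right'[OF grp] group.is_monoid[OF grp] monoid.m_closed
        group.inv_closed[OF grp] monoid.m_assoc group.l_inv[OF grp] monoid.r_one)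
  ultimately have "f \<in> cls g" unfolding cls_def r_coset_def by blast
  then show "cls f = cls g"
    unfolding cls_def using g
    by (intro P.repr_independence[OF _ _ sub, symmetric]) (simp_all add: carrier_product del: carrier_product_group)
qed

lemma one_seqs: "(\<lambda>n. \<one>\<^bsub>G n\<^esub>) \<in> seqs"
  using monoid.one_closed[OF group.is_monoid[OF grp]] by simp

lemma mult_seqs: "f \<in> seqs \<Longrightarrow> g \<in> seqs \<Longrightarrow> (\<lambda>n. f n \<otimes>\<^bsub>G n\<^esub> g n) \<in> seqs"
  using monoid.m_closed[OF group.is_monoid[OF grp]] by simp

lemma inv_seqs: "f \<in> seqs \<Longrightarrow> (\<lambda>n. inv\<^bsub>G n\<^esub> (f n)) \<in> seqs"
  using group.inv_closed[OF grp] by simp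

lemma cls_one: "\<one>\<^bsub>GG\<^esub> = cls (\<lambda>n. \<one>\<^bsub>G n\<^esub>)"
proof -
  have "cls (\<lambda>n. \<one>\<^bsub>G n\<^esub>) \<otimes>\<^bsub>GG\<^esub> cls (\<lambda>n. \<one>\<^bsub>G n\<^esub>) = cls (\<lambda>n. \<one>\<^bsub>G n\<^esub>)"
    by (simp add: cls_mult one_seqs[simplified] monoid.l_one[OF group.is_monoid[OF grp]])
  then show ?thesis using cls_closed[OF one_seqs] by (metis GG.l_cancel_one')
qed

lemma cls_inv:
  assumes "f \<in> seqs"
  shows "inv\<^bsub>GG\<^esub> (cls f) = cls (\<lambda>n. inv\<^bsub>G n\<^esub> (f n))"
proof (rule GG.inv_equality)
  show "cls (\<lambda>n. inv\<^bsub>G n\<^esub> (f n)) \<otimes>\<^bsub>GG\<^esub> cls f = \<one>\<^bsub>GG\<^esub>"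
    using assms by (simp add: cls_mult inv_seqs cls_one group.l_inv[OF grp] inv_seqs[simplified])
qed (use assms cls_closed inv_seqs in auto)

text \<open>\<open>internal_product\<close> asks for some representative; since two representatives
  of a class agree on a set in \<open>U\<close>, each of them decides membership.\<close>

lemma cls_in_internal:
  assumes "f \<in> seqs"
  shows "cls f \<in> internal_product U G X \<longleftrightarrow> eventually (\<lambda>n. f n \<in> X n) U"
proof
  assume "cls f \<in> internal_product U G X"
  then obtain g where "cls f = cls g" and g: "g \<in> seqs" "eventually (\<lambda>n. g n \<in> X n) U"
    unfolding internal_product_def carrier_product cls_def by blast
  then have "eventually (\<lambda>n. f n = g n) U" using cls_eq_iff[OF assms g(1)] by blast
  with g(2) show "eventually (\<lambda>n. f n \<in> X n) U" by eventually_elim simp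
next
  assume "eventually (\<lambda>n. f n \<in> X n) U"
  then show "cls f \<in> internal_product U G X"
    using assms unfolding internal_product_def carrier_product cls_def by blast
qed

lemma internal_product_subset: "internal_product U G X \<subseteq> carrier GG"
  unfolding internal_product_def carrier_product carrier_GG cls_def by blast

lemma internal_subset: "internal U G A \<Longrightarrow> A \<subseteq> carrier GG"
  unfolding internal_def using internal_product_subset by blast

lemma internal_productE:
  assumes "a \<in> internal_product U G X"
  obtains f where "f \<in> seqs" "a = cls f" "eventually (\<lambda>n. f n \<in> X n) U"
  using assms unfolding internal_product_def carrier_product cls_def by blast

lemma internal_productI:
  "(\<And>n. X n \<subseteq> carrier (G n)) \<Longrightarrow> internal U G (internal_product U G X)"
  unfolding internal_def by blast

lemma internalE:
  assumes "internal U G A"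
  obtains X where "\<And>n. X n \<subseteq> carrier (G n)" "A = internal_product U G X"
  using assms unfolding internal_def by blast

lemma internal_empty: "internal U G {}"
proof -
  have "internal_product U G (\<lambda>n. {}) = {}" by (auto simp: internal_product_def U_neq_bot)
  then show ?thesis using internal_productI[of "\<lambda>n. {}"] by simp
qed

lemma internal_carrier: "internal U G (carrier GG)"
proof -
  have "internal_product U G (\<lambda>n. carrier (G n)) = carrier GG"
    using internal_product_subset by (auto elim!: carrier_GG_E simp: cls_in_internal)
  then show ?thesis using internal_productI[of "\<lambda>n. carrier (G n)"] by simp
qed

text \<open>The universal step of Los's theorem: if the conclusion failed, counterexamples chosen at
  each index would form a sequence that violates the assumption.\<close>

lemma los_all:
  assumes "\<And>f. f \<in> seqs \<Longrightarrow> eventually (\<lambda>n. P n (f n)) U"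
  shows "eventually (\<lambda>n. \<forall>x\<in>carrier (G n). P n x) U"
proof (rule ccontr)
  assume "\<not> ?thesis"
  then have ev: "eventually (\<lambda>n. \<exists>x\<in>carrier (G n). \<not> P n x) U"
    unfolding ev_not[symmetric] by simp
  \<comment> \<open>Indices without a counterexample get an arbitrary element, so that the sequence
    lies in \<open>seqs\<close>.\<close>
  have "\<exists>y\<in>carrier (G n). (\<exists>x\<in>carrier (G n). \<not> P n x) \<longrightarrow> \<not> P n y" for n
    using monoid.one_closed[OF group.is_monoid[OF grp[of n]]] by blast
  then obtain f where f: "\<And>n. f n \<in> carrier (G n)"
      "\<And>n. (\<exists>x\<in>carrier (G n). \<not> P n x) \<longrightarrow> \<not> P n (f n)"
    by metis
  have "eventually (\<lambda>n. \<not> P n (f n)) U" using ev by (rule eventually_mono) (use f(2) in blast)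
  moreover have "eventually (\<lambda>n. P n (f n)) U" using f(1) by (intro assms) simp
  ultimately show False unfolding ev_not by simp
qed

lemma los_all2:
  assumes "\<And>f g. f \<in> seqs \<Longrightarrow> g \<in> seqs \<Longrightarrow> eventually (\<lambda>n. P n (f n) (g n)) U"
  shows "eventually (\<lambda>n. \<forall>x\<in>carrier (G n). \<forall>y\<in>carrier (G n). P n x y) U"
  by (intro los_all assms)

text \<open>Dual to \<open>los_all\<close>, by negation: witnesses in almost all factors are
  collected into one element of the ultraproduct.\<close>

lemma seq_of_eventually_ex:
  assumes "eventually (\<lambda>n. \<exists>x\<in>carrier (G n). P n x) U"
  obtains f where "f \<in> seqs" "eventually (\<lambda>n. P n (f n)) U"
proof -
  have "\<exists>f\<in>seqs. eventually (\<lambda>n. P n (f n)) U"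
  proof (rule ccontr)
    assume "\<not> ?thesis"
    then have "eventually (\<lambda>n. \<forall>x\<in>carrier (G n). \<not> P n x) U"
      by (intro los_all) (auto simp: ev_not)
    then show False using assms ev_not[of "\<lambda>n. \<exists>x\<in>carrier (G n). P n x"] by simp
  qed
  then show ?thesis using that by blast
qed

section \<open>Densities and product sets\<close>

abbreviation density :: "(nat \<Rightarrow> 'a set) \<Rightarrow> nat \<Rightarrow> real" where
  "density X n \<equiv> real (card (X n)) / real (card (carrier (G n)))"

lemma card_pos: "0 < card (carrier (G n))"
  using fin[of n] monoid.one_closed[OF group.is_monoid[OF grp[of n]]] card_gt_0_iff by blast

lemma density_tendsto:
  "(\<And>n. X n \<subseteq> carrier (G n)) \<Longrightarrow>
    (density X \<longlongrightarrow> internal_measure U G (internal_product U G X)) U"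
  by (rule tendsto_internal_measure[OF U grp fin])

lemma internal_measure_nonneg:
  assumes "\<And>n. X n \<subseteq> carrier (G n)"
  shows "0 \<le> internal_measure U G (internal_product U G X)"
  by (rule tendsto_lowerbound[OF density_tendsto[OF assms]]) (simp_all add: U_neq_bot)

lemma internal_measure_eq_of_card:
  assumes "\<And>n. X n \<subseteq> carrier (G n)" "\<And>n. Y n \<subseteq> carrier (G n)" "\<And>n. card (X n) = card (Y n)"
  shows "internal_measure U G (internal_product U G X) = internal_measure U G (internal_product U G Y)"
  using density_tendsto[OF assms(1)] density_tendsto[OF assms(2)] U_neq_bot
  unfolding assms(3) by (rule tendsto_unique[rotated])

lemma set_mult_internal_product:
  assumes X: "\<And>n. X n \<subseteq> carrier (G n)" and Y: "\<And>n. Y n \<subseteq> carrier (G n)"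
  shows "internal_product U G X <#>\<^bsub>GG\<^esub> internal_product U G Y
       = internal_product U G (\<lambda>n. X n <#>\<^bsub>G n\<^esub> Y n)" (is "?L = ?R")
proof (intro equalityI subsetI)
  fix z assume "z \<in> ?L"
  then obtain x y where xy: "x \<in> internal_product U G X" "y \<in> internal_product U G Y"
    "z = x \<otimes>\<^bsub>GG\<^esub> y" unfolding set_mult_def by blast
  then obtain f g where fg: "f \<in> seqs" "x = cls f" "g \<in> seqs" "y = cls g"
    using internal_product_subset by (metis (no_types, lifting) carrier_GG_E subsetD)
  have "eventually (\<lambda>n. f n \<in> X n) U" "eventually (\<lambda>n. g n \<in> Y n) U"
    using xy fg cls_in_internal by auto
  then have "eventually (\<lambda>n. f n \<otimes>\<^bsub>G n\<^esub> g n \<in> X n <#>\<^bsub>G n\<^esub> Y n) U"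
    by eventually_elim (auto simp: set_mult_def)
  then show "z \<in> ?R"
    using xy(3) fg cls_mult cls_in_internal[OF mult_seqs[OF fg(1,3)]] by simp
next
  fix z assume z: "z \<in> ?R"
  then obtain h where h: "h \<in> seqs" "z = cls h"
    using internal_product_subset by (metis (no_types, lifting) carrier_GG_E subsetD)
  have "eventually (\<lambda>n. h n \<in> X n <#>\<^bsub>G n\<^esub> Y n) U" using z h cls_in_internal by auto
  then have "eventually (\<lambda>n. \<exists>x\<in>carrier (G n). \<exists>y\<in>carrier (G n).
      x \<in> X n \<and> y \<in> Y n \<and> h n = x \<otimes>\<^bsub>G n\<^esub> y) U"
    by (rule eventually_mono) (use X Y in \<open>fastforce simp: set_mult_def\<close>)
  \<comment> \<open>The factors of \<open>h n\<close> are chosen one after the other, the second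
    along the sequence \<open>f\<close> already fixed.\<close>
  then obtain f where f: "f \<in> seqs" "eventually (\<lambda>n. \<exists>y\<in>carrier (G n).
      f n \<in> X n \<and> y \<in> Y n \<and> h n = f n \<otimes>\<^bsub>G n\<^esub> y) U"
    by (rule seq_of_eventually_ex)
  from f(2) obtain g where g: "g \<in> seqs" "eventually (\<lambda>n.
      f n \<in> X n \<and> g n \<in> Y n \<and> h n = f n \<otimes>\<^bsub>G n\<^esub> g n) U"
    by (rule seq_of_eventually_ex)
  have "z = cls f \<otimes>\<^bsub>GG\<^esub> cls g"
    unfolding h(2) cls_mult[OF f(1) g(1)] cls_eq_iff[OF h(1) mult_seqs[OF f(1) g(1)]]
    using g(2) by (rule eventually_mono) simp
  moreover have "cls f \<in> internal_product U G X" "cls g \<in> internal_product U G Y"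
    unfolding cls_in_internal[OF f(1)] cls_in_internal[OF g(1)]
    using g(2) by (auto elim: eventually_mono)
  ultimately show "z \<in> ?L" unfolding set_mult_def by blast
qed

end

section \<open>Quasirandom finite groups\<close>

locale finite_group = group G for G (structure) +
  assumes finite_carrier: "finite (carrier G)"
begin

section \<open>Functions on a finite group\<close>

abbreviation (input) "N \<equiv> real (card (carrier G))"

lemma card_carrier_pos: "0 < card (carrier G)"
  using finite_carrier one_closed card_gt_0_iff by blast

definition ip :: "('a \<Rightarrow> real) \<Rightarrow> ('a \<Rightarrow> real) \<Rightarrow> real" where
  "ip f g = (\<Sum>x\<in>carrier G. f x * g x)"

text \<open>The right regular representation: acting on the right makes it multiplicative in
  \<open>g\<close> without an inverse.\<close>

definition tr :: "'a \<Rightarrow> ('a \<Rightarrow> real) \<Rightarrow> 'a \<Rightarrow> real" where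
  "tr g f x = f (x \<otimes> g)"

text \<open>Left multiplication, so that the operator commutes with \<open>tr\<close>. Applied to
  the indicator of \<open>C\<close> and paired with that of \<open>B\<close>, it counts the pairs
  from \<open>A\<close> and \<open>B\<close> whose product lies in \<open>C\<close>.\<close>

definition conv :: "'a set \<Rightarrow> ('a \<Rightarrow> real) \<Rightarrow> 'a \<Rightarrow> real" where
  "conv A f x = (\<Sum>a\<in>A. f (a \<otimes> x))"

lemma ip_commute: "ip f g = ip g f"
  by (simp add: ip_def mult.commute)

lemma ip_add_left: "ip (\<lambda>x. f x + g x) h = ip f h + ip g h"
  by (simp add: ip_def distrib_right sum.distrib)

lemma ip_diff_left: "ip (\<lambda>x. f x - g x) h = ip f h - ip g h"
  by (simp add: ip_def left_diff_distrib sum_subtractf)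

lemma ip_scale_left: "ip (\<lambda>x. c * f x) h = c * ip f h"
  by (simp add: ip_def sum_distrib_left mult.assoc)

lemma ip_sum_left: "ip (\<lambda>x. \<Sum>i\<in>I. c i * f i x) h = (\<Sum>i\<in>I. c i * ip (f i) h)"
proof -
  have "ip (\<lambda>x. \<Sum>i\<in>I. c i * f i x) h = (\<Sum>x\<in>carrier G. \<Sum>i\<in>I. c i * f i x * h x)"
    by (simp add: ip_def sum_distrib_right)
  also have "\<dots> = (\<Sum>i\<in>I. \<Sum>x\<in>carrier G. c i * f i x * h x)" by (rule sum.swap)
  finally show ?thesis by (simp add: ip_def sum_distrib_left mult.assoc)
qed

lemma ip_add_right: "ip h (\<lambda>x. f x + g x) = ip h f + ip h g"
  by (simp add: ip_commute[of h] ip_add_left)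

lemma ip_diff_right: "ip h (\<lambda>x. f x - g x) = ip h f - ip h g"
  by (simp add: ip_commute[of h] ip_diff_left)

lemma ip_scale_right: "ip h (\<lambda>x. c * f x) = c * ip h f"
  by (simp add: ip_commute[of h] ip_scale_left)

lemma ip_sum_right: "ip h (\<lambda>x. \<Sum>i\<in>I. c i * f i x) = (\<Sum>i\<in>I. c i * ip h (f i))"
  by (simp add: ip_commute[of h] ip_sum_left)

lemma ip_self_nonneg: "0 \<le> ip f f"
  by (simp add: ip_def sum_nonneg)

lemma ip_self_eq_0D: "ip f f = 0 \<Longrightarrow> x \<in> carrier G \<Longrightarrow> f x = 0"
  using finite_carrier by (simp add: ip_def sum_nonneg_eq_0_iff)

lemma ip_cong:
  "(\<And>x. x \<in> carrier G \<Longrightarrow> f x = f' x) \<Longrightarrow> (\<And>x. x \<in> carrier G \<Longrightarrow> g x = g' x) \<Longrightarrow> ip f g = ip f' g'"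
  by (simp add: ip_def)

lemma ip_Cauchy_Schwarz: "(ip f g)\<^sup>2 \<le> ip f f * ip g g"
  using Cauchy_Schwarz_ineq_sum[of f g "carrier G"] by (simp add: ip_def power2_eq_square)

lemma tr_mult: "\<lbrakk>g \<in> carrier G; h \<in> carrier G; x \<in> carrier G\<rbrakk> \<Longrightarrow> tr g (tr h f) x = tr (g \<otimes> h) f x"
  by (simp add: tr_def m_assoc)

lemma sum_translate_right:
  assumes "g \<in> carrier G"
  shows "(\<Sum>x\<in>carrier G. f (x \<otimes> g)) = (\<Sum>x\<in>carrier G. f x)"
  using assms
  by (intro sum.reindex_bij_witness[of _ "\<lambda>x. x \<otimes> inv g" "\<lambda>x. x \<otimes> g"]) (auto simp: m_assoc)

lemma ip_tr_tr: "g \<in> carrier G \<Longrightarrow> ip (tr g f) (tr g h) = ip f h"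
  unfolding ip_def tr_def by (rule sum_translate_right)

lemma tr_conv:
  "\<lbrakk>A \<subseteq> carrier G; g \<in> carrier G; x \<in> carrier G\<rbrakk> \<Longrightarrow> tr g (conv A f) x = conv A (tr g f) x"
  unfolding tr_def conv_def by (intro sum.cong refl) (auto simp: m_assoc)

lemma tr_cong: "\<lbrakk>\<And>x. x \<in> carrier G \<Longrightarrow> f x = f' x; g \<in> carrier G; x \<in> carrier G\<rbrakk> \<Longrightarrow> tr g f x = tr g f' x"
  by (simp add: tr_def)

lemma conv_lin:
  "conv A (\<lambda>x. f x + g x) = (\<lambda>x. conv A f x + conv A g x)"
  "conv A (\<lambda>x. f x - g x) = (\<lambda>x. conv A f x - conv A g x)"
  "conv A (\<lambda>x. c * f x) = (\<lambda>x. c * conv A f x)"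
  by (simp_all add: fun_eq_iff conv_def sum.distrib sum_subtractf sum_distrib_left)

section \<open>Orthonormal systems in invariant subspaces\<close>

definition invariant_subspace :: "('a \<Rightarrow> real) set \<Rightarrow> bool" where
  "invariant_subspace V \<longleftrightarrow>
     (\<forall>f\<in>V. \<forall>f'\<in>V. (\<lambda>x. f x - f' x) \<in> V) \<and> (\<forall>f\<in>V. \<forall>c. (\<lambda>x. c * f x) \<in> V) \<and>
     (\<forall>f\<in>V. \<forall>g\<in>carrier G. tr g f \<in> V)"

definition orthonormal :: "nat \<Rightarrow> (nat \<Rightarrow> 'a \<Rightarrow> real) \<Rightarrow> bool" where
  "orthonormal k b \<longleftrightarrow> (\<forall>i<k. \<forall>j<k. ip (b i) (b j) = of_bool (i = j))"

text \<open>The difference of the two sides is the squared norm of \<open>f\<close> minus its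
  projection \<open>?p\<close>.\<close>

lemma Bessel:
  assumes "orthonormal k b"
  shows "(\<Sum>i<k. (ip f (b i))\<^sup>2) \<le> ip f f"
proof -
  let ?p = "\<lambda>x. \<Sum>i<k. ip f (b i) * b i x"
  have pp: "ip ?p ?p = (\<Sum>i<k. (ip f (b i))\<^sup>2)"
  proof -
    have "ip ?p ?p = (\<Sum>i<k. ip f (b i) * (\<Sum>j<k. ip f (b j) * ip (b i) (b j)))"
      by (simp only: ip_sum_left) (simp only: ip_sum_right)
    also have "\<dots> = (\<Sum>i<k. ip f (b i) * ip f (b i))"
    proof (intro sum.cong refl arg_cong2[of _ _ _ _ times])
      fix i assume "i \<in> {..<k}"
      then have "(\<Sum>j<k. ip f (b j) * ip (b i) (b j)) = (\<Sum>j<k. if j = i then ip f (b j) else 0)"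
        using assms by (intro sum.cong) (auto simp: orthonormal_def)
      then show "(\<Sum>j<k. ip f (b j) * ip (b i) (b j)) = ip f (b i)"
        using \<open>i \<in> {..<k}\<close> by simp
    qed
    finally show ?thesis by (simp add: power2_eq_square)
  qed
  have fp: "ip f ?p = (\<Sum>i<k. (ip f (b i))\<^sup>2)"
    by (simp add: ip_sum_right power2_eq_square)
  have "0 \<le> ip (\<lambda>x. f x - ?p x) (\<lambda>x. f x - ?p x)" by (rule ip_self_nonneg)
  also have "\<dots> = ip f f - 2 * ip f ?p + ip ?p ?p"
    by (simp only: ip_diff_left ip_diff_right ip_commute[of ?p f])
  finally show ?thesis using pp fp by simp
qed

text \<open>Bessel's inequality for the point mass at \<open>y\<close> bounds the sum of the squares
  \<open>(b i y)\<^sup>2\<close> by 1; summing over \<open>y\<close> turns the left side into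
  \<open>k\<close>.\<close>

lemma orthonormal_size:
  assumes "orthonormal k b"
  shows "k \<le> card (carrier G)"
proof -
  have "real k = (\<Sum>i<k. ip (b i) (b i))" using assms by (simp add: orthonormal_def)
  also have "\<dots> = (\<Sum>y\<in>carrier G. \<Sum>i<k. (b i y)\<^sup>2)"
    unfolding ip_def power2_eq_square by (rule sum.swap)
  also have "\<dots> \<le> (\<Sum>y\<in>carrier G. 1)"
  proof (rule sum_mono)
    fix y assume y: "y \<in> carrier G"
    have e: "ip (\<lambda>x. of_bool (x = y)) f = f y" for f
      using y finite_carrier by (simp add: ip_def of_bool_def if_distrib[of "\<lambda>z. z * _"] cong: if_cong)
    show "(\<Sum>i<k. (b i y)\<^sup>2) \<le> 1"
      using Bessel[OF assms, of "\<lambda>x. of_bool (x = y)"] by (simp add: e)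
  qed
  finally show ?thesis by simp
qed

text \<open>By \<open>orthonormal_size\<close> a system in \<open>V\<close> of largest size exists.
  If the remainder \<open>r\<close> of some \<open>f\<close> were non-zero, its normalisation would
  lie in \<open>V\<close> and enlarge the system.\<close>

lemma orthonormal_basis_exists:
  assumes V: "invariant_subspace V"
  obtains k b where "orthonormal k b" "\<And>i. i < k \<Longrightarrow> b i \<in> V"
    "\<And>f x. f \<in> V \<Longrightarrow> x \<in> carrier G \<Longrightarrow> f x = (\<Sum>i<k. ip f (b i) * b i x)"
proof -
  let ?P = "\<lambda>k. \<exists>b. orthonormal k b \<and> (\<forall>i<k. b i \<in> V)"
  have "?P 0" by (simp add: orthonormal_def)
  moreover have fin: "finite {k. ?P k}"
    by (rule finite_subset[of _ "{..card (carrier G)}"]) (use orthonormal_size in auto)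
  ultimately have "?P (Max {k. ?P k})" using Max_in[of "{k. ?P k}"] by blast
  then obtain k where k: "?P k" and max: "\<And>l. ?P l \<Longrightarrow> l \<le> k"
    using Max_ge[OF fin] by blast
  from k obtain b where b: "orthonormal k b" "\<And>i. i < k \<Longrightarrow> b i \<in> V" by blast
  have "f x = (\<Sum>i<k. ip f (b i) * b i x)" if f: "f \<in> V" and x: "x \<in> carrier G" for f x
  proof -
    define r where "r x = f x - (\<Sum>i<k. ip f (b i) * b i x)" for x
    have partial: "(\<lambda>x. f x - (\<Sum>i<l. ip f (b i) * b i x)) \<in> V" if "l \<le> k" for l
      using that
    proof (induction l)
      case (Suc l)
      then have "(\<lambda>x. (f x - (\<Sum>i<l. ip f (b i) * b i x)) - ip f (b l) * b l x) \<in> V"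
        using V b(2)[of l] by (simp add: invariant_subspace_def)
      then show ?case by (simp add: algebra_simps)
    qed (simp add: f)
    then have rV: "r \<in> V" using partial[of k] unfolding r_def by simp
    have orth: "ip r (b j) = 0" if "j < k" for j
    proof -
      have "ip r (b j) = ip f (b j) - (\<Sum>i<k. ip f (b i) * ip (b i) (b j))"
        unfolding r_def by (simp only: ip_diff_left ip_sum_left)
      also have "(\<Sum>i<k. ip f (b i) * ip (b i) (b j)) = (\<Sum>i<k. if i = j then ip f (b i) else 0)"
        using b(1) that by (intro sum.cong) (auto simp: orthonormal_def)
      also have "\<dots> = ip f (b j)" using that by simp
      finally show ?thesis by simp
    qed
    have "ip r r = 0"
    proof (rule ccontr)
      assume "ip r r \<noteq> 0"
      then have pos: "ip r r > 0" using ip_self_nonneg[of r] by simp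
      define u where "u = (\<lambda>x. (1 / sqrt (ip r r)) * r x)"
      have uu: "ip u u = 1" unfolding u_def ip_scale_left ip_scale_right using pos by simp
      have ub: "ip u (b j) = 0" if "j < k" for j
        unfolding u_def ip_scale_left using orth[OF that] by simp
      have "orthonormal (Suc k) (b(k := u))"
        using b(1) uu ub ub[unfolded ip_commute[of u]] by (auto simp: orthonormal_def less_Suc_eq)
      moreover have "u \<in> V" using V rV unfolding invariant_subspace_def u_def by blast
      ultimately have "?P (Suc k)" using b(2) by (intro exI[of _ "b(k := u)"]) (auto simp: less_Suc_eq)
      then show False using max by fastforce
    qed
    then have "r x = 0" using x by (rule ip_self_eq_0D)
    then show ?thesis by (simp add: r_def)
  qed
  with b that show ?thesis by blast
qed

text \<open>The right translations, written in an orthonormal basis of \<open>V\<close>, form a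
  unitary representation of dimension \<open>k\<close>. If it were trivial, every function in
  \<open>V\<close> would be constant on the group, and having mean zero it would vanish
  there.\<close>

lemma invariant_subspace_dim:
  assumes qr: "quasirandom d G" and V: "invariant_subspace V"
    and f: "f \<in> V" "ip f f \<noteq> 0" and mean0: "\<And>f. f \<in> V \<Longrightarrow> ip f (\<lambda>x. 1) = 0"
  obtains k b where "orthonormal k b" "\<And>i. i < k \<Longrightarrow> b i \<in> V" "d \<le> k"
proof -
  obtain k b where b: "orthonormal k b" "\<And>i. i < k \<Longrightarrow> b i \<in> V"
    and exp: "\<And>f x. f \<in> V \<Longrightarrow> x \<in> carrier G \<Longrightarrow> f x = (\<Sum>i<k. ip f (b i) * b i x)"
    using orthonormal_basis_exists[OF V] by blast
  \<comment> \<open>Translations preserve the real inner product, so these are orthogonal matrices,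
    read as complex ones.\<close>
  define M where "M g = Matrix.mat k k (\<lambda>(i, j). complex_of_real (ip (tr g (b j)) (b i)))" for g
  have M_carrier: "M g \<in> carrier_mat k k" for g by (simp add: M_def)
  have trV: "tr g (b j) \<in> V" if "g \<in> carrier G" "j < k" for g j
    using V b(2) that by (simp add: invariant_subspace_def)
  have M_mult: "M (g \<otimes> h) = M g * M h" if g: "g \<in> carrier G" and h: "h \<in> carrier G" for g h
  proof (rule eq_matI)
    fix i j assume "i < dim_row (M g * M h)" "j < dim_col (M g * M h)"
    then have ij: "i < k" "j < k" by (simp_all add: M_def)
    have "ip (tr (g \<otimes> h) (b j)) (b i) = ip (tr g (tr h (b j))) (b i)"
      by (intro ip_cong refl) (simp add: tr_mult g h)
    also have "\<dots> = ip (tr g (\<lambda>x. \<Sum>l<k. ip (tr h (b j)) (b l) * b l x)) (b i)"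
      by (intro ip_cong refl tr_cong g exp trV h ij)
    also have "\<dots> = (\<Sum>l<k. ip (tr h (b j)) (b l) * ip (tr g (b l)) (b i))"
      unfolding tr_def by (rule ip_sum_left)
    finally show "M (g \<otimes> h) $$ (i, j) = (M g * M h) $$ (i, j)"
      using ij by (simp add: M_def scalar_prod_def atLeast0LessThan mult.commute)
  qed (simp_all add: M_def)
  have M_one: "M \<one> = 1\<^sub>m k"
  proof (rule eq_matI)
    fix i j assume ij: "i < dim_row (1\<^sub>m k)" "j < dim_col (1\<^sub>m k)"
    have "ip (tr \<one> (b j)) (b i) = ip (b j) (b i)" by (intro ip_cong refl) (simp add: tr_def)
    then show "M \<one> $$ (i, j) = 1\<^sub>m k $$ (i, j)"
      using b(1) ij by (auto simp: M_def orthonormal_def)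
  qed (simp_all add: M_def)
  have M_adj: "mat_adjoint (M g) = M (inv g)" if g: "g \<in> carrier G" for g
  proof (rule eq_matI)
    fix i j assume "i < dim_row (M (inv g))" "j < dim_col (M (inv g))"
    then have ij: "i < k" "j < k" by (simp_all add: M_def)
    have "ip (tr (inv g) (b j)) (b i) = ip (tr g (tr (inv g) (b j))) (tr g (b i))"
      using g by (simp add: ip_tr_tr)
    also have "\<dots> = ip (b j) (tr g (b i))"
      using g by (intro ip_cong refl) (simp add: tr_mult, simp add: tr_def)
    finally show "mat_adjoint (M g) $$ (i, j) = M (inv g) $$ (i, j)"
      using ij by (simp add: M_def mat_adjoint_def mat_of_rows_def ip_commute)
  qed (simp_all add: M_def mat_adjoint_def)
  have hom: "M \<in> hom G (unitary_group k)"
  proof (rule homI)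
    fix g assume g: "g \<in> carrier G"
    have "M g * M (inv g) = 1\<^sub>m k" "M (inv g) * M g = 1\<^sub>m k"
      using M_mult[of g "inv g"] M_mult[of "inv g" g] g by (simp_all add: M_one)
    then show "M g \<in> carrier (unitary_group k)"
      by (simp add: unitary_group_def M_carrier M_adj g)
  qed (simp add: unitary_group_def M_mult)
  have "\<exists>g\<in>carrier G. M g \<noteq> 1\<^sub>m k"
  proof (rule ccontr)
    assume "\<not> ?thesis"
    then have triv: "M g = 1\<^sub>m k" if "g \<in> carrier G" for g using that by blast
    have const: "f x = f \<one>" if x: "x \<in> carrier G" for x
    proof -
      have inv: "b j x = b j \<one>" if j: "j < k" for j
      proof -
        have "ip (tr x (b j)) (b i) = of_bool (i = j)" if i: "i < k" for i
        proof -
          have "complex_of_real (ip (tr x (b j)) (b i)) = (1\<^sub>m k) $$ (i, j)"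
            using i j unfolding triv[OF x, symmetric] by (simp add: M_def)
          then have "complex_of_real (ip (tr x (b j)) (b i)) = complex_of_real (of_bool (i = j))"
            using i j by simp
          then show ?thesis by (simp only: of_real_eq_iff)
        qed
        \<comment> \<open>The expansion of the translate, evaluated at the identity, compares the
          values of \<open>b j\<close> at \<open>x\<close> and at the identity.\<close>
        then have "tr x (b j) \<one> = (\<Sum>i<k. of_bool (i = j) * b i \<one>)"
          using exp[OF trV[OF x j] one_closed] by simp
        also have "\<dots> = b j \<one>" using j by (simp add: of_bool_def if_distrib[of "\<lambda>z. z * _"] cong: if_cong)
        finally show ?thesis using x by (simp add: tr_def)
      qed
      show ?thesis using exp[OF f(1) x] exp[OF f(1) one_closed] inv by simp
    qed
    have "ip f f = ip f (\<lambda>x. f \<one> * 1)" by (intro ip_cong refl) (metis const mult_1_right)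
    also have "\<dots> = 0" unfolding ip_scale_right using mean0[OF f(1)] by simp
    finally show False using f(2) by simp
  qed
  then have "d \<le> k" using qr hom unfolding quasirandom_def by blast
  with b that show ?thesis by blast
qed

text \<open>For fixed \<open>x\<close>, the value \<open>conv A f x\<close> is the inner product of
  \<open>f\<close> with the indicator of the translate of \<open>A\<close> by \<open>x\<close>,
  whose squared norm is \<open>card A\<close>. Bessel's inequality at each \<open>x\<close> is then
  summed over the group.\<close>

lemma conv_Hilbert_Schmidt:
  assumes "orthonormal k b" and A: "A \<subseteq> carrier G"
  shows "(\<Sum>i<k. ip (conv A (b i)) (conv A (b i))) \<le> N * real (card A)"
proof -
  have conv_ip: "conv A f x = ip f (\<lambda>y. of_bool (y \<otimes> inv x \<in> A))" if x: "x \<in> carrier G" for f x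
  proof -
    have "conv A f x = (\<Sum>y\<in>(\<lambda>a. a \<otimes> x) ` A. f y)"
      unfolding conv_def using A x by (subst sum.reindex) (auto simp: inj_on_def subset_iff)
    also have "(\<lambda>a. a \<otimes> x) ` A = {y \<in> carrier G. y \<otimes> inv x \<in> A}"
    proof (intro equalityI subsetI)
      fix y assume "y \<in> {y \<in> carrier G. y \<otimes> inv x \<in> A}"
      then show "y \<in> (\<lambda>a. a \<otimes> x) ` A"
        using x by (intro image_eqI[of _ _ "y \<otimes> inv x"]) (auto simp: m_assoc)
    qed (use A x in \<open>auto simp: m_assoc subset_iff\<close>)
    also have "(\<Sum>y\<in>{y \<in> carrier G. y \<otimes> inv x \<in> A}. f y) = ip f (\<lambda>y. of_bool (y \<otimes> inv x \<in> A))"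
      unfolding ip_def using finite_carrier by (intro sum.mono_neutral_cong_left) auto
    finally show ?thesis .
  qed
  have card: "ip (\<lambda>y. of_bool (y \<otimes> inv x \<in> A)) (\<lambda>y. of_bool (y \<otimes> inv x \<in> A)) = real (card A)"
    if x: "x \<in> carrier G" for x
  proof -
    have "ip (\<lambda>y. of_bool (y \<otimes> inv x \<in> A)) (\<lambda>y. of_bool (y \<otimes> inv x \<in> A))
        = (\<Sum>y\<in>carrier G. of_bool (y \<otimes> inv x \<in> A))"
      unfolding ip_def by (intro sum.cong) auto
    also have "\<dots> = (\<Sum>y\<in>carrier G. of_bool (y \<in> A))"
      using sum_translate_right[of "inv x" "\<lambda>y. of_bool (y \<in> A)"] x by simp
    also have "\<dots> = real (card A)"
      using A finite_carrier by (simp add: of_bool_def sum.If_cases Int_absorb1)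
    finally show ?thesis .
  qed
  have "(\<Sum>i<k. ip (conv A (b i)) (conv A (b i)))
      = (\<Sum>x\<in>carrier G. \<Sum>i<k. (conv A (b i) x)\<^sup>2)"
    unfolding ip_def power2_eq_square by (rule sum.swap)
  also have "\<dots> \<le> (\<Sum>x\<in>carrier G. real (card A))"
  proof (rule sum_mono)
    fix x assume x: "x \<in> carrier G"
    show "(\<Sum>i<k. (conv A (b i) x)\<^sup>2) \<le> real (card A)"
      using Bessel[OF assms(1), of "\<lambda>y. of_bool (y \<otimes> inv x \<in> A)"]
      by (simp add: conv_ip[OF x] card[OF x] ip_commute)
  qed
  finally show ?thesis by simp
qed

text \<open>Functions are defined on the whole type and \<open>ip\<close> ignores their values
  outside the carrier, so its unit sphere need not be compact. Intersecting it with the cube of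
  functions into \<open>{-1..1}\<close>, compact by Tychonoff's theorem, loses nothing: every
  mean-zero function with \<open>ip f f\<close> non-zero can be scaled, and changed off the carrier,
  to lie in \<open>S\<close>.\<close>

lemma conv_maximiser:
  assumes A: "A \<subseteq> carrier G" and nontriv: "\<exists>f. ip f (\<lambda>x. 1) = 0 \<and> ip f f \<noteq> 0"
  obtains f0 where "ip f0 (\<lambda>x. 1) = 0" "ip f0 f0 = 1"
    "\<And>f. ip f (\<lambda>x. 1) = 0 \<Longrightarrow> ip (conv A f) (conv A f) \<le> ip (conv A f0) (conv A f0) * ip f f"
proof -
  define S where "S = {f. ip f (\<lambda>x. 1) = 0} \<inter> {f. ip f f = 1} \<inter> (UNIV \<rightarrow>\<^sub>E {-1..1})"
  have cont_ev: "continuous_on UNIV (\<lambda>f. f x)" for x :: 'a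
    by (rule continuous_on_product_coordinates)
  have cont_ip: "continuous_on UNIV (\<lambda>f. ip (F f) (H f))"
    if "\<And>x. continuous_on UNIV (\<lambda>f. F f x)" "\<And>x. continuous_on UNIV (\<lambda>f. H f x)"
    for F H :: "('a \<Rightarrow> real) \<Rightarrow> 'a \<Rightarrow> real"
    unfolding ip_def by (intro continuous_intros that)
  have "compactin (product_topology (\<lambda>i. euclidean) UNIV) (UNIV \<rightarrow>\<^sub>E {-1..1::real})"
    by (subst compactin_PiE) auto
  then have "compact (UNIV \<rightarrow>\<^sub>E {-1..1::real} :: ('a \<Rightarrow> real) set)"
    by (simp only: euclidean_product_topology compactin_euclidean_iff)
  moreover have "closed {f. ip f (\<lambda>x. 1) = 0}" "closed {f. ip f f = 1}"
    by (intro closed_Collect_eq cont_ip cont_ev continuous_on_const)+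
  ultimately have comp: "compact S" unfolding S_def by (intro closed_Int_compact closed_Int)
  \<comment> \<open>The value 0 outside the carrier keeps the function in the cube and changes no
    inner product.\<close>
  define norm1 where
    "norm1 f = (\<lambda>x. if x \<in> carrier G then (1 / sqrt (ip f f)) * f x else 0)" for f
  have norm1: "norm1 f \<in> S" if f: "ip f (\<lambda>x. 1) = 0" "ip f f \<noteq> 0" for f
  proof -
    have pos: "ip f f > 0" using f(2) ip_self_nonneg[of f] by simp
    have n: "ip (norm1 f) h = (1 / sqrt (ip f f)) * ip f h" for h
      unfolding norm1_def ip_scale_left[symmetric] by (intro ip_cong) auto
    have "ip (norm1 f) (norm1 f) = 1" 
      using pos n[of "norm1 f"] n[of f] ip_commute[of f "norm1 f"] by (simp add: divide_simps)
    moreover have "norm1 f x \<in> {-1..1}" for x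
    proof (cases "x \<in> carrier G")
      case True
      have "(norm1 f x)\<^sup>2 \<le> ip (norm1 f) (norm1 f)"
        unfolding ip_def power2_eq_square using True finite_carrier
        by (intro member_le_sum[of x "carrier G" "\<lambda>x. norm1 f x * norm1 f x"]) auto
      then have "\<bar>norm1 f x\<bar> \<le> 1" using \<open>ip (norm1 f) (norm1 f) = 1\<close> abs_square_le_1 by metis
      then show ?thesis by auto
    qed (simp add: norm1_def)
    ultimately show ?thesis using f(1) n[of "\<lambda>x. 1"] by (simp add: S_def PiE_UNIV_domain)
  qed
  have contT: "continuous_on S (\<lambda>f. ip (conv A f) (conv A f))"
    unfolding conv_def
    by (rule continuous_on_subset[OF cont_ip]) (auto intro!: continuous_on_sum cont_ev)
  have "S \<noteq> {}" using nontriv norm1 by blast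
  then obtain f0 where f0: "f0 \<in> S" "\<And>f. f \<in> S \<Longrightarrow> ip (conv A f) (conv A f) \<le> ip (conv A f0) (conv A f0)"
    using continuous_attains_sup[OF comp _ contT] by blast
  have "ip (conv A f) (conv A f) \<le> ip (conv A f0) (conv A f0) * ip f f" if f: "ip f (\<lambda>x. 1) = 0" for f
  proof (cases "ip f f = 0")
    case True
    then have "conv A f x = 0" if "x \<in> carrier G" for x
      using ip_self_eq_0D[of f] A that unfolding conv_def by (intro sum.neutral) auto
    then show ?thesis using True by (simp add: ip_def)
  next
    case False
    then have pos: "ip f f > 0" using ip_self_nonneg[of f] by simp
    have "conv A (norm1 f) x = 1 / sqrt (ip f f) * conv A f x" if "x \<in> carrier G" for x
      using that A unfolding conv_def norm1_def sum_distrib_left by (intro sum.cong) auto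
    then have "ip (conv A (norm1 f)) (conv A (norm1 f))
        = ip (\<lambda>x. 1 / sqrt (ip f f) * conv A f x) (\<lambda>x. 1 / sqrt (ip f f) * conv A f x)"
      by (intro ip_cong)
    also have "\<dots> = ip (conv A f) (conv A f) / ip f f"
      unfolding ip_scale_left ip_scale_right using pos by simp
    finally have "ip (conv A f) (conv A f) / ip f f \<le> ip (conv A f0) (conv A f0)"
      using f0(2)[OF norm1[OF f False]] by simp
    then show ?thesis using pos by (simp add: divide_le_eq)
  qed
  with f0(1) that show ?thesis by (auto simp: S_def)
qed

lemma quasirandom_conv_bound:
  assumes qr: "quasirandom d G" and A: "A \<subseteq> carrier G" and f: "ip f (\<lambda>x. 1) = 0"
  shows "real d * ip (conv A f) (conv A f) \<le> N * real (card A) * ip f f"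
proof (cases "ip f f = 0")
  case True
  then have "conv A f x = 0" if "x \<in> carrier G" for x
    using ip_self_eq_0D[of f] A that unfolding conv_def by (intro sum.neutral) auto
  then show ?thesis using True by (simp add: ip_def)
next
  case False
  obtain f0 where f0: "ip f0 (\<lambda>x. 1) = 0" "ip f0 f0 = 1"
    and max: "\<And>f. ip f (\<lambda>x. 1) = 0 \<Longrightarrow> ip (conv A f) (conv A f) \<le> ip (conv A f0) (conv A f0) * ip f f"
    using conv_maximiser[OF A] f False by blast
  define l where "l = ip (conv A f0) (conv A f0)"
  \<comment> \<open>The defect from the maximal stretch, a quadratic form that is non-negative on
    functions of mean zero.\<close>
  define q where "q f = l * ip f f - ip (conv A f) (conv A f)" for f
  have q_nonneg: "0 \<le> q f" if "ip f (\<lambda>x. 1) = 0" for f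
    using max[OF that] by (simp add: q_def l_def)
  have parallelogram: "q (\<lambda>x. f x + g x) + q (\<lambda>x. f x - g x) = 2 * q f + 2 * q g" for f g
    unfolding q_def conv_lin
    by (simp only: ip_add_left ip_add_right ip_diff_left ip_diff_right) (simp add: algebra_simps)
  \<comment> \<open>The top eigenspace: the zeros of a positive semidefinite form, a subspace by the parallelogram law.\<close>
  define V where "V = {f. ip f (\<lambda>x. 1) = 0 \<and> q f = 0}"
  have "invariant_subspace V"
    unfolding invariant_subspace_def
  proof (intro conjI ballI allI)
    fix f g assume fg: "f \<in> V" "g \<in> V"
    then have "0 \<le> q (\<lambda>x. f x + g x)" "0 \<le> q (\<lambda>x. f x - g x)"
      by (intro q_nonneg; simp add: V_def ip_add_left ip_diff_left)+
    then show "(\<lambda>x. f x - g x) \<in> V"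
      using parallelogram[of f g] fg by (simp add: V_def ip_diff_left)
  next
    fix f c assume "f \<in> V"
    then show "(\<lambda>x. c * f x) \<in> V"
      by (simp add: V_def q_def conv_lin ip_scale_left ip_scale_right)
  next
    fix f g assume f: "f \<in> V" and g: "g \<in> carrier G"
    have "ip (conv A (tr g f)) (conv A (tr g f)) = ip (tr g (conv A f)) (tr g (conv A f))"
      by (intro ip_cong) (simp_all add: tr_conv A g)
    moreover have "ip (tr g f) (tr g (\<lambda>x. 1)) = 0" using f g by (simp add: ip_tr_tr V_def)
    moreover have "tr g (\<lambda>x. 1) = (\<lambda>x. 1)" by (simp add: tr_def fun_eq_iff)
    ultimately show "tr g f \<in> V" using f g by (simp add: V_def q_def ip_tr_tr)
  qed
  note inv = this
  have f0V: "f0 \<in> V" and ne: "ip f0 f0 \<noteq> 0" using f0 by (simp_all add: V_def q_def l_def)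
  have mean0: "\<And>f. f \<in> V \<Longrightarrow> ip f (\<lambda>x. 1) = 0" by (simp add: V_def)
  obtain k b where b: "orthonormal k b" "\<And>i. i < k \<Longrightarrow> b i \<in> V" "d \<le> k"
    using invariant_subspace_dim[OF qr inv f0V ne mean0] by blast
  \<comment> \<open>Each of the \<open>k\<close> basis functions is stretched by the full
    \<open>l\<close>, so together they contribute \<open>k * l\<close> to the Hilbert-Schmidt
    sum.\<close>
  have "real d * l \<le> real k * l" using b(3) ip_self_nonneg by (intro mult_right_mono) (auto simp: l_def)
  also have "\<dots> = (\<Sum>i<k. ip (conv A (b i)) (conv A (b i)))"
  proof -
    have "ip (conv A (b i)) (conv A (b i)) = l" if "i < k" for i
      using b(1) b(2)[OF that] that by (simp add: V_def q_def orthonormal_def)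
    then show ?thesis by simp
  qed
  also have "\<dots> \<le> N * real (card A)" by (rule conv_Hilbert_Schmidt[OF b(1) A])
  finally have "real d * l * ip f f \<le> N * real (card A) * ip f f"
    by (rule mult_right_mono) (rule ip_self_nonneg)
  moreover have "real d * ip (conv A f) (conv A f) \<le> real d * (l * ip f f)"
    using max[OF f] by (intro mult_left_mono) (simp_all add: l_def)
  ultimately show ?thesis by (simp add: mult.assoc)
qed

text \<open>By \<open>free\<close>, the indicator of \<open>B\<close> is orthogonal to
  \<open>conv A\<close> of the indicator of \<open>C\<close>. Subtracting the density
  \<open>c\<close> from the latter gives \<open>f\<close> of mean zero, and the pairing becomes
  minus the expected count \<open>card A * card B * c\<close>. Cauchy-Schwarz and
  \<open>quasirandom_conv_bound\<close> show that so large a deviation forces the sets to be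
  small.\<close>

lemma Gowers_quasirandom:
  assumes qr: "quasirandom d G" and A: "A \<subseteq> carrier G" and B: "B \<subseteq> carrier G" and C: "C \<subseteq> carrier G"
    and free: "\<And>a b. a \<in> A \<Longrightarrow> b \<in> B \<Longrightarrow> a \<otimes> b \<notin> C"
  shows "real d * real (card A) * real (card B) * real (card C) \<le> N ^ 3"
proof -
  have Npos: "N > 0" using card_carrier_pos by simp
  have ind: "ip (\<lambda>x. of_bool (x \<in> X)) h = (\<Sum>x\<in>X. h x)" if "X \<subseteq> carrier G" for X h
    unfolding ip_def using that finite_carrier by (intro sum.mono_neutral_cong_right) auto
  define c where "c = real (card C) / N"
  define f where "f = (\<lambda>x. of_bool (x \<in> C) - c)"
  have one: "ip (\<lambda>x. c) (\<lambda>x. 1) = N * c" by (simp add: ip_def)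
  have f1: "ip f (\<lambda>x. 1) = 0"
    unfolding f_def ip_diff_left ind[OF C] one using Npos by (simp add: c_def)
  have "ip f f = ip f (\<lambda>x. of_bool (x \<in> C)) - c * ip f (\<lambda>x. 1)"
    unfolding ip_scale_right[symmetric] ip_diff_right[symmetric] by (simp add: f_def)
  also have "\<dots> = real (card C) - real (card C) * c"
    using f1 by (simp add: ip_commute[of f] ind[OF C]) (simp add: f_def sum_subtractf right_diff_distrib)
  finally have ff: "ip f f \<le> real (card C)" by (simp add: c_def)
  have "ip (\<lambda>x. of_bool (x \<in> B)) (conv A (\<lambda>x. of_bool (x \<in> C))) = 0"
    unfolding ind[OF B] conv_def using free by (intro sum.neutral) auto
  moreover have "conv A f = (\<lambda>x. conv A (\<lambda>x. of_bool (x \<in> C)) x - card A * c)"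
    unfolding f_def conv_lin by (simp add: conv_def)
  ultimately have "ip (\<lambda>x. of_bool (x \<in> B)) (conv A f) = - (card A * card B * c)"
    by (simp only: ip_diff_right) (simp add: ind[OF B])
  then have "(card A * card B * c)\<^sup>2 \<le> ip (\<lambda>x. of_bool (x \<in> B)) (\<lambda>x. of_bool (x \<in> B)) * ip (conv A f) (conv A f)"
    using ip_Cauchy_Schwarz[of "\<lambda>x. of_bool (x \<in> B)" "conv A f"] by simp
  also have "ip (\<lambda>x. of_bool (x \<in> B)) (\<lambda>x. of_bool (x \<in> B)) = real (card B)"
    unfolding ind[OF B] by simp
  finally have "real d * (card A * card B * c)\<^sup>2 \<le> card B * (real d * ip (conv A f) (conv A f))"
    using mult_left_mono[of _ _ "real d"] by (simp add: mult.left_commute)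
  also have "\<dots> \<le> card B * (N * real (card A) * ip f f)"
    by (intro mult_left_mono quasirandom_conv_bound qr A f1) simp
  also have "\<dots> \<le> card B * (N * real (card A) * card C)"
    using ff by (intro mult_left_mono) auto
  finally have le: "real d * (card A * card B * c)\<^sup>2 \<le> N * card A * card B * card C"
    by (simp add: mult_ac)
  \<comment> \<open>Clearing the denominator of \<open>c\<close> leaves a bound quadratic in
    \<open>X\<close> on the left and linear on the right, so one factor cancels unless
    \<open>X\<close> is 0.\<close>
  define X where "X = real (card A) * real (card B) * real (card C)"
  have "real d * X\<^sup>2 \<le> N ^ 3 * X"
    using le Npos unfolding c_def X_def
    by (simp add: power2_eq_square power3_eq_cube divide_simps) (simp add: mult_ac)
  moreover have "X \<ge> 0" by (simp add: X_def)
  ultimately have "real d * X \<le> N ^ 3"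
    by (cases "X = 0") (auto simp: power2_eq_square)
  then show ?thesis by (simp add: X_def mult.assoc)
qed

end

section \<open>Finite unitary groups\<close>

lemma mat_adjoint_index [simp]:
  "i < dim_col A \<Longrightarrow> j < dim_row A \<Longrightarrow> mat_adjoint A $$ (i, j) = conjugate (A $$ (j, i))"
  by (simp add: mat_adjoint_def mat_of_rows_def)

lemma mat_adjoint_dim [simp]:
  "dim_row (mat_adjoint A) = dim_col A" "dim_col (mat_adjoint A) = dim_row A"
  by (simp_all add: mat_adjoint_def)

lemma mat_adjoint_mult:
  fixes A B :: "complex mat"
  assumes "A \<in> carrier_mat l m" "B \<in> carrier_mat m n"
  shows "mat_adjoint (A * B) = mat_adjoint B * mat_adjoint A"
  using assms by (intro eq_matI) (auto simp: scalar_prod_def mult.commute)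

text \<open>The Hilbert-Schmidt norm, submultiplicative and unchanged by unitary factors on either
  side. As an \<open>L2_set\<close> over index pairs it inherits the triangle inequality.\<close>

definition frobenius :: "nat \<Rightarrow> complex mat \<Rightarrow> real" where
  "frobenius m A = L2_set (\<lambda>(i, j). cmod (A $$ (i, j))) ({..<m} \<times> {..<m})"

lemma frobenius_nonneg [simp]: "0 \<le> frobenius m A"
  by (simp add: frobenius_def)

lemma frobenius_square: "(frobenius m A)\<^sup>2 = (\<Sum>i<m. \<Sum>j<m. (cmod (A $$ (i, j)))\<^sup>2)"
  by (simp add: frobenius_def L2_set_def sum_nonneg case_prod_unfold sum.cartesian_product)

lemma frobenius_eq_0_iff:
  assumes "A \<in> carrier_mat m m"
  shows "frobenius m A = 0 \<longleftrightarrow> A = 0\<^sub>m m m"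
  using assms by (auto simp: frobenius_def L2_set_eq_0_iff intro!: eq_matI)

lemma frobenius_minus_le:
  assumes "A \<in> carrier_mat m m" "B \<in> carrier_mat m m"
  shows "frobenius m (A - B) \<le> frobenius m A + frobenius m B"
proof -
  have "frobenius m (A - B) \<le> L2_set (\<lambda>x. (case x of (i, j) \<Rightarrow> cmod (A $$ (i, j)))
      + (case x of (i, j) \<Rightarrow> cmod (B $$ (i, j)))) ({..<m} \<times> {..<m})"
    unfolding frobenius_def using assms by (intro L2_set_mono) (auto simp: norm_triangle_ineq4)
  also have "\<dots> \<le> frobenius m A + frobenius m B"
    unfolding frobenius_def by (rule L2_set_triangle_ineq)
  finally show ?thesis .
qed

text \<open>Cauchy-Schwarz for each entry, as a row against a column; the resulting double sum
  factors.\<close>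

lemma frobenius_mult_le:
  assumes "A \<in> carrier_mat m m" "B \<in> carrier_mat m m"
  shows "frobenius m (A * B) \<le> frobenius m A * frobenius m B"
proof (rule power2_le_imp_le)
  have "(cmod ((A * B) $$ (i, j)))\<^sup>2 \<le> (\<Sum>k<m. (cmod (A $$ (i, k)))\<^sup>2) * (\<Sum>k<m. (cmod (B $$ (k, j)))\<^sup>2)"
    if "i < m" "j < m" for i j
  proof -
    have "cmod ((A * B) $$ (i, j)) \<le> (\<Sum>k<m. \<bar>cmod (A $$ (i, k))\<bar> * \<bar>cmod (B $$ (k, j))\<bar>)"
      using assms that
      by (auto simp: scalar_prod_def atLeast0LessThan norm_mult intro!: order_trans[OF norm_sum])
    also have "\<dots> \<le> L2_set (\<lambda>k. cmod (A $$ (i, k))) {..<m} * L2_set (\<lambda>k. cmod (B $$ (k, j))) {..<m}"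
      by (rule L2_set_mult_ineq)
    finally have "(cmod ((A * B) $$ (i, j)))\<^sup>2
        \<le> (L2_set (\<lambda>k. cmod (A $$ (i, k))) {..<m} * L2_set (\<lambda>k. cmod (B $$ (k, j))) {..<m})\<^sup>2"
      by (intro power_mono) auto
    then show ?thesis by (simp add: L2_set_def power_mult_distrib sum_nonneg)
  qed
  then have "(frobenius m (A * B))\<^sup>2
      \<le> (\<Sum>i<m. \<Sum>j<m. (\<Sum>k<m. (cmod (A $$ (i, k)))\<^sup>2) * (\<Sum>k<m. (cmod (B $$ (k, j)))\<^sup>2))"
    unfolding frobenius_square by (intro sum_mono) auto
  also have "\<dots> = (\<Sum>i<m. \<Sum>k<m. (cmod (A $$ (i, k)))\<^sup>2) * (\<Sum>j<m. \<Sum>k<m. (cmod (B $$ (k, j)))\<^sup>2)"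
    by (simp add: sum_product)
  also have "(\<Sum>j<m. \<Sum>k<m. (cmod (B $$ (k, j)))\<^sup>2) = (\<Sum>k<m. \<Sum>j<m. (cmod (B $$ (k, j)))\<^sup>2)"
    by (rule sum.swap)
  finally show "(frobenius m (A * B))\<^sup>2 \<le> (frobenius m A * frobenius m B)\<^sup>2"
    by (simp add: power_mult_distrib frobenius_square)
qed simp

text \<open>The first formula removes a unitary factor on the right of \<open>A\<close>, the second
  one on the left.\<close>

lemma frobenius_square_trace:
  assumes "A \<in> carrier_mat m m"
  shows "complex_of_real ((frobenius m A)\<^sup>2) = (\<Sum>i<m. (A * mat_adjoint A) $$ (i, i))"
    and "complex_of_real ((frobenius m A)\<^sup>2) = (\<Sum>i<m. (mat_adjoint A * A) $$ (i, i))"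
proof -
  have sq: "complex_of_real ((cmod z)\<^sup>2) = z * cnj z" for z
    by (rule complex_norm_square)
  show "complex_of_real ((frobenius m A)\<^sup>2) = (\<Sum>i<m. (A * mat_adjoint A) $$ (i, i))"
    using assms by (simp add: frobenius_square scalar_prod_def atLeast0LessThan sq del: of_real_power)
  have "(frobenius m A)\<^sup>2 = (\<Sum>j<m. \<Sum>i<m. (cmod (A $$ (i, j)))\<^sup>2)"
    unfolding frobenius_square by (rule sum.swap)
  then show "complex_of_real ((frobenius m A)\<^sup>2) = (\<Sum>i<m. (mat_adjoint A * A) $$ (i, i))"
    using assms by (simp add: scalar_prod_def atLeast0LessThan sq mult.commute del: of_real_power)
qed

lemma unitary_groupD:
  assumes "A \<in> carrier (unitary_group m)"
  shows "A \<in> carrier_mat m m" "A * mat_adjoint A = 1\<^sub>m m" "mat_adjoint A * A = 1\<^sub>m m"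
    "mat_adjoint A \<in> carrier_mat m m"
  using assms by (auto simp: unitary_group_def)

lemma frobenius_unitary_left:
  assumes u: "u \<in> carrier (unitary_group m)" and A: "A \<in> carrier_mat m m"
  shows "frobenius m (u * A) = frobenius m A"
proof -
  note uc = unitary_groupD[OF u]
  have Ac: "mat_adjoint A \<in> carrier_mat m m" using A by auto
  have "mat_adjoint (u * A) * (u * A) = mat_adjoint A * (mat_adjoint u * u) * A"
    unfolding mat_adjoint_mult[OF uc(1) A]
    using uc(1,4) A Ac by (simp add: assoc_mult_mat[of _ m m _ m _ m])
  also have "\<dots> = mat_adjoint A * A" using uc A Ac by simp
  finally have "complex_of_real ((frobenius m (u * A))\<^sup>2) = complex_of_real ((frobenius m A)\<^sup>2)"
    using frobenius_square_trace(2)[OF A] frobenius_square_trace(2)[OF mult_carrier_mat[OF uc(1) A]] by simp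
  then show ?thesis by (simp only: of_real_eq_iff) simp
qed

lemma frobenius_unitary_right:
  assumes u: "u \<in> carrier (unitary_group m)" and A: "A \<in> carrier_mat m m"
  shows "frobenius m (A * u) = frobenius m A"
proof -
  note uc = unitary_groupD[OF u]
  have Ac: "mat_adjoint A \<in> carrier_mat m m" using A by auto
  have "(A * u) * mat_adjoint (A * u) = A * (u * mat_adjoint u) * mat_adjoint A"
    unfolding mat_adjoint_mult[OF A uc(1)]
    using uc(1,4) A Ac by (simp add: assoc_mult_mat[of _ m m _ m _ m])
  also have "\<dots> = A * mat_adjoint A" using uc A Ac by simp
  finally have "complex_of_real ((frobenius m (A * u))\<^sup>2) = complex_of_real ((frobenius m A)\<^sup>2)"
    using frobenius_square_trace(1)[OF A] frobenius_square_trace(1)[OF mult_carrier_mat[OF A uc(1)]] by simp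
  then show ?thesis by (simp only: of_real_eq_iff) simp
qed

text \<open>The identity matrix commutes with everything, so
  \<open>u * v - v * u = a * b - b * a\<close> for the deviations \<open>a\<close>, \<open>b\<close>
  of \<open>u\<close>, \<open>v\<close> from it.\<close>

lemma frobenius_commutator_le:
  assumes u: "u \<in> carrier (unitary_group m)" and v: "v \<in> carrier (unitary_group m)"
  shows "frobenius m (u * v - v * u) \<le> 2 * frobenius m (u - 1\<^sub>m m) * frobenius m (v - 1\<^sub>m m)"
proof -
  note uc = unitary_groupD(1)[OF u] and vc = unitary_groupD(1)[OF v]
  define a b where "a = u - 1\<^sub>m m" and "b = v - 1\<^sub>m m"
  have ab: "a \<in> carrier_mat m m" "b \<in> carrier_mat m m" using uc vc by (auto simp: a_def b_def)
  have exp: "(x - 1\<^sub>m m) * (y - 1\<^sub>m m) = x * y - x - y + 1\<^sub>m m"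
    if x: "x \<in> carrier_mat m m" and y: "y \<in> carrier_mat m m" for x y :: "complex mat"
  proof -
    have "(x - 1\<^sub>m m) * (y - 1\<^sub>m m) = x * (y - 1\<^sub>m m) - 1\<^sub>m m * (y - 1\<^sub>m m)"
      using x y by (intro minus_mult_distrib_mat) auto
    also have "x * (y - 1\<^sub>m m) = x * y - x * 1\<^sub>m m"
      using x y by (intro mult_minus_distrib_mat) auto
    finally show ?thesis using x y by (auto intro!: eq_matI)
  qed
  have "u * v - v * u = a * b - b * a"
    unfolding a_def b_def exp[OF uc vc] exp[OF vc uc] using uc vc by (auto intro!: eq_matI)
  also have "frobenius m \<dots> \<le> frobenius m (a * b) + frobenius m (b * a)"
    using ab by (intro frobenius_minus_le) auto
  also have "\<dots> \<le> frobenius m a * frobenius m b + frobenius m b * frobenius m a"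
    using ab by (intro add_mono frobenius_mult_le)
  finally show ?thesis by (simp add: a_def b_def)
qed

lemma group_unitary_group: "group (unitary_group m)"
proof (rule groupI)
  fix x y assume x: "x \<in> carrier (unitary_group m)" and y: "y \<in> carrier (unitary_group m)"
  note xc = unitary_groupD[OF x] and yc = unitary_groupD[OF y]
  have "x * y * (mat_adjoint y * mat_adjoint x) = x * (y * mat_adjoint y) * mat_adjoint x"
    "mat_adjoint y * mat_adjoint x * (x * y) = mat_adjoint y * (mat_adjoint x * x) * y"
    using xc(1,4) yc(1,4) by (simp_all add: assoc_mult_mat[of _ m m _ m _ m])
  then show "x \<otimes>\<^bsub>unitary_group m\<^esub> y \<in> carrier (unitary_group m)"
    using xc yc by (auto simp: unitary_group_def mat_adjoint_mult[OF xc(1) yc(1)])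
next
  show "\<one>\<^bsub>unitary_group m\<^esub> \<in> carrier (unitary_group m)"
  proof -
    have "mat_adjoint (1\<^sub>m m) = (1\<^sub>m m :: complex mat)" by (intro eq_matI) auto
    then show ?thesis by (simp add: unitary_group_def)
  qed
next
  fix x assume x: "x \<in> carrier (unitary_group m)"
  note xc = unitary_groupD[OF x]
  have "mat_adjoint (mat_adjoint x) = x" using xc(1) by (intro eq_matI) auto
  then show "\<exists>y\<in>carrier (unitary_group m). y \<otimes>\<^bsub>unitary_group m\<^esub> x = \<one>\<^bsub>unitary_group m\<^esub>"
    using xc by (intro bexI[of _ "mat_adjoint x"]) (auto simp: unitary_group_def)
qed (auto simp: unitary_group_def assoc_mult_mat)

text \<open>Rows of a unitary matrix are unit vectors. The bound confines the entries to finitely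
  many cells of a grid.\<close>

lemma unitary_entry_le:
  assumes "u \<in> carrier (unitary_group m)" "i < m" "j < m"
  shows "cmod (u $$ (i, j)) \<le> 1"
proof -
  note uc = unitary_groupD[OF assms(1)]
  have "complex_of_real (\<Sum>k<m. (cmod (u $$ (i, k)))\<^sup>2) = (u * mat_adjoint u) $$ (i, i)"
    using uc(1) assms(2) unfolding of_real_sum complex_norm_square
    by (simp add: scalar_prod_def atLeast0LessThan)
  then have "complex_of_real (\<Sum>k<m. (cmod (u $$ (i, k)))\<^sup>2) = complex_of_real 1"
    using uc(2) assms(2) by simp
  then have "(\<Sum>k<m. (cmod (u $$ (i, k)))\<^sup>2) = 1" by (simp only: of_real_eq_iff)
  moreover have "(cmod (u $$ (i, j)))\<^sup>2 \<le> (\<Sum>k<m. (cmod (u $$ (i, k)))\<^sup>2)"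
    using assms(3) by (intro member_le_sum) auto
  ultimately show ?thesis by (simp add: abs_square_le_1[of "cmod _", simplified])
qed

section \<open>Commutators and the centre\<close>

definition (in monoid) comm_center :: "'a set" where
  "comm_center = {z \<in> carrier G. \<forall>h\<in>carrier G. z \<otimes> h = h \<otimes> z}"

lemma (in group) subgroup_comm_center: "subgroup comm_center G"
proof (rule subgroupI)
  fix a assume "a \<in> comm_center"
  then have a: "a \<in> carrier G" "\<And>h. h \<in> carrier G \<Longrightarrow> a \<otimes> h = h \<otimes> a"
    by (auto simp: comm_center_def)
  have "inv a \<otimes> h = h \<otimes> inv a" if "h \<in> carrier G" for h
    using a(1) a(2)[OF that] that by (metis inv_closed inv_solve_left' inv_solve_right' m_assoc m_closed)
  then show "inv a \<in> comm_center" using a(1) by (simp add: comm_center_def)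
next
  fix a b assume "a \<in> comm_center" "b \<in> comm_center"
  then have ab: "a \<in> carrier G" "b \<in> carrier G"
      "\<And>h. h \<in> carrier G \<Longrightarrow> a \<otimes> h = h \<otimes> a" "\<And>h. h \<in> carrier G \<Longrightarrow> b \<otimes> h = h \<otimes> b"
    by (auto simp: comm_center_def)
  have "a \<otimes> b \<otimes> h = h \<otimes> (a \<otimes> b)" if "h \<in> carrier G" for h
  proof -
    have "a \<otimes> b \<otimes> h = a \<otimes> h \<otimes> b" using ab(1,2) ab(4)[OF that] that by (simp add: m_assoc)
    then show ?thesis using ab(1,2) ab(3)[OF that] that by (simp add: m_assoc)
  qed
  then show "a \<otimes> b \<in> comm_center" using ab(1,2) by (simp add: comm_center_def)
qed (auto simp: comm_center_def)

lemma (in group) inv_mult_cancel: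
  assumes "a \<in> carrier G" "b \<in> carrier G"
  shows "inv a \<otimes> (a \<otimes> b) = b" "a \<otimes> (inv a \<otimes> b) = b"
  using assms by (simp_all flip: m_assoc)

abbreviation (in group) commutator :: "'a \<Rightarrow> 'a \<Rightarrow> 'a" where
  "commutator x y \<equiv> x \<otimes> y \<otimes> inv x \<otimes> inv y"

text \<open>Once \<open>commutator g k\<close> is central the conjugation by \<open>h\<close>
  disappears, and \<open>commutator g\<close> is multiplicative.\<close>

lemma (in group) commutator_mult_right:
  assumes "g \<in> carrier G" "h \<in> carrier G" "k \<in> carrier G"
  shows "commutator g (h \<otimes> k) = commutator g h \<otimes> (h \<otimes> commutator g k \<otimes> inv h)"
  using assms by (simp add: m_assoc inv_mult_group inv_mult_cancel)

lemma (in group) commutator_eq_one_iff: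
  assumes "x \<in> carrier G" "y \<in> carrier G"
  shows "commutator x y = \<one> \<longleftrightarrow> x \<otimes> y = y \<otimes> x"
  using assms by (metis inv_closed inv_inv inv_solve_right' l_one m_closed one_closed)

text \<open>\<delta> stands for the distance from the identity. In \<open>conj\<close> the element
  \<open>y\<close> is the conjugate of \<open>x\<close> by \<open>g\<close>, in \<open>comm\<close>
  the element \<open>c\<close> is the commutator of \<open>x\<close> and \<open>y\<close>; both are
  given by equations without inverses, which suit matrices. Either the elements with \<delta> below
  1/2 generate a proper subgroup, or the group is abelian and the trivial subgroup serves, or the
  kernel of a commutator map does.\<close>

lemma (in group) proper_normal_of_commutator_contraction:
  fixes \<delta> :: "'a \<Rightarrow> real"
  assumes fin: "finite (carrier G)" and nontriv: "carrier G \<noteq> {\<one>}"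
    and nonneg: "\<And>x. 0 \<le> \<delta> x" and zero: "\<And>x. x \<in> carrier G \<Longrightarrow> \<delta> x = 0 \<Longrightarrow> x = \<one>"
    and conj: "\<And>x y g. \<lbrakk>x \<in> carrier G; y \<in> carrier G; g \<in> carrier G; y \<otimes> g = g \<otimes> x\<rbrakk> \<Longrightarrow> \<delta> y = \<delta> x"
    and comm: "\<And>x y c. \<lbrakk>x \<in> carrier G; y \<in> carrier G; c \<in> carrier G; c \<otimes> (y \<otimes> x) = x \<otimes> y\<rbrakk>
      \<Longrightarrow> \<delta> c \<le> 2 * \<delta> x * \<delta> y"
  obtains N where "N \<lhd> G" "N \<noteq> carrier G"
    "(\<forall>x\<in>carrier G. \<forall>y\<in>carrier G. commutator x y \<in> N) \<or> {x \<in> carrier G. \<delta> x < 1 / 2} \<subseteq> N"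
proof -
  \<comment> \<open>At 1/2 the factor \<open>2 * \<delta> t\<close> falls below 1, so a commutator
    with an element of \<open>S\<close> has \<delta> strictly below any positive \<delta> of the
    other argument.\<close>
  define S where "S = {x \<in> carrier G. \<delta> x < 1 / 2}"
  have Sc: "S \<subseteq> carrier G" by (auto simp: S_def)
  have normal: "generate G S \<lhd> G"
  proof (rule normal_generateI[OF Sc])
    fix h g assume h: "h \<in> S" and g: "g \<in> carrier G"
    then have "\<delta> (g \<otimes> h \<otimes> inv g) = \<delta> h" using Sc by (intro conj[of _ _ g]) (auto simp: m_assoc)
    then show "g \<otimes> h \<otimes> inv g \<in> S" using h g by (auto simp: S_def)
  qed
  have S_gen: "S \<subseteq> generate G S" by (auto intro: generate.incl)
  consider "generate G S \<noteq> carrier G" | "comm_center = carrier G"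
    | "generate G S = carrier G" "comm_center \<noteq> carrier G" by blast
  then show ?thesis
  proof cases
    case 1
    then show ?thesis using normal S_gen that[of "generate G S"] unfolding S_def by blast
  next
    case 2
    then have "x \<otimes> y = y \<otimes> x" if "x \<in> carrier G" "y \<in> carrier G" for x y
      using that unfolding comm_center_def by blast
    then have "\<forall>x\<in>carrier G. \<forall>y\<in>carrier G. commutator x y \<in> {\<one>}"
      using commutator_eq_one_iff by simp
    then show ?thesis using that[of "{\<one>}"] nontriv one_is_normal by blast
  next
    case 3
    have Zc: "comm_center \<subseteq> carrier G" by (auto simp: comm_center_def)
    have "\<not> S \<subseteq> comm_center"
      using 3 Zc generate_subgroup_incl[OF _ subgroup_comm_center, of S] by blast
    then obtain s where s: "s \<in> S" "s \<notin> comm_center" by blast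
    \<comment> \<open>Take \<open>g\<close> closest to the identity among the non-central elements: its commutators with
      \<open>S\<close> are closer still, hence central, which makes \<open>commutator g\<close> a homomorphism into the centre.\<close>
    define Y where "Y = carrier G - comm_center"
    have "finite Y" "s \<in> Y" using fin s Sc by (auto simp: Y_def)
    then obtain g where g: "g \<in> Y" and min: "\<And>y. y \<in> Y \<Longrightarrow> \<delta> g \<le> \<delta> y"
      using ex_min_if_finite[of "\<delta> ` Y"] by (metis empty_iff finite_imageI imageE image_eqI not_less)
    have gc: "g \<in> carrier G" and gZ: "g \<notin> comm_center" using g by (auto simp: Y_def)
    have "\<delta> g < 1 / 2" using min[OF \<open>s \<in> Y\<close>] s(1) by (simp add: S_def)
    have "\<delta> g \<noteq> 0" using zero[OF gc] gZ subgroup.one_closed[OF subgroup_comm_center] by auto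
    then have gpos: "\<delta> g > 0" using nonneg[of g] by simp
    have S_Z: "commutator g t \<in> comm_center" if t: "t \<in> S" for t
    proof (rule ccontr)
      assume n: "commutator g t \<notin> comm_center"
      have tc: "t \<in> carrier G" using t Sc by blast
      have "\<delta> (commutator g t) \<le> 2 * \<delta> g * \<delta> t"
        using gc tc by (intro comm) (auto simp: m_assoc inv_mult_cancel)
      also have "\<dots> < \<delta> g" using t gpos by (simp add: S_def)
      finally show False using min[of "commutator g t"] n gc tc by (auto simp: Y_def)
    qed
    have mult: "commutator g (h \<otimes> k) = commutator g h \<otimes> commutator g k"
      if h: "h \<in> carrier G" and k: "k \<in> carrier G" "commutator g k \<in> comm_center" for h k
    proof -
      have "h \<otimes> commutator g k = commutator g k \<otimes> h" using k(2) h unfolding comm_center_def by simp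
      then have "h \<otimes> commutator g k \<otimes> inv h = commutator g k \<otimes> (h \<otimes> inv h)"
        using h k(1) gc by (simp only: m_assoc[of "commutator g k"] m_closed inv_closed)
      then have "h \<otimes> commutator g k \<otimes> inv h = commutator g k" using h k(1) gc by simp
      then show ?thesis using commutator_mult_right[OF gc h k(1)] by (simp only:)
    qed
    have all_Z: "commutator g h \<in> comm_center" if "h \<in> carrier G" for h
    proof -
      have "h \<in> generate G S" using that 3 by simp
      then show ?thesis
      proof induction
        case one
        then show ?case using gc subgroup.one_closed[OF subgroup_comm_center] by simp
      next
        case (incl h)
        then show ?case by (rule S_Z)
      next
        case (inv h)
        then have hc: "h \<in> carrier G" using Sc by blast
        have "commutator g (inv h) \<otimes> commutator g h = \<one>"
          using mult[OF inv_closed[OF hc] hc S_Z[OF inv]] hc gc by simp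
        then have "commutator g (inv h) = inv (commutator g h)"
          using hc gc by (metis inv_closed inv_equality m_closed inv_inv)
        then show ?case using subgroup.m_inv_closed[OF subgroup_comm_center S_Z[OF inv]] by simp
      next
        case (eng h k)
        then have "h \<in> carrier G" "k \<in> carrier G" using generate_in_carrier[OF Sc] by auto
        then show ?case using mult eng.IH subgroup.m_closed[OF subgroup_comm_center] by simp
      qed
    qed
    have "group_hom G G (commutator g)"
      using gc mult all_Z by unfold_locales (auto simp: hom_def)
    then interpret \<phi>: group_hom G G "commutator g" .
    let ?N = "kernel G G (commutator g)"
    \<comment> \<open>The values of \<open>commutator g\<close> commute with everything, so this
      homomorphism sends every commutator to the identity.\<close>
    have "commutator x y \<in> ?N" if x: "x \<in> carrier G" and y: "y \<in> carrier G" for x y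
    proof -
      have "commutator g (commutator x y) = commutator (commutator g x) (commutator g y)"
        by (simp only: \<phi>.hom_mult \<phi>.hom_inv m_closed inv_closed x y)
      also have "\<dots> = \<one>"
        using all_Z[OF x] x y gc by (subst commutator_eq_one_iff) (auto simp: comm_center_def)
      finally show ?thesis using x y by (simp add: kernel_def)
    qed
    \<comment> \<open>A full kernel would make \<open>g\<close> central.\<close>
    moreover have "?N \<noteq> carrier G"
    proof
      assume "?N = carrier G"
      then have "g \<otimes> h = h \<otimes> g" if "h \<in> carrier G" for h
        using that gc commutator_eq_one_iff by (auto simp: kernel_def)
      then show False using gc gZ by (auto simp: comm_center_def)
    qed
    ultimately show ?thesis using that[of ?N] \<phi>.normal_kernel by blast
  qed
qed

section \<open>Proper normal subgroups from unitary representations\<close>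

definition contains_commutators :: "('g, 'm) monoid_scheme \<Rightarrow> 'g set \<Rightarrow> bool" where
  "contains_commutators H N \<longleftrightarrow> (\<forall>x\<in>carrier H. \<forall>y\<in>carrier H.
     x \<otimes>\<^bsub>H\<^esub> y \<otimes>\<^bsub>H\<^esub> inv\<^bsub>H\<^esub> x \<otimes>\<^bsub>H\<^esub> inv\<^bsub>H\<^esub> y \<in> N)"

text \<open>Index at most \<open>k\<close>, with named representatives that may repeat; in this form
  they can be collected into sequences along \<open>n\<close>.\<close>

definition covered_by_cosets :: "nat \<Rightarrow> ('g, 'm) monoid_scheme \<Rightarrow> 'g set \<Rightarrow> bool" where
  "covered_by_cosets k H N \<longleftrightarrow> (\<exists>t. (\<forall>i<k. t i \<in> carrier H) \<and>
     (\<forall>x\<in>carrier H. \<exists>i<k. x \<otimes>\<^bsub>H\<^esub> inv\<^bsub>H\<^esub> (t i) \<in> N))"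

text \<open>This replaces Jordan's theorem on finite linear groups: cells of side \<open>1 / r\<close> in matrix space
  bound the index of the subgroup generated by the elements close to the identity.\<close>

lemma unitary_image_proper_normal:
  fixes m :: nat
  obtains k where "\<And>(H :: 'g monoid) \<pi>. \<lbrakk>group H; finite (carrier H); \<pi> \<in> hom H (unitary_group m);
      \<exists>g\<in>carrier H. \<pi> g \<noteq> 1\<^sub>m m\<rbrakk> \<Longrightarrow>
    \<exists>N. N \<lhd> H \<and> N \<noteq> carrier H \<and> (contains_commutators H N \<or> covered_by_cosets k H N)"
proof -
  define I where "I = {..<m} \<times> {..<m}"
  \<comment> \<open>Two matrices in one cell differ by at most \<open>2 / r\<close> in modulus at
    each entry, hence by at most \<open>2 * m / r\<close> in norm, which is below the contraction
    threshold 1/2 for this \<open>r\<close>.\<close>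
  define r :: int where "r = 4 * int m + 4"
  define Q where "Q = I \<rightarrow>\<^sub>E ({-r..r} \<times> {-r..r})"
  define col :: "complex mat \<Rightarrow> _" where
    "col u = restrict (\<lambda>p. (\<lfloor>of_int r * Re (u $$ p)\<rfloor>, \<lfloor>of_int r * Im (u $$ p)\<rfloor>)) I" for u
  have "finite Q" by (auto simp: Q_def I_def intro!: finite_PiE)
  then obtain e where e: "bij_betw e {..<card Q} Q"
    using ex_bij_betw_nat_finite atLeast0LessThan by metis
  have colQ: "col u \<in> Q" if u: "u \<in> carrier (unitary_group m)" for u
  proof -
    have "\<lfloor>of_int r * z\<rfloor> \<in> {-r..r}" if "\<bar>z\<bar> \<le> 1" for z :: real
    proof -
      have "\<bar>of_int r * z\<bar> \<le> of_int r * 1" unfolding abs_mult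
        using that by (intro mult_mono) (auto simp: r_def)
      then show ?thesis by (simp add: le_floor_iff floor_le_iff abs_le_iff)
    qed
    moreover have "\<bar>Re (u $$ p)\<bar> \<le> 1" "\<bar>Im (u $$ p)\<bar> \<le> 1" if "p \<in> I" for p
      using unitary_entry_le[OF u] that abs_Re_le_cmod[of "u $$ p"] abs_Im_le_cmod[of "u $$ p"]
      by (force simp: I_def)+
    ultimately show ?thesis by (auto simp: Q_def col_def)
  qed
  have col_close: "frobenius m (v - u) < 1 / 2"
    if u: "u \<in> carrier (unitary_group m)" and v: "v \<in> carrier (unitary_group m)" and eq: "col u = col v" for u v
  proof -
    have "cmod ((v - u) $$ p) \<le> 2 / of_int r" if p: "p \<in> I" for p
    proof -
      have "\<bar>x - y\<bar> \<le> 1 / of_int r" if "\<lfloor>of_int r * x\<rfloor> = \<lfloor>of_int r * y\<rfloor>" for x y :: real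
      proof -
        have "\<bar>of_int r * x - of_int r * y\<bar> \<le> 1" using that by linarith
        then have "of_int r * \<bar>x - y\<bar> \<le> 1" by (simp add: abs_mult r_def flip: right_diff_distrib)
        then show ?thesis by (simp add: r_def field_simps)
      qed
      then have "\<bar>Re (v $$ p) - Re (u $$ p)\<bar> \<le> 1 / of_int r" "\<bar>Im (v $$ p) - Im (u $$ p)\<bar> \<le> 1 / of_int r"
        using fun_cong[OF eq, of p] p by (auto simp: col_def)
      moreover have "(v - u) $$ p = v $$ p - u $$ p"
        using p unitary_groupD(1)[OF u] unitary_groupD(1)[OF v] by (auto simp: I_def)
      ultimately show ?thesis using cmod_le[of "v $$ p - u $$ p"] by simp
    qed
    then have "frobenius m (v - u) \<le> L2_set (\<lambda>p. 2 / of_int r) I"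
      unfolding frobenius_def I_def by (intro L2_set_mono) auto
    also have "\<dots> = 2 * m / of_int r" by (simp add: L2_set_constant I_def r_def)
    also have "\<dots> < 1 / 2" by (simp add: r_def field_simps)
    finally show ?thesis .
  qed
  have main: "\<exists>N. N \<lhd> H \<and> N \<noteq> carrier H \<and>
      (contains_commutators H N \<or> covered_by_cosets (card Q) H N)"
    if H: "group H" and fin: "finite (carrier H)" and hom: "\<pi> \<in> hom H (unitary_group m)"
      and nontriv: "\<exists>g\<in>carrier H. \<pi> g \<noteq> 1\<^sub>m m" for H :: "'g monoid" and \<pi>
  proof -
    interpret H: group H by (rule H)
    interpret W: group "unitary_group m" by (rule group_unitary_group)
    have gh: "group_hom H (unitary_group m) \<pi>" using hom by unfold_locales
    define K where "K = (unitary_group m)\<lparr>carrier := \<pi> ` carrier H\<rparr>"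
    interpret K: group K
      unfolding K_def by (rule subgroup.subgroup_is_group[OF group_hom.img_is_subgroup[OF gh] W.group_axioms])
    have cK: "carrier K = \<pi> ` carrier H" and mK: "x \<otimes>\<^bsub>K\<^esub> y = x * y" and oK: "\<one>\<^bsub>K\<^esub> = 1\<^sub>m m" for x y
      by (simp_all add: K_def unitary_group_def)
    have KW: "x \<in> carrier (unitary_group m)" if "x \<in> carrier K" for x
      using that group_hom.hom_closed[OF gh] by (auto simp: cK)
    have Kc: "x \<in> carrier_mat m m" if "x \<in> carrier K" for x
      using KW[OF that] by (rule unitary_groupD)
    define \<delta> where "\<delta> x = frobenius m (x - 1\<^sub>m m)" for x
    \<comment> \<open>Multiplying \<open>c - 1\<^sub>m m\<close> by the unitary \<open>u\<close>
      keeps its norm. This reads off the distance of a quotient \<open>c\<close> of \<open>v\<close>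
      by \<open>u\<close> without inverting a matrix.\<close>
    have \<delta>_eq: "\<delta> c = frobenius m (v - u)" if "c \<in> carrier K" "u \<in> carrier K" "c * u = v" for c u v
    proof -
      have "frobenius m ((c - 1\<^sub>m m) * u) = \<delta> c"
        unfolding \<delta>_def using that Kc by (intro frobenius_unitary_right KW) auto
      moreover have "(c - 1\<^sub>m m) * u = v - u"
        using that(3) Kc[OF that(1)] Kc[OF that(2)] minus_mult_distrib_mat[of c m m "1\<^sub>m m" u m] by simp
      ultimately show ?thesis by simp
    qed
    obtain N where N: "N \<lhd> K" "N \<noteq> carrier K"
      "(\<forall>x\<in>carrier K. \<forall>y\<in>carrier K. K.commutator x y \<in> N) \<or> {x \<in> carrier K. \<delta> x < 1 / 2} \<subseteq> N"
    proof (rule K.proper_normal_of_commutator_contraction)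
      show "finite (carrier K)" using fin by (simp add: cK)
      show "carrier K \<noteq> {\<one>\<^bsub>K\<^esub>}" using nontriv by (auto simp: cK oK)
      show "0 \<le> \<delta> x" for x by (simp add: \<delta>_def)
      show "x = \<one>\<^bsub>K\<^esub>" if "x \<in> carrier K" "\<delta> x = 0" for x
      proof -
        have "x - 1\<^sub>m m \<in> carrier_mat m m" using Kc[OF that(1)] by auto
        then have "x - 1\<^sub>m m = 0\<^sub>m m m"
          using that(2) unfolding \<delta>_def by (rule frobenius_eq_0_iff[THEN iffD1])
        then have "x - 1\<^sub>m m + 1\<^sub>m m = 1\<^sub>m m" by simp
        moreover have "x - 1\<^sub>m m + 1\<^sub>m m = x" using Kc[OF that(1)] by (intro eq_matI) auto
        ultimately show ?thesis by (simp add: oK)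
      qed
      show "\<delta> y = \<delta> x" if x: "x \<in> carrier K" and y: "y \<in> carrier K" and g: "g \<in> carrier K"
        and eq: "y \<otimes>\<^bsub>K\<^esub> g = g \<otimes>\<^bsub>K\<^esub> x" for x y g
      proof -
        have "\<delta> y = frobenius m (g * x - g)" using \<delta>_eq[OF y g] eq by (simp add: mK)
        also have "g * x - g = g * (x - 1\<^sub>m m)"
          using Kc[OF g] Kc[OF x] mult_minus_distrib_mat[of g m m x m "1\<^sub>m m"] by simp
        also have "frobenius m \<dots> = \<delta> x"
          unfolding \<delta>_def using Kc[OF x] by (intro frobenius_unitary_left KW g) auto
        finally show ?thesis .
      qed
      show "\<delta> c \<le> 2 * \<delta> x * \<delta> y" if x: "x \<in> carrier K" and y: "y \<in> carrier K" and c: "c \<in> carrier K"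
        and eq: "c \<otimes>\<^bsub>K\<^esub> (y \<otimes>\<^bsub>K\<^esub> x) = x \<otimes>\<^bsub>K\<^esub> y" for x y c
        using \<delta>_eq[OF c K.m_closed[OF y x]] eq frobenius_commutator_le[OF KW[OF x] KW[OF y]]
        by (simp add: mK \<delta>_def)
    qed
    have hK: "\<pi> \<in> hom H K" using hom by (auto simp: hom_def cK mK unitary_group_def)
    interpret \<pi>K: group_hom H K \<pi> using hK by unfold_locales
    define M where "M = {g \<in> carrier H. \<pi> g \<in> N}"
    have "M \<lhd> H"
    proof -
      have sub: "subgroup N K" using N(1) by (rule normal_imp_subgroup)
      have "subgroup M H"
        unfolding M_def
        by (rule H.subgroupI)
          (auto simp: \<pi>K.hom_mult subgroup.m_closed[OF sub] subgroup.m_inv_closed[OF sub]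
            intro!: exI[of _ "\<one>\<^bsub>H\<^esub>"] subgroup.one_closed[OF sub])
      moreover have "x \<otimes>\<^bsub>H\<^esub> h \<otimes>\<^bsub>H\<^esub> inv\<^bsub>H\<^esub> x \<in> M" if "x \<in> carrier H" "h \<in> M" for x h
        using that normal.inv_op_closed2[OF N(1), of "\<pi> x" "\<pi> h"] by (simp add: M_def)
      ultimately show ?thesis by (simp add: H.normal_inv_iff)
    qed
    moreover have "M \<noteq> carrier H"
      using N(2) subgroup.subset[OF normal_imp_subgroup[OF N(1)]] by (auto simp: M_def cK)
    moreover have "contains_commutators H M \<or> covered_by_cosets (card Q) H M"
      unfolding contains_commutators_def covered_by_cosets_def
      using N(3)
    proof (elim disj_forward)
      assume "\<forall>x\<in>carrier K. \<forall>y\<in>carrier K. K.commutator x y \<in> N"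
      then show "\<forall>x\<in>carrier H. \<forall>y\<in>carrier H. H.commutator x y \<in> M"
        by (simp add: M_def)
    next
      assume small: "{x \<in> carrier K. \<delta> x < 1 / 2} \<subseteq> N"
      \<comment> \<open>One representative for each cell that the image meets, and the identity as a
        default for the others.\<close>
      define t where "t i = (if \<exists>h\<in>carrier H. col (\<pi> h) = e i then SOME h. h \<in> carrier H \<and> col (\<pi> h) = e i
        else \<one>\<^bsub>H\<^esub>)" for i
      have t: "t i \<in> carrier H \<and> col (\<pi> (t i)) = e i" if "\<exists>h\<in>carrier H. col (\<pi> h) = e i" for i
        using someI_ex[of "\<lambda>h. h \<in> carrier H \<and> col (\<pi> h) = e i"] that by (auto simp: t_def)
      show "\<exists>t. (\<forall>i<card Q. t i \<in> carrier H) \<and> (\<forall>x\<in>carrier H. \<exists>i<card Q. x \<otimes>\<^bsub>H\<^esub> inv\<^bsub>H\<^esub> (t i) \<in> M)"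
      proof (intro exI[of _ t] conjI allI impI ballI)
        show "t i \<in> carrier H" for i using t[of i] by (cases "\<exists>h\<in>carrier H. col (\<pi> h) = e i") (auto simp: t_def)
        fix x assume x: "x \<in> carrier H"
        have "col (\<pi> x) \<in> e ` {..<card Q}" using colQ[OF KW] e x by (simp add: bij_betw_def)
        then obtain i where i: "i < card Q" "col (\<pi> x) = e i" by auto
        then have ti: "t i \<in> carrier H" "col (\<pi> (t i)) = col (\<pi> x)" using t[of i] x by auto
        let ?c = "x \<otimes>\<^bsub>H\<^esub> inv\<^bsub>H\<^esub> (t i)"
        have "?c \<otimes>\<^bsub>H\<^esub> t i = x" using x ti by (simp add: H.m_assoc)
        then have "\<pi> ?c * \<pi> (t i) = \<pi> x" using \<pi>K.hom_mult[of ?c "t i"] x ti by (simp add: mK del: \<pi>K.hom_mult)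
        then have "\<delta> (\<pi> ?c) = frobenius m (\<pi> x - \<pi> (t i))"
          using x ti by (intro \<delta>_eq) (auto simp del: \<pi>K.hom_mult)
        also have "\<dots> < 1 / 2" using x ti by (intro col_close KW) auto
        finally have "\<pi> ?c \<in> N" using small x ti by (auto simp del: \<pi>K.hom_mult)
        then show "\<exists>i<card Q. x \<otimes>\<^bsub>H\<^esub> inv\<^bsub>H\<^esub> (t i) \<in> M" using i(1) x ti
          by (auto simp: M_def simp del: \<pi>K.hom_mult)
      qed
    qed
    ultimately show ?thesis by blast
  qed
  show ?thesis by (rule that[of "card Q", OF main])
qed

section \<open>Product sets and compactifications\<close>

context finite_group_ultraproduct
begin

text \<open>If the internal sets were disjoint, so would be almost all of their factors; the
  densities would then add up to at most 1, also in the limit.\<close>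

lemma measure_one_meets_non_null:
  assumes X: "\<And>n. X n \<subseteq> carrier (G n)" and Y: "\<And>n. Y n \<subseteq> carrier (G n)"
    and one: "internal_measure U G (internal_product U G X) = 1"
    and nn: "non_null U G (internal_product U G Y)"
  shows "internal_product U G X \<inter> internal_product U G Y \<noteq> {}"
proof
  assume disj: "internal_product U G X \<inter> internal_product U G Y = {}"
  have "\<not> eventually (\<lambda>n. \<exists>x\<in>carrier (G n). x \<in> X n \<and> x \<in> Y n) U"
  proof
    assume "eventually (\<lambda>n. \<exists>x\<in>carrier (G n). x \<in> X n \<and> x \<in> Y n) U"
    then obtain f where f: "f \<in> seqs" "eventually (\<lambda>n. f n \<in> X n \<and> f n \<in> Y n) U"
      by (rule seq_of_eventually_ex)
    then have "cls f \<in> internal_product U G X \<inter> internal_product U G Y"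
      using cls_in_internal[OF f(1)] by (simp add: eventually_conj_iff)
    with disj show False by blast
  qed
  then have "eventually (\<lambda>n. \<not> (\<exists>x\<in>carrier (G n). x \<in> X n \<and> x \<in> Y n)) U"
    by (simp only: ev_not) simp
  then have "eventually (\<lambda>n. density X n + density Y n \<le> 1) U"
  proof eventually_elim
    case (elim n)
    then have "X n \<inter> Y n = {}" using X[of n] by blast
    then have "card (X n) + card (Y n) = card (X n \<union> Y n)"
      using finite_subset[OF X fin] finite_subset[OF Y fin] by (simp add: card_Un_disjoint)
    also have "\<dots> \<le> card (carrier (G n))" using X Y by (intro card_mono fin) auto
    finally show ?case using card_pos[of n] by (simp add: add_divide_distrib[symmetric] divide_le_eq_1)
  qed
  moreover have "((\<lambda>n. density X n + density Y n) \<longlongrightarrow>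
      1 + internal_measure U G (internal_product U G Y)) U"
    using tendsto_add[OF density_tendsto[OF X] density_tendsto[OF Y]] by (simp add: one)
  ultimately have "1 + internal_measure U G (internal_product U G Y) \<le> 1"
    using U_neq_bot by (intro tendsto_upperbound)
  then show False using nn internal_measure_nonneg[OF Y] by (simp add: non_null_def)
qed

text \<open>This set consists of the \<open>x\<close> that can be completed to \<open>h\<close> by a
  factor from \<open>C\<close>. In each factor \<open>x\<close> is mapped bijectively to the
  completing element, which preserves the counting measure.\<close>

lemma internal_inv_translate:
  assumes h: "h \<in> carrier GG" and C: "internal U G C"
  obtains X where "\<And>n. X n \<subseteq> carrier (G n)"
    "internal_product U G X = {x \<in> carrier GG. inv\<^bsub>GG\<^esub> x \<otimes>\<^bsub>GG\<^esub> h \<in> C}"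
    "internal_measure U G (internal_product U G X) = internal_measure U G C"
proof -
  obtain Z where Z: "\<And>n. Z n \<subseteq> carrier (G n)" and C_eq: "C = internal_product U G Z"
    using internalE[OF C] by blast
  obtain k where k: "k \<in> seqs" "h = cls k" using h by (rule carrier_GG_E)
  define X where "X n = {x \<in> carrier (G n). inv\<^bsub>G n\<^esub> x \<otimes>\<^bsub>G n\<^esub> k n \<in> Z n}" for n
  have Xc: "X n \<subseteq> carrier (G n)" for n by (auto simp: X_def)
  have "card (X n) = card (Z n)" for n
  proof -
    interpret group "G n" by (rule grp)
    have kn: "k n \<in> carrier (G n)" using k(1) by simp
    have "bij_betw (\<lambda>x. inv\<^bsub>G n\<^esub> x \<otimes>\<^bsub>G n\<^esub> k n) (X n) (Z n)"
    proof (rule bij_betw_byWitness[where f' = "\<lambda>z. k n \<otimes>\<^bsub>G n\<^esub> inv\<^bsub>G n\<^esub> z"])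
      show "\<forall>x\<in>X n. k n \<otimes>\<^bsub>G n\<^esub> inv\<^bsub>G n\<^esub> (inv\<^bsub>G n\<^esub> x \<otimes>\<^bsub>G n\<^esub> k n) = x"
        using kn by (auto simp: X_def inv_mult_group m_assoc[symmetric])
      have inv_eq: "inv\<^bsub>G n\<^esub> (k n \<otimes>\<^bsub>G n\<^esub> inv\<^bsub>G n\<^esub> z) \<otimes>\<^bsub>G n\<^esub> k n = z" if "z \<in> Z n" for z
        using kn Z[of n] that by (auto simp: inv_mult_group m_assoc subset_iff)
      then show "\<forall>z\<in>Z n. inv\<^bsub>G n\<^esub> (k n \<otimes>\<^bsub>G n\<^esub> inv\<^bsub>G n\<^esub> z) \<otimes>\<^bsub>G n\<^esub> k n = z" by blast
      show "(\<lambda>z. k n \<otimes>\<^bsub>G n\<^esub> inv\<^bsub>G n\<^esub> z) ` Z n \<subseteq> X n"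
        using kn Z[of n] inv_eq by (auto simp: X_def)
    qed (auto simp: X_def)
    then show ?thesis by (rule bij_betw_same_card)
  qed
  then have meas: "internal_measure U G (internal_product U G X) = internal_measure U G C"
    unfolding C_eq by (intro internal_measure_eq_of_card Xc Z)
  have "cls f \<in> internal_product U G X \<longleftrightarrow> inv\<^bsub>GG\<^esub> (cls f) \<otimes>\<^bsub>GG\<^esub> h \<in> C" if f: "f \<in> seqs" for f
    using f unfolding k(2) C_eq cls_inv[OF f] cls_mult[OF inv_seqs[OF f] k(1)]
      cls_in_internal[OF f] cls_in_internal[OF mult_seqs[OF inv_seqs[OF f] k(1)]]
    by (simp add: X_def)
  then have "x \<in> internal_product U G X \<longleftrightarrow> inv\<^bsub>GG\<^esub> x \<otimes>\<^bsub>GG\<^esub> h \<in> C" if "x \<in> carrier GG" for x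
    using that by (auto simp: carrier_GG)
  then have eq: "internal_product U G X = {x \<in> carrier GG. inv\<^bsub>GG\<^esub> x \<otimes>\<^bsub>GG\<^esub> h \<in> C}"
    using internal_product_subset[of X] by blast
  show ?thesis by (rule that[OF Xc eq meas])
qed

lemma triple_product_of_measure_one:
  assumes c: "\<And>A B. \<lbrakk>internal U G A; internal U G B; non_null U G A; non_null U G B\<rbrakk>
      \<Longrightarrow> internal_measure U G (A <#>\<^bsub>GG\<^esub> B) = 1"
    and A: "internal U G A" "non_null U G A" and B: "internal U G B" "non_null U G B"
    and C: "internal U G C" "non_null U G C"
  shows "carrier GG = A <#>\<^bsub>GG\<^esub> B <#>\<^bsub>GG\<^esub> C"
proof
  show "A <#>\<^bsub>GG\<^esub> B <#>\<^bsub>GG\<^esub> C \<subseteq> carrier GG"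
    using A B C internal_subset by (intro GG.set_mult_closed) auto
  show "carrier GG \<subseteq> A <#>\<^bsub>GG\<^esub> B <#>\<^bsub>GG\<^esub> C"
  proof
    fix h assume h: "h \<in> carrier GG"
    obtain X where X: "\<And>n. X n \<subseteq> carrier (G n)"
        "internal_product U G X = {x \<in> carrier GG. inv\<^bsub>GG\<^esub> x \<otimes>\<^bsub>GG\<^esub> h \<in> C}"
        "internal_measure U G (internal_product U G X) = internal_measure U G C"
      using internal_inv_translate[OF h C(1)] by blast
    obtain S where S: "\<And>n. S n \<subseteq> carrier (G n)" "A = internal_product U G S"
      using internalE[OF A(1)] by blast
    obtain T where T: "\<And>n. T n \<subseteq> carrier (G n)" "B = internal_product U G T"
      using internalE[OF B(1)] by blast
    have AB: "A <#>\<^bsub>GG\<^esub> B = internal_product U G (\<lambda>n. S n <#>\<^bsub>G n\<^esub> T n)"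
      unfolding S(2) T(2) by (rule set_mult_internal_product[OF S(1) T(1)])
    have "internal_product U G (\<lambda>n. S n <#>\<^bsub>G n\<^esub> T n) \<inter> internal_product U G X \<noteq> {}"
    proof (rule measure_one_meets_non_null)
      show "S n <#>\<^bsub>G n\<^esub> T n \<subseteq> carrier (G n)" for n
        by (rule monoid.set_mult_closed[OF group.is_monoid[OF grp] S(1) T(1)])
      show "internal_measure U G (internal_product U G (\<lambda>n. S n <#>\<^bsub>G n\<^esub> T n)) = 1"
        using c[OF A(1) B(1) A(2) B(2)] by (simp only: AB)
      show "non_null U G (internal_product U G X)" using C(2) X(3) by (simp add: non_null_def)
    qed (rule X(1))
    then obtain x where x: "x \<in> A <#>\<^bsub>GG\<^esub> B" "x \<in> carrier GG" "inv\<^bsub>GG\<^esub> x \<otimes>\<^bsub>GG\<^esub> h \<in> C"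
      unfolding AB X(2) by blast
    have "h = x \<otimes>\<^bsub>GG\<^esub> (inv\<^bsub>GG\<^esub> x \<otimes>\<^bsub>GG\<^esub> h)" using x(2) h by (simp flip: GG.m_assoc)
    moreover have "x \<otimes>\<^bsub>GG\<^esub> (inv\<^bsub>GG\<^esub> x \<otimes>\<^bsub>GG\<^esub> h) \<in> A <#>\<^bsub>GG\<^esub> B <#>\<^bsub>GG\<^esub> C"
      using x(1,3) unfolding set_mult_def[of GG "A <#>\<^bsub>GG\<^esub> B"] by blast
    ultimately show "h \<in> A <#>\<^bsub>GG\<^esub> B <#>\<^bsub>GG\<^esub> C" by simp
  qed
qed

lemma product_free_null_of_triple_product:
  assumes d: "\<And>A B C. \<lbrakk>internal U G A; internal U G B; internal U G C;
      non_null U G A; non_null U G B; non_null U G C\<rbrakk> \<Longrightarrow> carrier GG = A <#>\<^bsub>GG\<^esub> B <#>\<^bsub>GG\<^esub> C"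
    and A: "internal U G A" "product_free GG A"
  shows "internal_measure U G A = 0"
proof (rule ccontr)
  assume nn: "internal_measure U G A \<noteq> 0"
  \<comment> \<open>With the identity for \<open>h\<close> the set consists of the inverses of the
    elements of \<open>A\<close>.\<close>
  obtain X where X: "\<And>n. X n \<subseteq> carrier (G n)"
      "internal_product U G X = {x \<in> carrier GG. inv\<^bsub>GG\<^esub> x \<otimes>\<^bsub>GG\<^esub> \<one>\<^bsub>GG\<^esub> \<in> A}"
      "internal_measure U G (internal_product U G X) = internal_measure U G A"
    using internal_inv_translate[OF GG.one_closed A(1)] by blast
  have "carrier GG = A <#>\<^bsub>GG\<^esub> A <#>\<^bsub>GG\<^esub> internal_product U G X"
    using nn X(3) A(1) by (intro d internal_productI X(1)) (simp_all add: non_null_def)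
  then have "\<one>\<^bsub>GG\<^esub> \<in> A <#>\<^bsub>GG\<^esub> A <#>\<^bsub>GG\<^esub> internal_product U G X" using GG.one_closed by blast
  then obtain x y z where xyz: "x \<in> A" "y \<in> A" "z \<in> internal_product U G X"
      "x \<otimes>\<^bsub>GG\<^esub> y \<otimes>\<^bsub>GG\<^esub> z = \<one>\<^bsub>GG\<^esub>"
    unfolding set_mult_def by auto
  have carr: "x \<in> carrier GG" "y \<in> carrier GG" "z \<in> carrier GG"
    using xyz internal_subset[OF A(1)] internal_product_subset by blast+
  then have "x \<otimes>\<^bsub>GG\<^esub> y = inv\<^bsub>GG\<^esub> z" using xyz(4) by (metis GG.inv_equality GG.inv_inv GG.m_closed)
  moreover have "inv\<^bsub>GG\<^esub> z \<in> A" using xyz(3) carr unfolding X(2) by simp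
  ultimately show False using A(2) xyz unfolding product_free_def by blast
qed

text \<open>Lifting \<open>F\<close> to a finite set of sequences carries the covering to almost all
  factors by \<open>los_all\<close>. Counting there bounds the density below by the reciprocal of
  the number of translates, uniformly in \<open>n\<close>.\<close>

lemma non_null_of_finite_cover:
  assumes A: "internal U G A" and F: "finite F" "F \<subseteq> carrier GG"
    and cover: "\<And>h. h \<in> carrier GG \<Longrightarrow> \<exists>g\<in>F. g \<otimes>\<^bsub>GG\<^esub> h \<in> A"
  shows "non_null U G A"
proof -
  obtain X where X: "\<And>n. X n \<subseteq> carrier (G n)" "A = internal_product U G X"
    using internalE[OF A] by blast
  obtain F' where F': "F' \<subseteq> seqs" "finite F'" "F = cls ` F'"
    using finite_subset_image[OF F(1), of cls seqs] F(2) unfolding carrier_GG by blast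
  have "eventually (\<lambda>n. \<forall>x\<in>carrier (G n). \<exists>f\<in>F'. f n \<otimes>\<^bsub>G n\<^esub> x \<in> X n) U"
  proof (rule los_all)
    fix h assume h: "h \<in> seqs"
    obtain f where f: "f \<in> F'" "cls f \<otimes>\<^bsub>GG\<^esub> cls h \<in> A"
      using cover[OF cls_closed[OF h]] unfolding F'(3) by blast
    then have "eventually (\<lambda>n. f n \<otimes>\<^bsub>G n\<^esub> h n \<in> X n) U"
      using F'(1) h cls_mult[of f h] cls_in_internal[OF mult_seqs[of f h]] unfolding X(2) by auto
    then show "eventually (\<lambda>n. \<exists>f\<in>F'. f n \<otimes>\<^bsub>G n\<^esub> h n \<in> X n) U"
      by (rule eventually_mono) (use f(1) in blast)
  qed
  then have "eventually (\<lambda>n. 1 \<le> real (card F') * density X n) U"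
  proof eventually_elim
    case (elim n)
    interpret group "G n" by (rule grp)
    have fn: "f n \<in> carrier (G n)" if "f \<in> F'" for f using F'(1) that by blast
    let ?Y = "\<lambda>f. {x \<in> carrier (G n). f n \<otimes>\<^bsub>G n\<^esub> x \<in> X n}"
    have "card (carrier (G n)) \<le> card (\<Union>f\<in>F'. ?Y f)"
      using elim by (intro card_mono finite_UN_I F'(2)) (auto simp: fin)
    also have "\<dots> \<le> (\<Sum>f\<in>F'. card (?Y f))" by (rule card_UN_le[OF F'(2)])
    also have "\<dots> \<le> (\<Sum>f\<in>F'. card (X n))"
    proof (rule sum_mono)
      fix f assume f: "f \<in> F'"
      have "inj_on (\<lambda>x. f n \<otimes>\<^bsub>G n\<^esub> x) (?Y f)" using fn[OF f] by (auto simp: inj_on_def)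
      then show "card (?Y f) \<le> card (X n)"
        by (rule card_inj_on_le) (use finite_subset[OF X(1) fin] in auto)
    qed
    finally have "real (card (carrier (G n))) \<le> real (card F') * real (card (X n))"
      by (simp flip: of_nat_mult)
    then show ?case using card_pos[of n] by (simp add: le_divide_eq)
  qed
  moreover have "((\<lambda>n. real (card F') * density X n) \<longlongrightarrow> real (card F') * internal_measure U G A) U"
    unfolding X(2) by (intro tendsto_mult_left density_tendsto X(1))
  ultimately have "1 \<le> real (card F') * internal_measure U G A"
    using U_neq_bot by (intro tendsto_lowerbound)
  then show ?thesis by (auto simp: non_null_def)
qed

text \<open>Regularity gives a neighbourhood \<open>O'\<close> of \<open>k\<close> and an open
  \<open>V\<close> around the complement of \<open>W\<close>, disjoint from \<open>O'\<close>. An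
  internal set that separates the complements of \<open>V\<close> and of \<open>W\<close> maps into
  \<open>W\<close> and contains the preimage of \<open>O'\<close>. By density and compactness
  finitely many translates of \<open>O'\<close> cover the compactification, so
  \<open>non_null_of_finite_cover\<close> applies.\<close>

lemma compactification_neighbourhood_non_null:
  fixes K :: "'k monoid"
  assumes comp: "internal_compactification U G K T \<rho>" and W: "openin T W" "k \<in> W"
  obtains A where "internal U G A" "non_null U G A" "\<rho> ` A \<subseteq> W"
proof -
  have K: "group K" and top: "topspace T = carrier K"
    and cm: "continuous_map (prod_topology T T) T (\<lambda>(x, y). x \<otimes>\<^bsub>K\<^esub> y)"
    and cpt: "compact_space T" and haus: "Hausdorff_space T"
    and hom: "\<rho> \<in> hom GG K"
    and dense: "T closure_of (\<rho> ` carrier GG) = carrier K"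
    and sep: "\<And>C\<^sub>1 C\<^sub>2. \<lbrakk>closedin T C\<^sub>1; closedin T C\<^sub>2; C\<^sub>1 \<inter> C\<^sub>2 = {}\<rbrakk> \<Longrightarrow>
        \<exists>C. internal U G C \<and> {g \<in> carrier GG. \<rho> g \<in> C\<^sub>1} \<subseteq> C \<and>
             {g \<in> carrier GG. \<rho> g \<in> C\<^sub>2} \<subseteq> carrier GG - C"
    using comp unfolding internal_compactification_def compact_hausdorff_group_def by auto
  interpret K: group K by (rule K)
  have \<rho>c: "\<rho> g \<in> carrier K" if "g \<in> carrier GG" for g using hom that by (auto simp: hom_def)
  have Wsub: "W \<subseteq> carrier K" using openin_subset[OF W(1)] top by simp
  have "regular_space T" using cpt haus by (rule compact_Hausdorff_imp_regular_space)
  moreover have "closedin T (topspace T - W)" using W(1) by blast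
  ultimately obtain O' V where OV: "openin T O'" "openin T V" "k \<in> O'" "topspace T - W \<subseteq> V" "disjnt O' V"
    using W Wsub top unfolding regular_space_def by (metis Diff_iff subsetD)
  have OV_sub: "O' \<subseteq> topspace T - V" using OV(1,5) openin_subset by (auto simp: disjnt_iff)
  obtain A where A: "internal U G A" "{g \<in> carrier GG. \<rho> g \<in> topspace T - V} \<subseteq> A"
      "{g \<in> carrier GG. \<rho> g \<in> topspace T - W} \<subseteq> carrier GG - A"
    using sep[of "topspace T - V" "topspace T - W"] OV(2,4) W(1) by blast
  have AW: "\<rho> ` A \<subseteq> W"
    using A(3) internal_subset[OF A(1)] \<rho>c by (auto simp: top)
  have right: "continuous_map T T (\<lambda>x. x \<otimes>\<^bsub>K\<^esub> y)" and left: "continuous_map T T (\<lambda>x. y \<otimes>\<^bsub>K\<^esub> x)"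
    if y: "y \<in> carrier K" for y
    using continuous_map_compose[OF _ cm, of T "\<lambda>x. (x, y)"]
      continuous_map_compose[OF _ cm, of T "\<lambda>x. (y, x)"] y
    by (auto simp: continuous_map_paired top o_def continuous_map_const)
  define \<V> where "\<V> g = {y \<in> topspace T. \<rho> g \<otimes>\<^bsub>K\<^esub> y \<in> O'}" for g
  have "topspace T \<subseteq> \<Union>(\<V> ` carrier GG)"
  proof
    fix y assume "y \<in> topspace T"
    then have y: "y \<in> carrier K" using top by simp
    have kc: "k \<in> carrier K" using W(2) Wsub by blast
    \<comment> \<open>The open set \<open>D\<close> contains \<open>k\<close> times the inverse of
      \<open>y\<close>, so the dense image of \<rho> meets it; this puts \<open>y\<close> in some
      \<open>\<V> g\<close>.\<close>
    define D where "D = {x \<in> topspace T. x \<otimes>\<^bsub>K\<^esub> y \<in> O'}"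
    have "openin T D"
      unfolding D_def by (rule openin_continuous_map_preimage[OF right[OF y] OV(1)])
    moreover have "k \<otimes>\<^bsub>K\<^esub> inv\<^bsub>K\<^esub> y \<in> D"
      using y kc OV(3) by (simp add: D_def top K.m_assoc)
    moreover have "k \<otimes>\<^bsub>K\<^esub> inv\<^bsub>K\<^esub> y \<in> T closure_of (\<rho> ` carrier GG)"
      using y kc by (simp add: dense)
    ultimately obtain z where "z \<in> \<rho> ` carrier GG" "z \<in> D"
      unfolding in_closure_of by blast
    then obtain g where "g \<in> carrier GG" "\<rho> g \<otimes>\<^bsub>K\<^esub> y \<in> O'" by (auto simp: D_def)
    then show "y \<in> \<Union>(\<V> ` carrier GG)" using y by (auto simp: \<V>_def top)
  qed
  moreover have "openin T (\<V> g)" if "g \<in> carrier GG" for g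
    unfolding \<V>_def by (rule openin_continuous_map_preimage[OF left[OF \<rho>c[OF that]] OV(1)])
  ultimately obtain \<F> where \<F>: "finite \<F>" "\<F> \<subseteq> \<V> ` carrier GG" "topspace T \<subseteq> \<Union>\<F>"
    using cpt unfolding compact_space_alt
    by (elim allE[of _ "\<V> ` carrier GG"] impE) auto
  obtain F where F: "F \<subseteq> carrier GG" "finite F" "\<F> = \<V> ` F"
    using finite_subset_image[OF \<F>(1,2)] by blast
  have "non_null U G A"
  proof (rule non_null_of_finite_cover[OF A(1) F(2,1)])
    fix h assume h: "h \<in> carrier GG"
    then obtain g where g: "g \<in> F" "\<rho> h \<in> \<V> g" using \<F>(3) \<rho>c F(3) top by blast
    have gc: "g \<in> carrier GG" using g F by blast
    have "\<rho> (g \<otimes>\<^bsub>GG\<^esub> h) \<in> O'" using g(2) hom_mult[OF hom gc h] by (simp add: \<V>_def)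
    then have "g \<otimes>\<^bsub>GG\<^esub> h \<in> A" using A(2) OV_sub gc h by blast
    then show "\<exists>g\<in>F. g \<otimes>\<^bsub>GG\<^esub> h \<in> A" using g by blast
  qed
  with A(1) AW that show ?thesis by blast
qed

lemma compactification_trivial_of_product_free_null:
  fixes K :: "'k monoid"
  assumes a: "\<And>A. \<lbrakk>internal U G A; product_free GG A\<rbrakk> \<Longrightarrow> internal_measure U G A = 0"
    and comp: "internal_compactification U G K T \<rho>"
  shows "carrier K = {\<one>\<^bsub>K\<^esub>}"
proof (rule ccontr)
  assume nontriv: "carrier K \<noteq> {\<one>\<^bsub>K\<^esub>}"
  have K: "group K" and top: "topspace T = carrier K"
    and cm: "continuous_map (prod_topology T T) T (\<lambda>(x, y). x \<otimes>\<^bsub>K\<^esub> y)"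
    and haus: "Hausdorff_space T" and hom: "\<rho> \<in> hom GG K"
    using comp unfolding internal_compactification_def compact_hausdorff_group_def by auto
  interpret K: group K by (rule K)
  obtain k where k: "k \<in> carrier K" "k \<noteq> \<one>\<^bsub>K\<^esub>" using nontriv K.one_closed by blast
  then have "k \<otimes>\<^bsub>K\<^esub> k \<noteq> k" by simp
  then obtain P Q where PQ: "openin T P" "openin T Q" "k \<otimes>\<^bsub>K\<^esub> k \<in> P" "k \<in> Q" "disjnt P Q"
    using haus k unfolding Hausdorff_space_def top by (metis K.m_closed)
  define D where "D = {p \<in> topspace (prod_topology T T). (\<lambda>(x, y). x \<otimes>\<^bsub>K\<^esub> y) p \<in> P}"
  have openD: "openin (prod_topology T T) D"
    unfolding D_def by (rule openin_continuous_map_preimage[OF cm PQ(1)])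
  have kD: "(k, k) \<in> D" using k PQ(3) by (simp add: top D_def)
  obtain R S where RS: "openin T R" "openin T S" "k \<in> R" "k \<in> S" "R \<times> S \<subseteq> D"
    using openD[unfolded openin_prod_topology_alt, rule_format, OF kD] by (elim exE conjE) rule
  \<comment> \<open>Products of two elements of \<open>W\<close> lie in \<open>P\<close>, while
    \<open>W\<close> lies in \<open>Q\<close>, which is disjoint from \<open>P\<close>.\<close>
  define W where "W = R \<inter> S \<inter> Q"
  have "openin T W" "k \<in> W" using RS PQ by (auto simp: W_def)
  then obtain A where A: "internal U G A" "non_null U G A" "\<rho> ` A \<subseteq> W"
    using compactification_neighbourhood_non_null[OF comp] by blast
  have "product_free GG A"
    unfolding product_free_def
  proof (intro notI, elim bexE)
    fix x y z assume xyz: "x \<in> A" "y \<in> A" "z \<in> A" "x \<otimes>\<^bsub>GG\<^esub> y = z"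
    then have "\<rho> z = \<rho> x \<otimes>\<^bsub>K\<^esub> \<rho> y" using hom internal_subset[OF A(1)] by (auto simp: hom_def)
    moreover have "\<rho> x \<in> W" "\<rho> y \<in> W" "\<rho> z \<in> W" using A(3) xyz by auto
    moreover from this have "\<rho> x \<otimes>\<^bsub>K\<^esub> \<rho> y \<in> P" using RS(5) by (auto simp: W_def D_def)
    ultimately show False using PQ(5) by (auto simp: W_def disjnt_iff)
  qed
  then show False using a A by (auto simp: non_null_def)
qed

text \<open>The one-point group, with the empty set as its point, is universal: when every
  compactification is a point, the constant map is the only candidate for \<tau> and it
  works.\<close>

lemma trivial_universal_compactification:
  assumes triv: "\<And>(K :: 'a compactification_point monoid) T \<rho>.
      internal_compactification U G K T \<rho> \<Longrightarrow> carrier K = {\<one>\<^bsub>K\<^esub>}"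
  shows "\<exists>H T \<beta>. universal_internal_compactification U G H T \<beta> \<and> trivial_group H"
proof -
  define H :: "'a compactification_point monoid" where
    "H = \<lparr>carrier = {{}}, monoid.mult = (\<lambda>x y. {}), one = {}\<rparr>"
  define T :: "'a compactification_point topology" where "T = discrete_topology {{}}"
  define \<beta> :: "(nat \<Rightarrow> 'a) set \<Rightarrow> 'a compactification_point" where "\<beta> = (\<lambda>g. {})"
  have H: "group H" by (rule groupI) (auto simp: H_def)
  have cH: "carrier H = {{}}" and oH: "\<one>\<^bsub>H\<^esub> = {}" and mH: "x \<otimes>\<^bsub>H\<^esub> y = {}" for x y
    by (simp_all add: H_def)
  have invH: "inv\<^bsub>H\<^esub> x = {}" if "x = {}" for x
    using group.inv_closed[OF H, of x] that by (simp add: cH)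
  have "compact_hausdorff_group H T"
    unfolding compact_hausdorff_group_def
  proof (intro conjI H)
    show "continuous_map T T (\<lambda>x. inv\<^bsub>H\<^esub> x)" by (simp add: T_def invH)
    have "continuous_map (prod_topology T T) T (\<lambda>p. {})" by (simp add: T_def)
    then show "continuous_map (prod_topology T T) T (\<lambda>(x, y). x \<otimes>\<^bsub>H\<^esub> y)"
      by (simp add: mH case_prod_unfold)
  qed (simp_all add: T_def cH compact_space_discrete_topology Hausdorff_space_discrete_topology)
  moreover have "\<exists>C. internal U G C \<and> {g \<in> carrier GG. \<beta> g \<in> C\<^sub>1} \<subseteq> C \<and>
      {g \<in> carrier GG. \<beta> g \<in> C\<^sub>2} \<subseteq> carrier GG - C" if "C\<^sub>1 \<inter> C\<^sub>2 = {}" for C\<^sub>1 C\<^sub>2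
  proof -
    show ?thesis
    \<comment> \<open>Only one of the disjoint sets can contain the single point, so all of the
      ultraproduct or the empty set separates them.\<close>
    proof (cases "{} \<in> C\<^sub>1")
      case True
      then show ?thesis using that internal_carrier by (intro exI[of _ "carrier GG"]) (auto simp: \<beta>_def)
    next
      case False
      then show ?thesis using internal_empty by (intro exI[of _ "{}"]) (auto simp: \<beta>_def)
    qed
  qed
  moreover have "T closure_of (\<beta> ` carrier GG) = carrier H"
    using GG.one_closed by (auto simp: T_def \<beta>_def cH discrete_topology_closure_of)
  ultimately have comp: "internal_compactification U G H T \<beta>"
    unfolding internal_compactification_def by (auto simp: hom_def \<beta>_def cH mH)
  have "\<exists>!\<tau>. \<tau> \<in> extensional (carrier H) \<and> compactification_map U G H T \<beta> K S \<rho> \<tau>"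
    if K: "internal_compactification U G K S \<rho>" for K :: "'a compactification_point monoid" and S \<rho>
  proof -
    have cK: "carrier K = {\<one>\<^bsub>K\<^esub>}" using triv[OF K] .
    have grpK: "group K" and topK: "topspace S = carrier K" and hom: "\<rho> \<in> hom GG K"
      using K by (auto simp: internal_compactification_def compact_hausdorff_group_def)
    define \<tau> where "\<tau> = restrict (\<lambda>x. \<one>\<^bsub>K\<^esub>) (carrier H)"
    have "\<rho> g = \<one>\<^bsub>K\<^esub>" if "g \<in> carrier GG" for g using hom that cK by (auto simp: hom_def)
    then have "compactification_map U G H T \<beta> K S \<rho> \<tau>"
      unfolding compactification_map_def
      using monoid.l_one[OF group.is_monoid[OF grpK]] monoid.one_closed[OF group.is_monoid[OF grpK]] cK
      by (auto simp: hom_def \<tau>_def cH mH \<beta>_def T_def topK)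
    moreover have "\<tau>' = \<tau>" if "\<tau>' \<in> extensional (carrier H)" "compactification_map U G H T \<beta> K S \<rho> \<tau>'" for \<tau>'
      using that cK unfolding compactification_map_def
      by (intro extensionalityI[of \<tau>' "carrier H"]) (auto simp: \<tau>_def hom_def)
    ultimately show ?thesis by (intro ex1I[of _ \<tau>]) (auto simp: \<tau>_def)
  qed
  then have "universal_internal_compactification U G H T \<beta>"
    unfolding universal_internal_compactification_def using comp by blast
  moreover have "trivial_group H" using H by (simp add: trivial_group_def cH oH)
  ultimately show ?thesis by blast
qed

end

section \<open>Internal quotients\<close>

lemma (in group) rcos_eq_iff:
  assumes N: "subgroup N G" and x: "x \<in> carrier G" and y: "y \<in> carrier G"
  shows "N #> x = N #> y \<longleftrightarrow> x \<otimes> inv y \<in> N"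
proof
  assume "N #> x = N #> y"
  then have "x \<in> N #> y" using rcos_self[OF x N] by simp
  then obtain h where h: "h \<in> N" "x = h \<otimes> y" unfolding r_coset_def by blast
  then show "x \<otimes> inv y \<in> N" using y subgroup.mem_carrier[OF N] by (simp add: m_assoc)
next
  assume "x \<otimes> inv y \<in> N"
  moreover have "x = (x \<otimes> inv y) \<otimes> y" using x y by (simp add: m_assoc)
  ultimately have "x \<in> N #> y" unfolding r_coset_def by blast
  then show "N #> x = N #> y" using repr_independence[OF _ y N] by simp
qed

text \<open>Two products of cosets agree exactly when the commutator of the representatives lies in
  \<open>H\<close>. The condition on elements can be moved between the ultraproduct and its
  factors.\<close>

lemma (in normal) comm_group_Mod_iff:
  "comm_group (G Mod H) \<longleftrightarrow> contains_commutators G H"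
proof -
  have eq: "(H #> x) \<otimes>\<^bsub>G Mod H\<^esub> (H #> y) = (H #> y) \<otimes>\<^bsub>G Mod H\<^esub> (H #> x)
      \<longleftrightarrow> x \<otimes> y \<otimes> inv x \<otimes> inv y \<in> H" if x: "x \<in> carrier G" and y: "y \<in> carrier G" for x y
    using x y rcos_eq_iff[OF subgroup_axioms, of "x \<otimes> y" "y \<otimes> x"]
    by (simp add: FactGroup_def rcos_sum inv_mult_group m_assoc)
  have carr: "carrier (G Mod H) = (\<lambda>x. H #> x) ` carrier G"
    by (auto simp: FactGroup_def RCOSETS_def)
  show ?thesis
    unfolding contains_commutators_def
  proof
    assume "comm_group (G Mod H)"
    then interpret Q: comm_group "G Mod H" .
    show "\<forall>x\<in>carrier G. \<forall>y\<in>carrier G. x \<otimes> y \<otimes> inv x \<otimes> inv y \<in> H"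
      using eq Q.m_comm carr by blast
  next
    assume r: "\<forall>x\<in>carrier G. \<forall>y\<in>carrier G. x \<otimes> y \<otimes> inv x \<otimes> inv y \<in> H"
    show "comm_group (G Mod H)"
      by (rule group.group_comm_groupI[OF factorgroup_is_group]) (use r eq in \<open>auto simp: carr\<close>)
  qed
qed

section \<open>Quasirandom factors and internal quotients\<close>

context finite_group_ultraproduct
begin

text \<open>\<open>Gowers_quasirandom\<close> is applied to the complement of the product set in
  each factor. In the limit the product of the three measures is at most \<open>1 / d\<close> for
  every \<open>d\<close>, so the complement has measure zero.\<close>

lemma measure_one_of_ultra_quasirandom:
  assumes qr: "ultra_quasirandom U G" and A: "internal U G A" "non_null U G A"
    and B: "internal U G B" "non_null U G B"
  shows "internal_measure U G (A <#>\<^bsub>GG\<^esub> B) = 1"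
proof -
  obtain X where X: "\<And>n. X n \<subseteq> carrier (G n)" "A = internal_product U G X"
    using internalE[OF A(1)] by blast
  obtain Y where Y: "\<And>n. Y n \<subseteq> carrier (G n)" "B = internal_product U G Y"
    using internalE[OF B(1)] by blast
  define S where "S n = X n <#>\<^bsub>G n\<^esub> Y n" for n
  have S: "S n \<subseteq> carrier (G n)" for n
    unfolding S_def by (rule monoid.set_mult_closed[OF group.is_monoid[OF grp] X(1) Y(1)])
  have AB: "A <#>\<^bsub>GG\<^esub> B = internal_product U G S"
    unfolding X(2) Y(2) S_def by (rule set_mult_internal_product[OF X(1) Y(1)])
  define \<alpha> \<beta> \<sigma> where "\<alpha> = internal_measure U G A" and "\<beta> = internal_measure U G B"
    and "\<sigma> = internal_measure U G (A <#>\<^bsub>GG\<^esub> B)"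
  have lim: "(density X \<longlongrightarrow> \<alpha>) U" "(density Y \<longlongrightarrow> \<beta>) U" "(density S \<longlongrightarrow> \<sigma>) U"
    unfolding \<alpha>_def \<beta>_def \<sigma>_def AB unfolding X(2) Y(2) by (intro density_tendsto X(1) Y(1) S)+
  have pos: "0 < \<alpha>" "0 < \<beta>"
    using A(2) B(2) internal_measure_nonneg[of X, OF X(1)] internal_measure_nonneg[of Y, OF Y(1)]
    unfolding \<alpha>_def \<beta>_def non_null_def X(2) Y(2) by (simp_all add: less_le)
  have "\<sigma> \<le> 1"
  proof (rule tendsto_upperbound[OF lim(3) _ U_neq_bot])
    have "density S n \<le> 1" for n using card_mono[OF fin S, of n] card_pos[of n] by simp
    then show "eventually (\<lambda>n. density S n \<le> 1) U" by simp
  qed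
  have bound: "real d * \<alpha> * \<beta> * (1 - \<sigma>) \<le> 1" if d: "d \<ge> 1" for d
  proof (rule tendsto_upperbound[OF _ _ U_neq_bot])
    show "((\<lambda>n. real d * density X n * density Y n * (1 - density S n)) \<longlongrightarrow> real d * \<alpha> * \<beta> * (1 - \<sigma>)) U"
      by (intro tendsto_mult tendsto_diff tendsto_const lim)
    have "eventually (\<lambda>n. quasirandom d (G n)) U" using qr d by (simp add: ultra_quasirandom_def)
    then show "eventually (\<lambda>n. real d * density X n * density Y n * (1 - density S n) \<le> 1) U"
    proof eventually_elim
      case (elim n)
      interpret finite_group "G n" using grp fin by (simp add: finite_group_def finite_group_axioms_def)
      let ?N = "real (card (carrier (G n)))"
      have N: "?N > 0" using card_pos[of n] by simp
      have "real d * real (card (X n)) * real (card (Y n)) * real (card (carrier (G n) - S n)) \<le> ?N ^ 3"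
        by (rule Gowers_quasirandom[OF elim X(1) Y(1)]) (auto simp: S_def set_mult_def)
      moreover have "real (card (carrier (G n) - S n)) = ?N - real (card (S n))"
        using finite_subset[OF S fin] card_mono[OF fin S] by (simp add: card_Diff_subset[OF _ S] of_nat_diff)
      ultimately have le: "real d * real (card (X n)) * real (card (Y n)) * (?N - real (card (S n))) \<le> ?N ^ 3"
        by simp
      have "real d * density X n * density Y n * (1 - density S n)
          = real d * real (card (X n)) * real (card (Y n)) * (?N - real (card (S n))) / ?N ^ 3"
        using N by (simp add: field_simps power3_eq_cube)
      also have "\<dots> \<le> 1" using le N by simp
      finally show ?case .
    qed
  qed
  have "\<not> \<sigma> < 1"
  proof
    assume "\<sigma> < 1"
    then have p: "0 < \<alpha> * \<beta> * (1 - \<sigma>)" using pos by simp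
    obtain d :: nat where "1 < real d * (\<alpha> * \<beta> * (1 - \<sigma>))" using reals_Archimedean3[OF p] by blast
    moreover from this have "d \<ge> 1" by (cases d) auto
    ultimately show False using bound[of d] by (simp add: mult.assoc)
  qed
  with \<open>\<sigma> \<le> 1\<close> show ?thesis by (simp add: \<sigma>_def)
qed

lemma internal_normal:
  assumes X: "\<And>n. X n \<lhd> G n"
  shows "internal_product U G X \<lhd> GG"
proof -
  have sub: "subgroup (X n) (G n)" for n using X by (rule normal_imp_subgroup)
  have "subgroup (internal_product U G X) GG"
  proof (rule GG.subgroupI)
    have "\<one>\<^bsub>GG\<^esub> \<in> internal_product U G X"
      unfolding cls_one cls_in_internal[OF one_seqs] by (simp add: subgroup.one_closed[OF sub])
    then show "internal_product U G X \<noteq> {}" by blast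
  next
    fix a assume "a \<in> internal_product U G X"
    then obtain f where f: "f \<in> seqs" "a = cls f" "eventually (\<lambda>n. f n \<in> X n) U"
      by (rule internal_productE)
    show "inv\<^bsub>GG\<^esub> a \<in> internal_product U G X"
      unfolding f(2) cls_inv[OF f(1)] cls_in_internal[OF inv_seqs[OF f(1)]]
      using f(3) by eventually_elim (rule subgroup.m_inv_closed[OF sub])
  next
    fix a b assume a: "a \<in> internal_product U G X" and b: "b \<in> internal_product U G X"
    obtain f where f: "f \<in> seqs" "a = cls f" "eventually (\<lambda>n. f n \<in> X n) U"
      using a by (rule internal_productE)
    obtain g where g: "g \<in> seqs" "b = cls g" "eventually (\<lambda>n. g n \<in> X n) U"
      using b by (rule internal_productE)
    show "a \<otimes>\<^bsub>GG\<^esub> b \<in> internal_product U G X"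
      unfolding f(2) g(2) cls_mult[OF f(1) g(1)] cls_in_internal[OF mult_seqs[OF f(1) g(1)]]
      using f(3) g(3) by eventually_elim (rule subgroup.m_closed[OF sub])
  qed (rule internal_product_subset)
  moreover have "x \<otimes>\<^bsub>GG\<^esub> h \<otimes>\<^bsub>GG\<^esub> inv\<^bsub>GG\<^esub> x \<in> internal_product U G X"
    if x: "x \<in> carrier GG" and h: "h \<in> internal_product U G X" for x h
  proof -
    obtain f where f: "f \<in> seqs" "x = cls f" using x by (rule carrier_GG_E)
    obtain g where g: "g \<in> seqs" "h = cls g" "eventually (\<lambda>n. g n \<in> X n) U"
      using h by (rule internal_productE)
    show ?thesis
      unfolding f(2) g(2) cls_inv[OF f(1)] cls_mult[OF f(1) g(1)]
        cls_mult[OF mult_seqs[OF f(1) g(1)] inv_seqs[OF f(1)]]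
        cls_in_internal[OF mult_seqs[OF mult_seqs[OF f(1) g(1)] inv_seqs[OF f(1)]]]
      using g(3) by (rule eventually_mono) (use f(1) normal.inv_op_closed2[OF X] in simp)
  qed
  ultimately show ?thesis by (simp add: GG.normal_inv_iff)
qed

text \<open>The ultrafilter makes two choices: a single dimension \<open>m\<close> below
  \<open>d\<close> for the offending representations, and then one of the two kinds of quotient. As
  \<open>k\<close> depends on \<open>m\<close> only, bounded index in the factors gives finite index
  in the ultraproduct.\<close>

lemma ultra_quasirandom_of_no_quotient:
  assumes e: "\<not> (\<exists>N. internal U G N \<and> N \<lhd> GG \<and> N \<noteq> carrier GG \<and>
      (finite (carrier (GG Mod N)) \<or> comm_group (GG Mod N)))"
  shows "ultra_quasirandom U G"
  unfolding ultra_quasirandom_def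
proof (intro allI impI, rule ccontr)
  fix d :: nat assume "\<not> eventually (\<lambda>n. quasirandom d (G n)) U"
  then have "eventually (\<lambda>n. \<not> quasirandom d (G n)) U" by (simp add: ev_not)
  then have "eventually (\<lambda>n. \<exists>m\<in>{..<d}. \<exists>\<pi>\<in>hom (G n) (unitary_group m). \<exists>g\<in>carrier (G n). \<pi> g \<noteq> 1\<^sub>m m) U"
    by (rule eventually_mono) (auto simp: quasirandom_def not_le)
  then obtain m where m: "eventually (\<lambda>n. \<exists>\<pi>\<in>hom (G n) (unitary_group m). \<exists>g\<in>carrier (G n). \<pi> g \<noteq> 1\<^sub>m m) U"
    unfolding ev_bex[OF finite_lessThan] by blast
  obtain k where k: "\<And>(H :: 'a monoid) \<pi>. \<lbrakk>group H; finite (carrier H); \<pi> \<in> hom H (unitary_group m);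
      \<exists>g\<in>carrier H. \<pi> g \<noteq> 1\<^sub>m m\<rbrakk> \<Longrightarrow>
    \<exists>N. N \<lhd> H \<and> N \<noteq> carrier H \<and> (contains_commutators H N \<or> covered_by_cosets k H N)"
    using that by (rule unitary_image_proper_normal[where m = m])
  define P where "P n N \<longleftrightarrow> N \<noteq> carrier (G n) \<and>
    (contains_commutators (G n) N \<or> covered_by_cosets k (G n) N)" for n N
  have ev0: "eventually (\<lambda>n. \<exists>N. N \<lhd> G n \<and> P n N) U"
    using m unfolding P_def by (rule eventually_mono) (use k[OF grp fin] in blast)
  \<comment> \<open>The trivial subgroup as default keeps \<open>X n\<close> normal at every
    index.\<close>
  define X where "X n = (if \<exists>N. N \<lhd> G n \<and> P n N then SOME N. N \<lhd> G n \<and> P n N else {\<one>\<^bsub>G n\<^esub>})" for n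
  have XP: "X n \<lhd> G n \<and> P n (X n)" if "\<exists>N. N \<lhd> G n \<and> P n N" for n
    using someI_ex[OF that] that by (simp add: X_def)
  have X: "X n \<lhd> G n" for n
    using XP[of n] group.one_is_normal[OF grp[of n]] by (cases "\<exists>N. N \<lhd> G n \<and> P n N") (auto simp: X_def)
  have evP: "eventually (\<lambda>n. P n (X n)) U"
    using ev0 by (rule eventually_mono) (use XP in blast)
  have Xc: "X n \<subseteq> carrier (G n)" for n
    using normal_imp_subgroup[OF X] by (rule subgroup.subset)
  let ?N = "internal_product U G X"
  have normal: "?N \<lhd> GG" by (rule internal_normal[OF X])
  interpret N: normal ?N GG by (rule normal)
  have ev: "eventually (\<lambda>n. X n \<noteq> carrier (G n)) U"
    "eventually (\<lambda>n. contains_commutators (G n) (X n) \<or> covered_by_cosets k (G n) (X n)) U"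
    using evP by (auto simp: P_def elim: eventually_mono)
  have "eventually (\<lambda>n. \<exists>x\<in>carrier (G n). x \<notin> X n) U"
    using ev(1) by (rule eventually_mono) (use Xc in blast)
  then obtain f where f: "f \<in> seqs" "eventually (\<lambda>n. f n \<notin> X n) U" by (rule seq_of_eventually_ex)
  then have "cls f \<notin> ?N" by (simp add: cls_in_internal ev_not)
  then have proper: "?N \<noteq> carrier GG" using cls_closed[OF f(1)] by blast
  have "comm_group (GG Mod ?N) \<or> finite (carrier (GG Mod ?N))"
    using ev(2) unfolding ev_disj
  proof (elim disj_forward)
    assume comm: "eventually (\<lambda>n. contains_commutators (G n) (X n)) U"
    show "comm_group (GG Mod ?N)"
      unfolding N.comm_group_Mod_iff contains_commutators_def
    proof (intro ballI)
      fix x y assume "x \<in> carrier GG" "y \<in> carrier GG"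
      then obtain f g where f: "f \<in> seqs" "x = cls f" and g: "g \<in> seqs" "y = cls g"
        by (auto simp: carrier_GG)
      note s = mult_seqs[OF f(1) g(1)]
      note s' = mult_seqs[OF s inv_seqs[OF f(1)]]
      show "x \<otimes>\<^bsub>GG\<^esub> y \<otimes>\<^bsub>GG\<^esub> inv\<^bsub>GG\<^esub> x \<otimes>\<^bsub>GG\<^esub> inv\<^bsub>GG\<^esub> y \<in> ?N"
        unfolding f(2) g(2) cls_inv[OF f(1)] cls_inv[OF g(1)] cls_mult[OF f(1) g(1)]
          cls_mult[OF s inv_seqs[OF f(1)]] cls_mult[OF s' inv_seqs[OF g(1)]]
          cls_in_internal[OF mult_seqs[OF s' inv_seqs[OF g(1)]]]
        using comm by (rule eventually_mono) (use f g in \<open>simp add: contains_commutators_def\<close>)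
    qed
  next
    assume cov: "eventually (\<lambda>n. covered_by_cosets k (G n) (X n)) U"
    \<comment> \<open>Representatives are made total in \<open>i\<close> and \<open>n\<close>, with
      the identity as default, so that each \<open>\<lambda>n. t n i\<close> lies in
      \<open>seqs\<close>.\<close>
    have "\<exists>t. (\<forall>i. t i \<in> carrier (G n)) \<and> (covered_by_cosets k (G n) (X n) \<longrightarrow>
        (\<forall>x\<in>carrier (G n). \<exists>i<k. x \<otimes>\<^bsub>G n\<^esub> inv\<^bsub>G n\<^esub> (t i) \<in> X n))" for n
    proof (cases "covered_by_cosets k (G n) (X n)")
      case True
      then obtain t where "\<forall>i<k. t i \<in> carrier (G n)"
          "\<forall>x\<in>carrier (G n). \<exists>i<k. x \<otimes>\<^bsub>G n\<^esub> inv\<^bsub>G n\<^esub> (t i) \<in> X n"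
        unfolding covered_by_cosets_def by blast
      then show ?thesis
        using one_seqs by (intro exI[of _ "\<lambda>i. if i < k then t i else \<one>\<^bsub>G n\<^esub>"]) force
    next
      case False
      then show ?thesis using one_seqs by (intro exI[of _ "\<lambda>i. \<one>\<^bsub>G n\<^esub>"]) simp
    qed
    then obtain t where t: "\<And>n i. t n i \<in> carrier (G n)"
        "\<And>n x. \<lbrakk>covered_by_cosets k (G n) (X n); x \<in> carrier (G n)\<rbrakk>
          \<Longrightarrow> \<exists>i<k. x \<otimes>\<^bsub>G n\<^esub> inv\<^bsub>G n\<^esub> (t n i) \<in> X n"
      by metis
    have "carrier (GG Mod ?N) \<subseteq> (\<lambda>i. ?N #>\<^bsub>GG\<^esub> cls (\<lambda>n. t n i)) ` {..<k}"
    proof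
      fix c assume "c \<in> carrier (GG Mod ?N)"
      then obtain f where f: "f \<in> seqs" "c = ?N #>\<^bsub>GG\<^esub> cls f"
        by (auto simp: FactGroup_def RCOSETS_def carrier_GG)
      have "eventually (\<lambda>n. \<exists>i\<in>{..<k}. f n \<otimes>\<^bsub>G n\<^esub> inv\<^bsub>G n\<^esub> (t n i) \<in> X n) U"
        using cov by (rule eventually_mono) (use t(2) f(1) in fastforce)
      then obtain i where i: "i < k" "eventually (\<lambda>n. f n \<otimes>\<^bsub>G n\<^esub> inv\<^bsub>G n\<^esub> (t n i) \<in> X n) U"
        unfolding ev_bex[OF finite_lessThan] by blast
      have ti: "(\<lambda>n. t n i) \<in> seqs" using t(1) by simp
      have "cls f \<otimes>\<^bsub>GG\<^esub> inv\<^bsub>GG\<^esub> (cls (\<lambda>n. t n i)) \<in> ?N"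
        unfolding cls_inv[OF ti] cls_mult[OF f(1) inv_seqs[OF ti]]
          cls_in_internal[OF mult_seqs[OF f(1) inv_seqs[OF ti]]] by (rule i(2))
      then have "c = ?N #>\<^bsub>GG\<^esub> cls (\<lambda>n. t n i)"
        unfolding f(2) GG.rcos_eq_iff[OF N.subgroup_axioms cls_closed[OF f(1)] cls_closed[OF ti]] .
      then show "c \<in> (\<lambda>i. ?N #>\<^bsub>GG\<^esub> cls (\<lambda>n. t n i)) ` {..<k}" using i(1) by blast
    qed
    then show "finite (carrier (GG Mod ?N))" by (rule finite_subset) simp
  qed
  then show False using e internal_productI[OF Xc] normal proper by blast
qed

text \<open>The map from the universal compactification is onto, so its image of a point is
  everything. \<open>K\<close> may have any type of elements, as the later quotients and circle
  groups require.\<close>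

lemma compactification_trivial_of_universal:
  fixes K :: "'k monoid"
  assumes "universal_internal_compactification U G H T b" "trivial_group H"
    and comp: "internal_compactification U G K S \<rho>"
  shows "carrier K = {\<one>\<^bsub>K\<^esub>}"
proof -
  obtain \<tau> where "compactification_map U G H T b K S \<rho> \<tau>"
    using universal_internal_compactification_any_type[OF assms(1) comp] by blast
  then have "carrier K = {\<tau> \<one>\<^bsub>H\<^esub>}"
    using assms(2) by (auto simp: compactification_map_def trivial_group_def)
  moreover have "\<one>\<^bsub>K\<^esub> \<in> carrier K"
    using comp by (simp add: internal_compactification_def compact_hausdorff_group_def group.is_monoid monoid.one_closed)
  ultimately show ?thesis by simp
qed

section \<open>Finite internal quotients as compactifications\<close>

lemma internal_singleton: "x \<in> carrier GG \<Longrightarrow> internal U G {x}"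
proof (elim carrier_GG_E)
  fix f assume f: "f \<in> seqs" "x = cls f"
  have "internal_product U G (\<lambda>n. {f n}) = {x}"
  proof (intro equalityI subsetI)
    fix y assume "y \<in> internal_product U G (\<lambda>n. {f n})"
    then obtain g where "g \<in> seqs" "y = cls g" "eventually (\<lambda>n. g n \<in> {f n}) U"
      by (rule internal_productE)
    then show "y \<in> {x}" using cls_eq_iff[of g f] f by simp
  qed (use f cls_in_internal[OF f(1)] in simp)
  then show "internal U G {x}" using internal_productI[of "\<lambda>n. {f n}"] f(1) by simp
qed

lemma internal_set_mult: "internal U G A \<Longrightarrow> internal U G B \<Longrightarrow> internal U G (A <#>\<^bsub>GG\<^esub> B)"
proof (elim internalE)
  fix X Y assume X: "\<And>n. X n \<subseteq> carrier (G n)" "A = internal_product U G X"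
    and Y: "\<And>n. Y n \<subseteq> carrier (G n)" "B = internal_product U G Y"
  show "internal U G (A <#>\<^bsub>GG\<^esub> B)"
    unfolding X(2) Y(2) set_mult_internal_product[OF X(1) Y(1)]
    by (intro internal_productI monoid.set_mult_closed[OF group.is_monoid[OF grp]] X(1) Y(1))
qed

lemma internal_Un: "internal U G A \<Longrightarrow> internal U G B \<Longrightarrow> internal U G (A \<union> B)"
proof (elim internalE)
  fix X Y assume X: "\<And>n. X n \<subseteq> carrier (G n)" "A = internal_product U G X"
    and Y: "\<And>n. Y n \<subseteq> carrier (G n)" "B = internal_product U G Y"
  have "x \<in> internal_product U G (\<lambda>n. X n \<union> Y n) \<longleftrightarrow> x \<in> A \<union> B" if "x \<in> carrier GG" for x
    using that by (auto simp: carrier_GG X(2) Y(2) cls_in_internal ev_disj)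
  then have "A \<union> B = internal_product U G (\<lambda>n. X n \<union> Y n)"
    using internal_product_subset unfolding X(2) Y(2) by blast
  then show "internal U G (A \<union> B)" using internal_productI[of "\<lambda>n. X n \<union> Y n"] X(1) Y(1) by simp
qed

lemma internal_Union: "finite \<C> \<Longrightarrow> (\<And>C. C \<in> \<C> \<Longrightarrow> internal U G C) \<Longrightarrow> internal U G (\<Union>\<C>)"
  by (induction rule: finite_induct) (auto intro: internal_empty internal_Un)

text \<open>A coset is the product of the internal set \<open>N\<close> with a singleton, hence
  internal, and so is any finite union of cosets. Such unions separate all disjoint sets in the
  discrete quotient.\<close>

lemma finite_quotient_compactification:
  assumes N: "internal U G N" "N \<lhd> GG" and finQ: "finite (carrier (GG Mod N))"
  shows "internal_compactification U G (GG Mod N) (discrete_topology (carrier (GG Mod N)))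
    (\<lambda>g. N #>\<^bsub>GG\<^esub> g)"
proof -
  interpret N: normal N GG by (rule N(2))
  interpret Q: group "GG Mod N" by (rule N.factorgroup_is_group)
  have carr: "carrier (GG Mod N) = (\<lambda>x. N #>\<^bsub>GG\<^esub> x) ` carrier GG"
    by (auto simp: FactGroup_def RCOSETS_def)
  have coset_internal: "internal U G C" if C: "C \<in> carrier (GG Mod N)" for C
  proof -
    obtain g where g: "g \<in> carrier GG" "C = N #>\<^bsub>GG\<^esub> g"
      using C unfolding carr by (elim imageE)
    then have "C = N <#>\<^bsub>GG\<^esub> {g}" by (auto simp: r_coset_def set_mult_def)
    then show ?thesis using internal_set_mult[OF N(1) internal_singleton[OF g(1)]] by simp
  qed
  have "compact_hausdorff_group (GG Mod N) (discrete_topology (carrier (GG Mod N)))"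
    unfolding compact_hausdorff_group_def
    using Q.group_axioms finQ
    by (auto simp: compact_space_discrete_topology Hausdorff_space_discrete_topology
        prod_topology_discrete_topology[symmetric] intro!: Q.m_closed[simplified])
  moreover have "(\<lambda>g. N #>\<^bsub>GG\<^esub> g) \<in> hom GG (GG Mod N)" by (rule N.r_coset_hom_Mod)
  moreover have "\<exists>C. internal U G C \<and> {g \<in> carrier GG. N #>\<^bsub>GG\<^esub> g \<in> C\<^sub>1} \<subseteq> C \<and>
      {g \<in> carrier GG. N #>\<^bsub>GG\<^esub> g \<in> C\<^sub>2} \<subseteq> carrier GG - C"
    if C: "C\<^sub>1 \<subseteq> carrier (GG Mod N)" "C\<^sub>1 \<inter> C\<^sub>2 = {}" for C\<^sub>1 C\<^sub>2
  proof (intro exI[of _ "\<Union>C\<^sub>1"] conjI)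
    show "internal U G (\<Union>C\<^sub>1)"
      using C(1) coset_internal finite_subset[OF C(1) finQ] by (intro internal_Union) auto
    show "{g \<in> carrier GG. N #>\<^bsub>GG\<^esub> g \<in> C\<^sub>1} \<subseteq> \<Union>C\<^sub>1"
      using GG.rcos_self[OF _ N.subgroup_axioms] by blast
    show "{g \<in> carrier GG. N #>\<^bsub>GG\<^esub> g \<in> C\<^sub>2} \<subseteq> carrier GG - \<Union>C\<^sub>1"
    proof (intro subsetI, elim CollectE conjE)
      fix g assume g: "g \<in> carrier GG" "N #>\<^bsub>GG\<^esub> g \<in> C\<^sub>2"
      have "g \<notin> c" if c: "c \<in> C\<^sub>1" for c
      proof
        assume "g \<in> c"
        obtain h where h: "h \<in> carrier GG" "c = N #>\<^bsub>GG\<^esub> h" using c C(1) carr by blast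
        have "c = N #>\<^bsub>GG\<^esub> g"
          using \<open>g \<in> c\<close> GG.repr_independence[OF _ h(1) N.subgroup_axioms] unfolding h(2) by simp
        then show False using c g(2) C(2) by blast
      qed
      then show "g \<in> carrier GG - \<Union>C\<^sub>1" using g by blast
    qed
  qed
  ultimately show ?thesis
    unfolding internal_compactification_def
    by (auto simp: discrete_topology_closure_of carr)
qed

end

section \<open>Characters\<close>

lemma cis_cong_of_dvd:
  assumes "int r dvd k - l" "0 < r"
  shows "cis (2 * pi * of_int k / real r) = cis (2 * pi * of_int l / real r)"
proof -
  obtain j where j: "k - l = int r * j" using assms(1) by (elim dvdE)
  then have "k = l + int r * j" by simp
  then have "2 * pi * of_int k / real r = 2 * pi * of_int l / real r + 2 * pi * of_int j"
    using assms(2) by (simp add: field_simps)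
  then have "cis (2 * pi * of_int k / real r) = cis (2 * pi * of_int l / real r) * cis (2 * pi * of_int j)"
    by (simp only: cis_mult)
  then show ?thesis by simp
qed

lemma cis_neq_1:
  assumes "1 < r" shows "cis (2 * pi / real r) \<noteq> 1"
proof
  assume "cis (2 * pi / real r) = 1"
  then have "cos (2 * pi / real r) = 1" by (simp add: complex_eq_iff)
  then obtain j :: int where "2 * pi / real r = of_int j * 2 * pi" unfolding cos_one_2pi_int by blast
  then have "2 * pi / real r / (2 * pi) = of_int j" by (simp only:) simp
  then have "1 / real r = of_int j" by simp
  moreover have "0 < 1 / real r" "1 / real r < 1" using assms by simp_all
  ultimately show False by simp
qed

text \<open>A maximal proper subgroup \<open>M\<close> above \<open>N\<close> is normal because it
  contains all commutators. Any \<open>x\<close> outside \<open>M\<close> generates the group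
  together with \<open>M\<close>, so the quotient is cyclic, and \<psi> sends the coset of
  \<open>x [^] k\<close> to the corresponding root of unity.\<close>

lemma (in group) nontrivial_character:
  assumes fin: "finite (carrier G)" and N: "subgroup N G" "N \<noteq> carrier G" "contains_commutators G N"
  obtains \<psi> :: "'a \<Rightarrow> complex" where "\<And>x. x \<in> carrier G \<Longrightarrow> cmod (\<psi> x) = 1"
    "\<And>x y. x \<in> carrier G \<Longrightarrow> y \<in> carrier G \<Longrightarrow> \<psi> (x \<otimes> y) = \<psi> x * \<psi> y"
    "\<exists>x\<in>carrier G. \<psi> x \<noteq> 1"
proof -
  define \<M> where "\<M> = {M. subgroup M G \<and> N \<subseteq> M \<and> M \<noteq> carrier G}"
  have "finite \<M>" by (rule finite_subset[of _ "Pow (carrier G)"]) (auto simp: \<M>_def fin dest: subgroup.subset)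
  moreover have "N \<in> \<M>" using N by (auto simp: \<M>_def)
  ultimately obtain M where M: "M \<in> \<M>" and max: "\<And>L. L \<in> \<M> \<Longrightarrow> M \<subseteq> L \<Longrightarrow> M = L"
    using finite_has_maximal[of \<M>] by blast
  have Ms: "subgroup M G" "N \<subseteq> M" "M \<noteq> carrier G" using M by (auto simp: \<M>_def)
  interpret M: subgroup M G by (rule Ms(1))
  have Mn: "M \<lhd> G"
    unfolding normal_inv_iff
  proof (intro conjI ballI Ms(1))
    fix x h assume x: "x \<in> carrier G" and h: "h \<in> M"
    then have "commutator x h \<in> M" using N(3) Ms(2) M.mem_carrier unfolding contains_commutators_def by blast
    then have "commutator x h \<otimes> h \<in> M" using h by (rule M.m_closed)
    moreover have "commutator x h \<otimes> h = x \<otimes> h \<otimes> inv x" using x h by (simp add: m_assoc)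
    ultimately show "x \<otimes> h \<otimes> inv x \<in> M" by simp
  qed
  obtain x where x: "x \<in> carrier G" "x \<notin> M" using Ms(3) M.subset by blast
  let ?L = "M <#> generate G {x}"
  have sub: "subgroup ?L G" using x by (intro mult_norm_subgroup Mn generate_is_subgroup) simp
  have mem: "m \<otimes> y \<in> ?L" if "m \<in> M" "y \<in> generate G {x}" for m y
    using that unfolding set_mult_def by blast
  have M_le: "M \<subseteq> ?L"
  proof
    fix m assume "m \<in> M"
    then show "m \<in> ?L" using mem[OF _ generate.one, of m] by simp
  qed
  have "x \<in> ?L" using mem[OF M.one_closed generate.incl, of x] x by simp
  have L: "?L = carrier G"
  proof (rule ccontr)
    assume "?L \<noteq> carrier G"
    then have "?L \<in> \<M>" using sub M_le Ms(2) unfolding \<M>_def by blast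
    then have "M = ?L" using max M_le by blast
    then show False using \<open>x \<in> ?L\<close> x(2) by simp
  qed
  have exk: "\<exists>k::int. y \<otimes> inv (x [^] k) \<in> M" if "y \<in> carrier G" for y
  proof -
    have "y \<in> M <#> {x [^] (k::int) |k. k \<in> UNIV}" using that L generate_pow[OF x(1)] by simp
    then obtain m and k :: int where "m \<in> M" "y = m \<otimes> x [^] k" unfolding set_mult_def by blast
    then show ?thesis using x(1) by (intro exI[of _ k]) (simp add: m_assoc)
  qed
  \<comment> \<open>The order of \<open>x\<close> modulo \<open>M\<close>; the order of the whole
    group is a positive exponent that qualifies.\<close>
  define r where "r = (LEAST n. 0 < n \<and> x [^] int n \<in> M)"
  have ex: "\<exists>n. 0 < n \<and> x [^] int n \<in> M"
  proof (intro exI[of _ "card (carrier G)"] conjI)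
    show "0 < card (carrier G)" using fin one_closed card_gt_0_iff by blast
    show "x [^] int (card (carrier G)) \<in> M"
      unfolding int_pow_int pow_order_eq_1[OF x(1), unfolded Coset.order_def] by (rule M.one_closed)
  qed
  have r: "0 < r" "x [^] int r \<in> M" using LeastI_ex[OF ex] unfolding r_def by simp_all
  have least: "r \<le> n" if "0 < n" "x [^] int n \<in> M" for n
    unfolding r_def using that by (intro Least_le) simp
  have "r \<noteq> 1" using r(2) x int_pow_1[OF x(1)] by auto
  then have r1: "1 < r" using r(1) by simp
  have dvd: "int r dvd k" if k: "x [^] k \<in> M" for k :: int
  proof (rule ccontr)
    assume "\<not> int r dvd k"
    then have pos: "0 < k mod int r" 
      using pos_mod_sign[of "int r" k] mod_eq_0_iff_dvd[of k "int r"] r(1) by linarith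
    have "x [^] (k mod int r) = x [^] k \<otimes> inv ((x [^] int r) [^] (k div int r))"
      using x(1) by (simp add: int_pow_pow minus_mult_div_eq_mod flip: int_pow_diff)
    also have "\<dots> \<in> M"
      using k subgroup_int_pow_closed[OF Ms(1) r(2)] by (intro M.m_closed M.m_inv_closed)
    finally have "r \<le> nat (k mod int r)" using pos by (intro least) auto
    then show False using r(1) pos by (smt (verit) nat_le_eq_zle pos_mod_bound int_nat_eq of_nat_0_less_iff zle_int)
  qed
  \<comment> \<open>The exponent is determined only modulo \<open>r\<close>, which is all that
    \<psi> sees.\<close>
  define \<phi> where "\<phi> y = (SOME k::int. y \<otimes> inv (x [^] k) \<in> M)" for y
  define \<psi> where "\<psi> y = cis (2 * pi * of_int (\<phi> y) / real r)" for y
  have \<phi>: "y \<otimes> inv (x [^] \<phi> y) \<in> M" if "y \<in> carrier G" for y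
    using someI_ex[OF exk[OF that]] by (simp add: \<phi>_def)
  have \<psi>_eq: "\<psi> y = cis (2 * pi * of_int k / real r)" if y: "y \<in> carrier G" and k: "y \<otimes> inv (x [^] k) \<in> M" for y and k :: int
  proof -
    have "inv (y \<otimes> inv (x [^] \<phi> y)) \<otimes> (y \<otimes> inv (x [^] k)) \<in> M"
      using \<phi>[OF y] k by simp
    also have "inv (y \<otimes> inv (x [^] \<phi> y)) \<otimes> (y \<otimes> inv (x [^] k)) = x [^] (\<phi> y - k)"
      using y x(1) by (simp add: inv_mult_group m_assoc inv_mult_cancel int_pow_diff)
    finally show ?thesis unfolding \<psi>_def using dvd r(1) by (intro cis_cong_of_dvd)
  qed
  show ?thesis
  proof (rule that[of \<psi>])
    show "cmod (\<psi> y) = 1" for y by (simp add: \<psi>_def)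
    show "\<exists>y\<in>carrier G. \<psi> y \<noteq> 1"
      using \<psi>_eq[OF x(1), of 1] x(1) r1 cis_neq_1[of r] by (intro bexI[of _ x]) (auto simp: M.one_closed)
    show "\<psi> (y \<otimes> z) = \<psi> y * \<psi> z" if y: "y \<in> carrier G" and z: "z \<in> carrier G" for y z
    proof -
      let ?a = "x [^] \<phi> y" and ?b = "x [^] \<phi> z"
      have ab: "?a \<in> carrier G" "?b \<in> carrier G" using x(1) by simp_all
      \<comment> \<open>Conjugating the second factor by \<open>?a\<close>, which stays within the
        normal subgroup \<open>M\<close>, lets the two exponents be collected on the right.\<close>
      have "(y \<otimes> inv ?a) \<otimes> (?a \<otimes> (z \<otimes> inv ?b) \<otimes> inv ?a) \<in> M"
        using \<phi>[OF y] normal.inv_op_closed2[OF Mn ab(1) \<phi>[OF z]] by (rule M.m_closed)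
      also have "(y \<otimes> inv ?a) \<otimes> (?a \<otimes> (z \<otimes> inv ?b) \<otimes> inv ?a) = (y \<otimes> z) \<otimes> inv (x [^] (\<phi> y + \<phi> z))"
        using ab y z x(1) by (simp add: int_pow_mult inv_mult_group m_assoc inv_mult_cancel)
      finally have "\<psi> (y \<otimes> z) = cis (2 * pi * of_int (\<phi> y + \<phi> z) / real r)"
        using y z by (intro \<psi>_eq) auto
      also have "\<dots> = \<psi> y * \<psi> z" by (simp add: \<psi>_def cis_mult distrib_left add_divide_distrib)
      finally show ?thesis .
    qed
  qed
qed

text \<open>A maximiser \<open>y\<close> of \<open>\<bar>\<psi> y - 1\<bar>\<close> satisfies
  \<open>\<bar>\<psi> y - 1\<bar> \<bar>\<psi> y + 1\<bar> = \<bar>\<psi> (y y) - 1\<bar> \<le> \<bar>\<psi> y - 1\<bar>\<close>.\<close>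

lemma (in group) character_far_from_one:
  fixes \<psi> :: "'a \<Rightarrow> complex"
  assumes fin: "finite (carrier G)"
    and mult: "\<And>x y. x \<in> carrier G \<Longrightarrow> y \<in> carrier G \<Longrightarrow> \<psi> (x \<otimes> y) = \<psi> x * \<psi> y"
    and nontriv: "\<exists>x\<in>carrier G. \<psi> x \<noteq> 1"
  shows "\<exists>x\<in>carrier G. 1 \<le> cmod (\<psi> x - 1)"
proof -
  let ?D = "(\<lambda>x. cmod (\<psi> x - 1)) ` carrier G"
  have D: "finite ?D" "?D \<noteq> {}" using fin one_closed by auto
  obtain y where y: "y \<in> carrier G" "cmod (\<psi> y - 1) = Max ?D" using Max_in[OF D] by auto
  have max: "cmod (\<psi> x - 1) \<le> cmod (\<psi> y - 1)" if "x \<in> carrier G" for x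
    unfolding y(2) using that D by (intro Max_ge) auto
  have pos: "0 < cmod (\<psi> y - 1)" using nontriv max by (metis order_less_le_trans right_minus_eq zero_less_norm_iff)
  have "cmod (\<psi> y - 1) * cmod (\<psi> y + 1) = cmod (\<psi> (y \<otimes> y) - 1)"
    using mult[OF y(1) y(1)] by (simp add: algebra_simps flip: norm_mult)
  also have "\<dots> \<le> cmod (\<psi> y - 1) * 1" using max y(1) by simp
  finally have "cmod (\<psi> y + 1) \<le> 1" using pos by simp
  moreover have "2 \<le> cmod (\<psi> y + 1) + cmod (\<psi> y - 1)"
    using norm_triangle_ineq4[of "\<psi> y + 1" "\<psi> y - 1"] by simp
  ultimately show ?thesis using y(1) by force
qed

section \<open>Ultralimits and closed subgroups of the circle\<close>

lemma ultrafilter_limit_compact: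
  fixes f :: "nat \<Rightarrow> 'b :: topological_space"
  assumes U: "nonprincipal_ultrafilter U" and S: "compact S" and f: "\<And>n. f n \<in> S"
  shows "\<exists>l\<in>S. (f \<longlongrightarrow> l) U"
proof -
  have "filtermap f U \<noteq> bot" using U by (simp add: filtermap_bot_iff nonprincipal_ultrafilter_def)
  moreover have "eventually (\<lambda>x. x \<in> S) (filtermap f U)" using f by (simp add: eventually_filtermap)
  ultimately obtain l where l: "l \<in> S" "inf (nhds l) (filtermap f U) \<noteq> bot"
    using S unfolding compact_filter by blast
  have "(f \<longlongrightarrow> l) U"
    unfolding filterlim_def
  proof (rule filter_leI)
    fix P assume P: "eventually P (nhds l)"
    show "eventually P (filtermap f U)"
    proof (rule ccontr)
      assume "\<not> eventually P (filtermap f U)"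
      then have "eventually (\<lambda>x. \<not> P x) (filtermap f U)"
        by (simp add: eventually_filtermap eventually_not_ultrafilter[OF U])
      with P have "eventually (\<lambda>x. False) (inf (nhds l) (filtermap f U))"
        unfolding eventually_inf by blast
      then show False using l(2) by (simp add: trivial_limit_def)
    qed
  qed
  with l(1) show ?thesis by blast
qed

lemma closure_mult_closed:
  fixes S :: "complex set"
  assumes S: "\<And>x y. x \<in> S \<Longrightarrow> y \<in> S \<Longrightarrow> x * y \<in> S" and x: "x \<in> closure S" and y: "y \<in> closure S"
  shows "x * y \<in> closure S"
proof -
  obtain f g where "\<And>n. f n \<in> S" "f \<longlonglongrightarrow> x" "\<And>n. g n \<in> S" "g \<longlonglongrightarrow> y"
    using x y unfolding closure_sequential by blast
  then have "\<And>n. f n * g n \<in> S" "(\<lambda>n. f n * g n) \<longlonglongrightarrow> x * y" using S by (auto intro: tendsto_mult)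
  then show ?thesis unfolding closure_sequential by (intro exI[of _ "\<lambda>n. f n * g n"]) simp
qed

lemma closure_cnj_closed:
  assumes S: "\<And>x. x \<in> S \<Longrightarrow> cnj x \<in> S" and x: "x \<in> closure S"
  shows "cnj x \<in> closure S"
proof -
  obtain f where "\<And>n. f n \<in> S" "f \<longlonglongrightarrow> x" using x unfolding closure_sequential by blast
  then have "\<And>n. cnj (f n) \<in> S" "(\<lambda>n. cnj (f n)) \<longlonglongrightarrow> cnj x" using S by (auto intro: tendsto_cnj)
  then show ?thesis unfolding closure_sequential by (intro exI[of _ "\<lambda>n. cnj (f n)"]) simp
qed

definition circle_subgroup :: "complex set \<Rightarrow> complex monoid" where
  "circle_subgroup S = \<lparr>carrier = S, monoid.mult = (*), one = 1\<rparr>"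

text \<open>On the unit circle inversion is complex conjugation, which is continuous.\<close>

lemma compact_hausdorff_circle_subgroup:
  assumes S: "closed S" "1 \<in> S" "\<And>x. x \<in> S \<Longrightarrow> cmod x = 1"
    "\<And>x y. x \<in> S \<Longrightarrow> y \<in> S \<Longrightarrow> x * y \<in> S" "\<And>x. x \<in> S \<Longrightarrow> cnj x \<in> S"
  shows "compact_hausdorff_group (circle_subgroup S) (top_of_set S)"
proof -
  have cnj: "cnj x * x = 1" if "x \<in> S" for x
    using S(3)[OF that] by (simp add: mult.commute complex_norm_square[symmetric])
  have grp: "group (circle_subgroup S)"
  proof (rule groupI)
    show "\<exists>y\<in>carrier (circle_subgroup S). y \<otimes>\<^bsub>circle_subgroup S\<^esub> x = \<one>\<^bsub>circle_subgroup S\<^esub>"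
      if "x \<in> carrier (circle_subgroup S)" for x
      using that S(5) cnj by (intro bexI[of _ "cnj x"]) (auto simp: circle_subgroup_def)
  qed (use S in \<open>auto simp: circle_subgroup_def mult.assoc\<close>)
  have inv: "inv\<^bsub>circle_subgroup S\<^esub> x = cnj x" if "x \<in> S" for x
    using that S(5) cnj by (intro group.inv_equality[OF grp]) (auto simp: circle_subgroup_def)
  have "continuous_map (top_of_set S) (top_of_set S) cnj"
    using S(5) by (auto simp: continuous_map_in_subtopology intro!: continuous_intros)
  then have "continuous_map (top_of_set S) (top_of_set S) (\<lambda>x. inv\<^bsub>circle_subgroup S\<^esub> x)"
    by (rule continuous_map_eq) (simp add: inv)
  moreover have "continuous_map (prod_topology (top_of_set S) (top_of_set S)) (top_of_set S) (\<lambda>(x, y). x * y)"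
    using S(4) by (auto simp: continuous_map_in_subtopology case_prod_unfold intro!: continuous_intros)
  moreover have "bounded S" using S(3) by (auto simp: bounded_iff)
  then have "compact S" using S(1) by (simp add: compact_eq_bounded_closed)
  ultimately show ?thesis
    unfolding compact_hausdorff_group_def using grp
    by (auto simp: circle_subgroup_def compact_space_subtopology Hausdorff_space_subtopology)
qed

section \<open>Compactifications from characters\<close>

context finite_group_ultraproduct
begin

text \<open>The ultralimit \<rho> of the \<psi> n maps into the unit circle, and the closure of its
  image is the compactification. The lower bound 1 in \<open>nontriv\<close> passes to the limit,
  which keeps \<rho> non-trivial.\<close>

lemma character_compactification:
  fixes \<psi> :: "nat \<Rightarrow> 'a \<Rightarrow> complex"
  assumes norm: "\<And>n x. x \<in> carrier (G n) \<Longrightarrow> cmod (\<psi> n x) = 1"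
    and mult: "\<And>n x y. x \<in> carrier (G n) \<Longrightarrow> y \<in> carrier (G n) \<Longrightarrow> \<psi> n (x \<otimes>\<^bsub>G n\<^esub> y) = \<psi> n x * \<psi> n y"
    and nontriv: "eventually (\<lambda>n. \<exists>x\<in>carrier (G n). 1 \<le> cmod (\<psi> n x - 1)) U"
  obtains K :: "complex monoid" and T \<rho> where "internal_compactification U G K T \<rho>" "carrier K \<noteq> {\<one>\<^bsub>K\<^esub>}"
proof -
  \<comment> \<open>Limits are taken along a chosen representative; \<open>lim\<close> then shows
    that every representative has the same limit.\<close>
  define rep where "rep x = (SOME f. f \<in> seqs \<and> x = cls f)" for x
  have rep: "rep x \<in> seqs" "x = cls (rep x)" if "x \<in> carrier GG" for x
    using someI_ex[of "\<lambda>f. f \<in> seqs \<and> x = cls f"] that unfolding rep_def carrier_GG by blast+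
  define \<rho> where "\<rho> x = (SOME l. ((\<lambda>n. \<psi> n (rep x n)) \<longlongrightarrow> l) U)" for x
  have lim: "((\<lambda>n. \<psi> n (f n)) \<longlongrightarrow> \<rho> (cls f)) U" if f: "f \<in> seqs" for f
  proof -
    let ?g = "rep (cls f)"
    have g: "?g \<in> seqs" "cls f = cls ?g" using rep[OF cls_closed[OF f]] by auto
    have "\<exists>l\<in>sphere 0 1. ((\<lambda>n. \<psi> n (?g n)) \<longlongrightarrow> l) U"
      using g(1) norm by (intro ultrafilter_limit_compact[OF U]) auto
    then have l: "((\<lambda>n. \<psi> n (?g n)) \<longlongrightarrow> \<rho> (cls f)) U"
      unfolding \<rho>_def by (metis someI_ex)
    have "eventually (\<lambda>n. ?g n = f n) U" using g(2) cls_eq_iff[OF g(1) f] by simp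
    then have "eventually (\<lambda>n. \<psi> n (?g n) = \<psi> n (f n)) U" by (rule eventually_mono) simp
    with l show ?thesis by (rule Lim_transform_eventually)
  qed
  have \<rho>_eq: "\<rho> (cls f) = l" if "f \<in> seqs" "((\<lambda>n. \<psi> n (f n)) \<longlongrightarrow> l) U" for f l
    using tendsto_unique[OF U_neq_bot lim[OF that(1)] that(2)] .
  have \<rho>_mult: "\<rho> (x \<otimes>\<^bsub>GG\<^esub> y) = \<rho> x * \<rho> y" if "x \<in> carrier GG" "y \<in> carrier GG" for x y
  proof -
    obtain f where f: "f \<in> seqs" "x = cls f" using \<open>x \<in> carrier GG\<close> by (rule carrier_GG_E)
    obtain g where g: "g \<in> seqs" "y = cls g" using \<open>y \<in> carrier GG\<close> by (rule carrier_GG_E)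
    have "((\<lambda>n. \<psi> n (f n) * \<psi> n (g n)) \<longlongrightarrow> \<rho> x * \<rho> y) U"
      unfolding f(2) g(2) by (intro tendsto_mult lim f g)
    then have "((\<lambda>n. \<psi> n (f n \<otimes>\<^bsub>G n\<^esub> g n)) \<longlongrightarrow> \<rho> x * \<rho> y) U"
      using f(1) g(1) by (simp add: mult)
    then show ?thesis
      unfolding f(2) g(2) cls_mult[OF f(1) g(1)] by (rule \<rho>_eq[OF mult_seqs[OF f(1) g(1)]])
  qed
  have \<rho>_norm: "cmod (\<rho> x) = 1" if x: "x \<in> carrier GG" for x
  proof -
    obtain f where f: "f \<in> seqs" "x = cls f" using x by (rule carrier_GG_E)
    have "((\<lambda>n. cmod (\<psi> n (f n))) \<longlongrightarrow> cmod (\<rho> x)) U" unfolding f(2) by (intro tendsto_norm lim f)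
    moreover have "((\<lambda>n. cmod (\<psi> n (f n))) \<longlongrightarrow> 1) U" using f(1) norm by simp
    ultimately show ?thesis using tendsto_unique[OF U_neq_bot] by blast
  qed
  have \<rho>_one: "\<rho> \<one>\<^bsub>GG\<^esub> = 1"
    using \<rho>_mult[OF GG.one_closed GG.one_closed] \<rho>_norm[OF GG.one_closed] by auto
  have \<rho>_inv: "\<rho> (inv\<^bsub>GG\<^esub> x) = cnj (\<rho> x)" if x: "x \<in> carrier GG" for x
  proof -
    have "\<rho> (inv\<^bsub>GG\<^esub> x) * \<rho> x = 1" using \<rho>_mult[of "inv\<^bsub>GG\<^esub> x" x] x \<rho>_one by simp
    moreover have "\<rho> x * cnj (\<rho> x) = 1"
      using \<rho>_norm[OF x] complex_norm_square[of "\<rho> x"] by simp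
    ultimately show ?thesis by (metis mult.assoc mult.commute mult_1)
  qed
  define R where "R = \<rho> ` carrier GG"
  have R_mult: "x * y \<in> R" if "x \<in> R" "y \<in> R" for x y
    using that \<rho>_mult[symmetric] by (auto simp: R_def)
  have R_cnj: "cnj x \<in> R" if "x \<in> R" for x
    using that \<rho>_inv[symmetric] by (auto simp: R_def)
  have "R \<subseteq> sphere 0 1" using \<rho>_norm by (auto simp: R_def)
  then have sph: "closure R \<subseteq> sphere 0 1" by (rule closure_minimal) simp
  let ?T = "top_of_set (closure R)"
  have chg: "compact_hausdorff_group (circle_subgroup (closure R)) ?T"
  proof (rule compact_hausdorff_circle_subgroup)
    show "1 \<in> closure R" using \<rho>_one GG.one_closed closure_subset by (force simp: R_def)
    show "cmod x = 1" if "x \<in> closure R" for x using that sph by auto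
    show "x * y \<in> closure R" if "x \<in> closure R" "y \<in> closure R" for x y
      using R_mult that by (rule closure_mult_closed)
    show "cnj x \<in> closure R" if "x \<in> closure R" for x
      using R_cnj that by (rule closure_cnj_closed)
  qed simp
  have cK: "carrier (circle_subgroup (closure R)) = closure R" by (simp add: circle_subgroup_def)
  have "internal_compactification U G (circle_subgroup (closure R)) ?T \<rho>"
    unfolding internal_compactification_def
  proof (intro conjI chg allI impI)
    show "\<rho> \<in> hom GG (circle_subgroup (closure R))"
      using closure_subset[of R] \<rho>_mult by (auto simp: hom_def circle_subgroup_def R_def)
    show "?T closure_of (\<rho> ` carrier GG) = carrier (circle_subgroup (closure R))"
      unfolding cK closure_of_subtopology R_def[symmetric]
      using closure_subset[of R] by (simp add: Int_absorb1)
  next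
    fix C\<^sub>1 C\<^sub>2 assume C: "closedin ?T C\<^sub>1 \<and> closedin ?T C\<^sub>2 \<and> C\<^sub>1 \<inter> C\<^sub>2 = {}"
    have "bounded (closure R)" using sph by (rule bounded_subset[rotated]) simp
    then have "compact (closure R)" by (simp add: compact_eq_bounded_closed)
    then have "compact C\<^sub>1" "closed C\<^sub>2"
      using C by (auto simp: closedin_closed_eq compact_eq_bounded_closed intro: bounded_subset)
    then obtain d where d: "0 < d" "\<And>x y. x \<in> C\<^sub>1 \<Longrightarrow> y \<in> C\<^sub>2 \<Longrightarrow> d \<le> dist x y"
      using separate_compact_closed[of C\<^sub>1 C\<^sub>2] C by blast
    \<comment> \<open>Half of the gap \<open>d\<close>: a limit in the first closed set puts almost
      all values within \<open>d / 2\<close> of it, while a value that near to both sets would bring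
      them closer than \<open>d\<close>.\<close>
    define X where "X n = {x \<in> carrier (G n). \<exists>c\<in>C\<^sub>1. dist (\<psi> n x) c < d / 2}" for n
    have near: "eventually (\<lambda>n. dist (\<psi> n (f n)) (\<rho> (cls f)) < d / 2) U" if "f \<in> seqs" for f
      using tendstoD[OF lim[OF that], of "d / 2"] d(1) by simp
    show "\<exists>C. internal U G C \<and> {g \<in> carrier GG. \<rho> g \<in> C\<^sub>1} \<subseteq> C \<and> {g \<in> carrier GG. \<rho> g \<in> C\<^sub>2} \<subseteq> carrier GG - C"
    proof (intro exI[of _ "internal_product U G X"] conjI subsetI)
      show "internal U G (internal_product U G X)" by (rule internal_productI) (auto simp: X_def)
      show "g \<in> internal_product U G X" if g: "g \<in> {g \<in> carrier GG. \<rho> g \<in> C\<^sub>1}" for g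
      proof -
        obtain f where f: "f \<in> seqs" "g = cls f" using g by (auto elim: carrier_GG_E)
        show ?thesis
          unfolding f(2) cls_in_internal[OF f(1)]
          using near[OF f(1)] by (rule eventually_mono) (use f g in \<open>auto simp: X_def\<close>)
      qed
      show "g \<in> carrier GG - internal_product U G X" if g: "g \<in> {g \<in> carrier GG. \<rho> g \<in> C\<^sub>2}" for g
      proof -
        obtain f where f: "f \<in> seqs" "g = cls f" using g by (auto elim: carrier_GG_E)
        have "eventually (\<lambda>n. f n \<notin> X n) U"
          using near[OF f(1)]
        proof (rule eventually_mono)
          fix n assume near: "dist (\<psi> n (f n)) (\<rho> (cls f)) < d / 2"
          show "f n \<notin> X n"
          proof
            assume "f n \<in> X n"
            then obtain c where c: "c \<in> C\<^sub>1" "dist (\<psi> n (f n)) c < d / 2" by (auto simp: X_def)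
            have "dist c (\<rho> (cls f)) < d" using c(2) near dist_triangle[of c "\<rho> (cls f)" "\<psi> n (f n)"]
              by (simp add: dist_commute)
            then show False using d(2)[OF c(1), of "\<rho> (cls f)"] g f(2) by simp
          qed
        qed
        then show ?thesis using g f cls_in_internal[OF f(1)] by (simp add: ev_not)
      qed
    qed
  qed
  moreover have "carrier (circle_subgroup (closure R)) \<noteq> {\<one>\<^bsub>circle_subgroup (closure R)\<^esub>}"
  proof -
    obtain f where f: "f \<in> seqs" "eventually (\<lambda>n. 1 \<le> cmod (\<psi> n (f n) - 1)) U"
      using nontriv by (rule seq_of_eventually_ex)
    have "((\<lambda>n. cmod (\<psi> n (f n) - 1)) \<longlongrightarrow> cmod (\<rho> (cls f) - 1)) U"
      by (intro tendsto_norm tendsto_diff tendsto_const lim f)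
    then have "1 \<le> cmod (\<rho> (cls f) - 1)" using f(2) U_neq_bot by (rule tendsto_lowerbound)
    then have "\<rho> (cls f) \<noteq> 1" by auto
    moreover have "\<rho> (cls f) \<in> closure R"
      using cls_closed[OF f(1)] closure_subset[of R] by (auto simp: R_def)
    ultimately show ?thesis by (auto simp: circle_subgroup_def)
  qed
  ultimately show ?thesis by (rule that)
qed

text \<open>Being a subgroup amounts to containing the identity and all quotients of two elements,
  and \<open>los_all2\<close> takes the latter condition down to the factors.\<close>

lemma eventually_subgroup_of_internal:
  assumes N: "subgroup (internal_product U G X) GG" and X: "\<And>n. X n \<subseteq> carrier (G n)"
  shows "eventually (\<lambda>n. subgroup (X n) (G n)) U"
proof -
  have "eventually (\<lambda>n. \<forall>x\<in>carrier (G n). \<forall>y\<in>carrier (G n).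
      x \<in> X n \<and> y \<in> X n \<longrightarrow> x \<otimes>\<^bsub>G n\<^esub> inv\<^bsub>G n\<^esub> y \<in> X n) U"
  proof (rule los_all2)
    fix f g assume f: "f \<in> seqs" and g: "g \<in> seqs"
    show "eventually (\<lambda>n. f n \<in> X n \<and> g n \<in> X n \<longrightarrow> f n \<otimes>\<^bsub>G n\<^esub> inv\<^bsub>G n\<^esub> (g n) \<in> X n) U"
    \<comment> \<open>If the premise does not hold almost everywhere, it fails almost everywhere and
      the implication is vacuous.\<close>
    proof (cases "eventually (\<lambda>n. f n \<in> X n \<and> g n \<in> X n) U")
      case True
      then have "cls f \<in> internal_product U G X" "cls g \<in> internal_product U G X"
        using f g by (simp_all add: cls_in_internal eventually_conj_iff)
      then have "cls f \<otimes>\<^bsub>GG\<^esub> inv\<^bsub>GG\<^esub> (cls g) \<in> internal_product U G X"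
        by (intro subgroup.m_closed[OF N] subgroup.m_inv_closed[OF N])
      then have "eventually (\<lambda>n. f n \<otimes>\<^bsub>G n\<^esub> inv\<^bsub>G n\<^esub> (g n) \<in> X n) U"
        unfolding cls_inv[OF g] cls_mult[OF f inv_seqs[OF g]] cls_in_internal[OF mult_seqs[OF f inv_seqs[OF g]]] .
      then show ?thesis by (rule eventually_mono) simp
    next
      case False
      then have "eventually (\<lambda>n. \<not> (f n \<in> X n \<and> g n \<in> X n)) U" by (simp only: ev_not) simp
      then show ?thesis by (rule eventually_mono) blast
    qed
  qed
  moreover have "eventually (\<lambda>n. \<one>\<^bsub>G n\<^esub> \<in> X n) U"
    using subgroup.one_closed[OF N] unfolding cls_one cls_in_internal[OF one_seqs] .
  ultimately show ?thesis
  proof eventually_elim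
    case (elim n)
    interpret group "G n" by (rule grp)
    have div: "x \<otimes>\<^bsub>G n\<^esub> inv\<^bsub>G n\<^esub> y \<in> X n" if "x \<in> X n" "y \<in> X n" for x y
      using elim(1) that X[of n] by blast
    have inv: "inv\<^bsub>G n\<^esub> y \<in> X n" if "y \<in> X n" for y
      using div[OF elim(2) that] X[of n] that by (simp add: subset_iff)
    show ?case
    proof (rule subgroupI)
      show "x \<otimes>\<^bsub>G n\<^esub> y \<in> X n" if "x \<in> X n" "y \<in> X n" for x y
        using div[OF that(1) inv[OF that(2)]] X[of n] that by (simp add: subset_iff)
    qed (use X elim(2) inv in auto)
  qed
qed

text \<open>A finite quotient is itself a compactification. An abelian one may be infinite and comes
  with no compact topology, so \<open>N\<close> is taken down to almost all factors; their abelian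
  quotients supply the characters for \<open>character_compactification\<close>.\<close>

lemma no_quotient_of_trivial_compactification:
  assumes univ: "universal_internal_compactification U G H T b" "trivial_group H"
    and N: "internal U G N" "N \<lhd> GG" "N \<noteq> carrier GG"
    and quot: "finite (carrier (GG Mod N)) \<or> comm_group (GG Mod N)"
  shows False
  using quot
proof
  interpret N: normal N GG by (rule N(2))
  assume "finite (carrier (GG Mod N))"
  then have "carrier (GG Mod N) = {\<one>\<^bsub>GG Mod N\<^esub>}"
    using finite_quotient_compactification[OF N(1,2)] compactification_trivial_of_universal[OF univ] by blast
  then have "N #>\<^bsub>GG\<^esub> g = N" if "g \<in> carrier GG" for g
    using that by (auto simp: FactGroup_def RCOSETS_def)
  then have "carrier GG \<subseteq> N" using GG.rcos_self[OF _ N.subgroup_axioms] by blast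
  then show False using N(3) N.subset by blast
next
  interpret N: normal N GG by (rule N(2))
  assume "comm_group (GG Mod N)"
  then have comm: "contains_commutators GG N" by (simp add: N.comm_group_Mod_iff)
  obtain X where X: "\<And>n. X n \<subseteq> carrier (G n)" "N = internal_product U G X"
    using internalE[OF N(1)] by blast
  have sub: "eventually (\<lambda>n. subgroup (X n) (G n)) U"
    using N.subgroup_axioms X(1) unfolding X(2) by (rule eventually_subgroup_of_internal)
  have "\<not> eventually (\<lambda>n. X n = carrier (G n)) U"
  proof
    assume full: "eventually (\<lambda>n. X n = carrier (G n)) U"
    have "cls f \<in> N" if f: "f \<in> seqs" for f
      unfolding X(2) cls_in_internal[OF f] using full by (rule eventually_mono) (use f in simp)
    then show False using N(3) N.subset by (auto simp: carrier_GG)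
  qed
  then have proper: "eventually (\<lambda>n. X n \<noteq> carrier (G n)) U" by (simp only: ev_not) simp
  have "eventually (\<lambda>n. contains_commutators (G n) (X n)) U"
    unfolding contains_commutators_def
  proof (rule los_all2)
    fix f g assume f: "f \<in> seqs" and g: "g \<in> seqs"
    note s = mult_seqs[OF f g]
    note s' = mult_seqs[OF s inv_seqs[OF f]]
    have "cls f \<otimes>\<^bsub>GG\<^esub> cls g \<otimes>\<^bsub>GG\<^esub> inv\<^bsub>GG\<^esub> (cls f) \<otimes>\<^bsub>GG\<^esub> inv\<^bsub>GG\<^esub> (cls g) \<in> N"
      using comm cls_closed[OF f] cls_closed[OF g] unfolding contains_commutators_def by blast
    then show "eventually (\<lambda>n. f n \<otimes>\<^bsub>G n\<^esub> g n \<otimes>\<^bsub>G n\<^esub> inv\<^bsub>G n\<^esub> f n \<otimes>\<^bsub>G n\<^esub> inv\<^bsub>G n\<^esub> g n \<in> X n) U"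
      unfolding X(2) cls_inv[OF f] cls_inv[OF g] cls_mult[OF f g] cls_mult[OF s inv_seqs[OF f]]
        cls_mult[OF s' inv_seqs[OF g]] cls_in_internal[OF mult_seqs[OF s' inv_seqs[OF g]]] .
  qed
  with sub proper have ev: "eventually (\<lambda>n. subgroup (X n) (G n) \<and> X n \<noteq> carrier (G n) \<and>
      contains_commutators (G n) (X n)) U"
    by eventually_elim blast
  define Q where "Q n \<psi> \<longleftrightarrow> (\<forall>x\<in>carrier (G n). cmod (\<psi> x) = 1) \<and>
    (\<forall>x\<in>carrier (G n). \<forall>y\<in>carrier (G n). \<psi> (x \<otimes>\<^bsub>G n\<^esub> y) = \<psi> x * \<psi> y)" for n and \<psi> :: "'a \<Rightarrow> complex"
  define far where "far n \<psi> \<longleftrightarrow> (\<exists>x\<in>carrier (G n). 1 \<le> cmod (\<psi> x - 1))" for n and \<psi> :: "'a \<Rightarrow> complex"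
  \<comment> \<open>Indices at which \<open>X n\<close> lacks one of the three properties get the
    constant character 1, so that every index carries a character.\<close>
  have "\<exists>\<psi>. Q n \<psi> \<and> (subgroup (X n) (G n) \<and> X n \<noteq> carrier (G n) \<and>
      contains_commutators (G n) (X n) \<longrightarrow> far n \<psi>)" for n
  proof (cases "subgroup (X n) (G n) \<and> X n \<noteq> carrier (G n) \<and> contains_commutators (G n) (X n)")
    case True
    then obtain \<psi> :: "'a \<Rightarrow> complex" where \<psi>: "\<And>x. x \<in> carrier (G n) \<Longrightarrow> cmod (\<psi> x) = 1"
        "\<And>x y. x \<in> carrier (G n) \<Longrightarrow> y \<in> carrier (G n) \<Longrightarrow> \<psi> (x \<otimes>\<^bsub>G n\<^esub> y) = \<psi> x * \<psi> y"
        "\<exists>x\<in>carrier (G n). \<psi> x \<noteq> 1"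
      using group.nontrivial_character[OF grp fin, of "X n" n] by blast
    then show ?thesis
      using group.character_far_from_one[OF grp fin \<psi>(2,3)] by (intro exI[of _ \<psi>]) (auto simp: Q_def far_def)
  next
    case False
    then show ?thesis by (intro exI[of _ "\<lambda>x. 1"]) (auto simp: Q_def)
  qed
  then obtain \<psi> where \<psi>: "\<And>n. Q n (\<psi> n)"
      "\<And>n. subgroup (X n) (G n) \<and> X n \<noteq> carrier (G n) \<and> contains_commutators (G n) (X n) \<Longrightarrow> far n (\<psi> n)"
    by metis
  have far: "eventually (\<lambda>n. \<exists>x\<in>carrier (G n). 1 \<le> cmod (\<psi> n x - 1)) U"
    unfolding far_def[symmetric] using ev by (rule eventually_mono) (rule \<psi>(2))
  obtain K :: "complex monoid" and S \<rho> where "internal_compactification U G K S \<rho>" "carrier K \<noteq> {\<one>\<^bsub>K\<^esub>}"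
    by (rule character_compactification[OF _ _ far]) (use \<psi>(1) in \<open>auto simp: Q_def\<close>)
  then show False using compactification_trivial_of_universal[OF univ] by blast
qed

end

theorem theorem4p8:
  fixes U :: "nat filter" and G :: "nat \<Rightarrow> 'a monoid"
  assumes "nonprincipal_ultrafilter U"
    and "\<And>n. group (G n)"
    and "\<And>n. finite (carrier (G n))"
  shows "let
     GG = ultraproduct U G;
     \<mu> = internal_measure U G;
     a = (\<forall>A. internal U G A \<and> product_free GG A \<longrightarrow> \<mu> A = 0);
     b = (\<exists>H T \<beta>. universal_internal_compactification U G H T \<beta> \<and> trivial_group H);
     c = (\<forall>A B. internal U G A \<and> internal U G B \<and> non_null U G A \<and> non_null U G B
            \<longrightarrow> \<mu> (A <#>\<^bsub>GG\<^esub> B) = 1);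
     d = (\<forall>A B C. internal U G A \<and> internal U G B \<and> internal U G C \<and>
            non_null U G A \<and> non_null U G B \<and> non_null U G C
            \<longrightarrow> carrier GG = A <#>\<^bsub>GG\<^esub> B <#>\<^bsub>GG\<^esub> C);
     e = (\<not> (\<exists>N. internal U G N \<and> N \<lhd> GG \<and> N \<noteq> carrier GG \<and>
            (finite (carrier (GG Mod N)) \<or> comm_group (GG Mod N))));
     f = ultra_quasirandom U G
   in (a \<longleftrightarrow> b) \<and> (b \<longleftrightarrow> c) \<and> (c \<longleftrightarrow> d) \<and> (d \<longleftrightarrow> e) \<and> (e \<longleftrightarrow> f)"
proof -
  interpret finite_group_ultraproduct U G by (rule finite_group_ultraproduct.intro) (fact assms)+
  define a where "a = (\<forall>A. internal U G A \<and> product_free GG A \<longrightarrow> internal_measure U G A = 0)"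
  define b where "b = (\<exists>H T \<beta>. universal_internal_compactification U G H T \<beta> \<and> trivial_group H)"
  define c where "c = (\<forall>A B. internal U G A \<and> internal U G B \<and> non_null U G A \<and> non_null U G B
    \<longrightarrow> internal_measure U G (A <#>\<^bsub>GG\<^esub> B) = 1)"
  define d where "d = (\<forall>A B C. internal U G A \<and> internal U G B \<and> internal U G C \<and>
    non_null U G A \<and> non_null U G B \<and> non_null U G C \<longrightarrow> carrier GG = A <#>\<^bsub>GG\<^esub> B <#>\<^bsub>GG\<^esub> C)"
  define e where "e = (\<not> (\<exists>N. internal U G N \<and> N \<lhd> GG \<and> N \<noteq> carrier GG \<and>
    (finite (carrier (GG Mod N)) \<or> comm_group (GG Mod N))))"
  define f where "f = ultra_quasirandom U G"
  have "c \<Longrightarrow> d" unfolding c_def d_def by (intro allI impI triple_product_of_measure_one) blast+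
  moreover have "d \<Longrightarrow> a" unfolding d_def a_def by (intro allI impI product_free_null_of_triple_product) blast+
  moreover have "a \<Longrightarrow> b"
    unfolding a_def b_def
    by (intro trivial_universal_compactification compactification_trivial_of_product_free_null) blast+
  moreover have "b \<Longrightarrow> e" unfolding b_def e_def using no_quotient_of_trivial_compactification by blast
  moreover have "e \<Longrightarrow> f" unfolding e_def f_def by (rule ultra_quasirandom_of_no_quotient)
  moreover have "f \<Longrightarrow> c" unfolding f_def c_def by (intro allI impI measure_one_of_ultra_quasirandom) blast+
  ultimately have "(a \<longleftrightarrow> b) \<and> (b \<longleftrightarrow> c) \<and> (c \<longleftrightarrow> d) \<and> (d \<longleftrightarrow> e) \<and> (e \<longleftrightarrow> f)" by argo
  then show ?thesis unfolding Let_def a_def b_def c_def d_def e_def f_def .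
qed

end
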